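(* The functions associated to the cyclic $(2,7)$-curve $y^2=x^7+\lambda_6x^6+\lambda_5x^5+\lambda_4x^4+\lambda_3x^3+\lambda_2x^2+\lambda_1x+\lambda_0$ satisfy the following complete set of quadratic 3-index relations (identities of meromorphic functions of $\boldsymbol u\in\mathbb C^3$), where $\Delta=\wp_{11}\wp_{33}-\wp_{12}\wp_{23}-\wp_{13}^2+\wp_{13}\wp_{22}$: $\wp_{333}^2=4\wp_{33}^3+4\lambda_4+4\lambda_5\wp_{33}+4\lambda_6\wp_{33}^2-4\wp_{13}+4\wp_{22}+4\wp_{33}\wp_{23}$ $\wp_{233}\wp_{333}=4\wp_{23}\wp_{33}^2+2\lambda_3+2\lambda_5\wp_{23}+4\lambda_6\wp_{33}\wp_{23}+2\wp_{12}+4\wp_{33}\wp_{13}-2\wp_{33}\wp_{22}+2\wp_{23}^2$ $\wp_{233}^2=8\wp_{23}\wp_{13}-4\wp_{23}\wp_{22}+4\wp_{11}+4\lambda_2+4\wp_{23}^2\wp_{33}+4\lambda_6\wp_{23}^2$ $\wp_{223}\wp_{333}=-4\wp_{33}\wp_{12}-2\wp_{23}\wp_{13}+4\wp_{23}\wp_{22}+4\lambda_6\wp_{33}\wp_{13}+2\lambda_5\wp_{33}\wp_{23}+4\lambda_4\wp_{23}-2\wp_{11}+2\lambda_5\wp_{13}-2\lambda_3\wp_{33}+2\wp_{22}\wp_{33}^2+2\wp_{23}^2\wp_{33}$ $\wp_{133}\wp_{333}=-2\wp_{33}\wp_{12}+2\wp_{23}\wp_{13}+4\lambda_6\wp_{33}\wp_{13}-2\wp_{11}+2\lambda_5\wp_{13}+4\wp_{13}\wp_{33}^2$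 $\wp_{223}\wp_{233}=2\lambda_1+4\lambda_6\wp_{23}\wp_{13}+2\wp_{22}\wp_{23}\wp_{33}+2\wp_{23}^3-2\wp_{13}\wp_{22}+4\wp_{13}^2-4\wp_{11}\wp_{33}+2\lambda_5\wp_{23}^2-4\lambda_2\wp_{33}+2\lambda_3\wp_{23}$ $\wp_{222}\wp_{333}=-16\wp_{13}^2-4\wp_{22}^2+20\wp_{13}\wp_{22}-2\wp_{12}\wp_{23}+6\wp_{22}\wp_{23}\wp_{33}+4\wp_{11}\wp_{33}-2\wp_{23}^3-2\lambda_5\lambda_3-8\lambda_6\wp_{23}\wp_{13}-2\lambda_5^2\wp_{23}-2\lambda_5\wp_{12}-4\lambda_4\wp_{22}+16\lambda_4\wp_{13}-4\lambda_3\wp_{33}^2+8\lambda_4\wp_{33}\wp_{23}-2\lambda_5\wp_{33}\wp_{22}-4\lambda_6\wp_{33}\wp_{12}+8\lambda_5\wp_{33}\wp_{13}+8\lambda_6\wp_{23}\wp_{22}+8\lambda_6\lambda_4\wp_{23}-4\lambda_6\lambda_3\wp_{33}-4\lambda_5\wp_{23}^2-2\lambda_3\wp_{23}$ $\wp_{133}\wp_{233}=2\lambda_1+4\lambda_6\wp_{23}\wp_{13}+4\wp_{13}\wp_{23}\wp_{33}-2\wp_{13}\wp_{22}-2\wp_{12}\wp_{23}+4\wp_{13}^2$ $\wp_{123}\wp_{333}=2\wp_{11}\wp_{33}-4\wp_{13}^2+4\wp_{13}\wp_{22}+4\lambda_4\wp_{13}+2\wp_{12}\wp_{33}^2+2\wp_{13}\wp_{23}\wp_{33}+2\lambda_5\wp_{33}\wp_{13}$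 $\wp_{223}^2=4\wp_{33}\Delta-4\wp_{23}\wp_{11}-4\wp_{13}\wp_{12}+4\lambda_0-4\lambda_3\wp_{33}\wp_{23}+4\lambda_6\wp_{13}^2+4\lambda_5\wp_{23}\wp_{13}+4\lambda_2\wp_{33}^2+4\lambda_4\wp_{23}^2-4\lambda_1\wp_{33}+4\wp_{22}\wp_{23}^2$ $\wp_{133}\wp_{223}=4\lambda_0-2\wp_{23}\wp_{11}-4\wp_{13}\wp_{12}+4\lambda_6\wp_{13}^2+2\lambda_5\wp_{23}\wp_{13}-2\lambda_1\wp_{33}+2\wp_{13}\wp_{23}^2+2\wp_{13}\wp_{33}\wp_{22}$ $\wp_{133}^2=4\wp_{13}^2\wp_{33}-4\wp_{13}\wp_{12}+4\lambda_0+4\lambda_6\wp_{13}^2$ $\wp_{222}\wp_{233}=-8\wp_{33}\Delta-4\wp_{23}\wp_{11}+4\lambda_6\lambda_3\wp_{23}-4\lambda_6\Delta-4\lambda_6\wp_{13}^2-8\lambda_6\lambda_2\wp_{33}+2\lambda_5\wp_{23}\wp_{22}+8\wp_{13}\wp_{12}-2\wp_{22}\wp_{12}-4\lambda_2\lambda_5+4\lambda_3\wp_{33}\wp_{23}+2\wp_{22}^2\wp_{33}+2\wp_{22}\wp_{23}^2-8\lambda_2\wp_{33}^2+4\lambda_6\wp_{13}\wp_{22}-4\lambda_6\wp_{11}\wp_{33}-4\lambda_1\wp_{33}-4\lambda_5\wp_{11}+8\lambda_3\wp_{13}-2\lambda_3\wp_{22}-4\lambda_2\wp_{23}$ $\wp_{123}\wp_{233}=2\wp_{13}\wp_{12}+2\lambda_5\wp_{23}\wp_{13}-2\lambda_1\wp_{33}+2\wp_{13}\wp_{23}^2+2\wp_{12}\wp_{33}\wp_{23}+2\lambda_3\wp_{13}$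 $\wp_{122}\wp_{333}=4\wp_{33}\Delta-2\lambda_5\wp_{33}\wp_{12}-8\lambda_6\wp_{13}^2+8\lambda_6\lambda_4\wp_{13}+8\lambda_4\wp_{33}\wp_{13}+6\wp_{13}\wp_{12}-4\lambda_5\wp_{23}\wp_{13}-2\lambda_5^2\wp_{13}-4\lambda_4\wp_{12}+2\lambda_5\wp_{11}+2\lambda_3\wp_{13}+8\lambda_6\wp_{13}\wp_{22}+4\lambda_6\wp_{11}\wp_{33}-2\wp_{13}\wp_{23}^2+2\wp_{13}\wp_{33}\wp_{22}+4\wp_{12}\wp_{33}\wp_{23}-4\wp_{22}\wp_{12}+4\wp_{23}\wp_{11}$ $\wp_{113}\wp_{333}=-2\wp_{33}\Delta+2\wp_{23}\wp_{11}+2\wp_{13}\wp_{12}+2\wp_{13}^2\wp_{33}+2\wp_{11}\wp_{33}^2+2\lambda_3\wp_{13}$ $\wp_{222}\wp_{223}=-4\lambda_6\wp_{23}\wp_{11}-4\wp_{23}\Delta+4\lambda_5\wp_{12}\wp_{23}-4\lambda_5\wp_{11}\wp_{33}+4\lambda_4\wp_{23}\wp_{22}-2\lambda_3\wp_{33}\wp_{22}-4\lambda_6\lambda_1\wp_{33}+2\lambda_5\lambda_3\wp_{23}-4\lambda_2\wp_{33}\wp_{23}-4\lambda_2\lambda_5\wp_{33}-8\lambda_4\wp_{11}+2\lambda_3\wp_{23}^2+4\lambda_3\wp_{12}+8\lambda_2\wp_{13}-8\lambda_2\wp_{22}-2\lambda_1\wp_{23}-8\lambda_0\wp_{33}+4\wp_{22}^2\wp_{23}+4\lambda_5\wp_{13}^2-6\wp_{22}\wp_{11}+2\wp_{12}^2+2\lambda_3^2-8\lambda_2\lambda_4-2\lambda_5\lambda_1$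 $\wp_{133}\wp_{222}=-4\lambda_6\wp_{23}\wp_{11}-4\wp_{23}\Delta+2\lambda_5\wp_{12}\wp_{23}-4\lambda_6\lambda_1\wp_{33}-2\wp_{12}\wp_{23}^2-2\lambda_1\wp_{23}-8\lambda_0\wp_{33}+4\lambda_5\wp_{13}^2-8\wp_{13}\wp_{11}+2\wp_{22}\wp_{11}-2\lambda_5\lambda_1+4\wp_{13}\wp_{23}\wp_{22}+2\wp_{12}\wp_{33}\wp_{22}-4\lambda_1\wp_{33}^2$ $\wp_{123}\wp_{223}=2\wp_{23}\Delta+2\wp_{12}\wp_{23}^2-4\lambda_0\wp_{33}-2\wp_{13}\wp_{11}+2\lambda_5\wp_{13}^2-2\lambda_3\wp_{33}\wp_{13}+4\lambda_4\wp_{23}\wp_{13}+2\wp_{13}\wp_{23}\wp_{22}+2\lambda_1\wp_{33}^2$ $\wp_{123}\wp_{133}=-4\lambda_0\wp_{33}-2\wp_{13}\wp_{11}+2\wp_{13}^2\wp_{23}+2\wp_{12}\wp_{13}\wp_{33}+2\lambda_5\wp_{13}^2$ $\wp_{122}\wp_{233}=2\lambda_5\wp_{12}\wp_{23}-2\lambda_5\wp_{11}\wp_{33}-4\lambda_6\lambda_1\wp_{33}+2\wp_{12}\wp_{23}^2-2\lambda_3\wp_{12}+4\lambda_2\wp_{13}-4\lambda_1\wp_{23}-2\lambda_5\wp_{13}^2+4\wp_{13}\wp_{11}-2\wp_{12}^2-2\lambda_5\lambda_1+4\lambda_6\wp_{13}\wp_{12}+4\lambda_6\lambda_3\wp_{13}+4\lambda_3\wp_{33}\wp_{13}+2\wp_{12}\wp_{33}\wp_{22}+2\lambda_5\Delta-4\lambda_1\wp_{33}^2$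 $\wp_{113}\wp_{233}=-2\wp_{23}\Delta+4\lambda_2\wp_{13}-2\lambda_1\wp_{23}+4\wp_{13}\wp_{11}+2\wp_{13}^2\wp_{23}+2\wp_{11}\wp_{23}\wp_{33}$ $\wp_{112}\wp_{333}=4\lambda_6\wp_{23}\wp_{11}+2\wp_{23}\Delta-2\lambda_5\wp_{11}\wp_{33}-2\lambda_3\wp_{12}-2\wp_{13}^2\wp_{23}-2\lambda_5\wp_{13}^2+4\wp_{13}\wp_{11}-2\wp_{22}\wp_{11}-2\wp_{12}^2+4\lambda_6\wp_{13}\wp_{12}+4\lambda_6\lambda_3\wp_{13}+4\lambda_3\wp_{33}\wp_{13}+4\wp_{12}\wp_{13}\wp_{33}+2\wp_{11}\wp_{23}\wp_{33}+2\lambda_5\Delta$ $\wp_{222}^2=-8\lambda_3\wp_{23}\wp_{13}+8\wp_{23}\lambda_5\lambda_2-8\lambda_5\lambda_3\wp_{13}+4\wp_{23}\wp_{22}\lambda_3-16\lambda_6\lambda_4\wp_{11}-16\lambda_6\lambda_2\wp_{22}+4\lambda_5\lambda_3\wp_{22}-16\lambda_2\lambda_4\wp_{33}-8\wp_{33}\lambda_1\lambda_5+8\lambda_3\wp_{12}\lambda_6+16\lambda_0\wp_{33}^2-4\wp_{12}^2\wp_{33}-4\wp_{11}\wp_{23}^2+8\wp_{12}\wp_{13}\wp_{23}-8\lambda_1\wp_{33}\wp_{23}+16\lambda_6\wp_{13}\wp_{11}+16\lambda_6\lambda_2\wp_{13}+4\wp_{11}\wp_{22}\wp_{33}-4\w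p_{13}^2\wp_{22}+16\lambda_1\wp_{13}-16\lambda_1\lambda_4-16\lambda_6\lambda_4\lambda_2-16\wp_{22}\wp_{11}\lambda_6-16\wp_{22}\lambda_2\wp_{33}+4\lambda_5\wp_{22}\wp_{12}+4\lambda_6\lambda_3^2+4\lambda_5^2\lambda_2+4\wp_{23}^2\lambda_2+4\wp_{22}^2\lambda_4+4\wp_{12}^2\lambda_6+4\lambda_5^2\wp_{11}+4\lambda_3^2\wp_{33}-16\lambda_4\Delta-8\lambda_3\wp_{11}+32\wp_{13}\Delta-20\wp_{22}\Delta-8\lambda_5\wp_{13}\wp_{12}+4\wp_{22}^3-16\lambda_1\wp_{22}+16\lambda_2\wp_{33}\wp_{13}-8\wp_{12}\wp_{11}+16\lambda_4\wp_{13}^2$ $\wp_{123}\wp_{222}=-2\wp_{33}\lambda_1\lambda_5+4\wp_{13}\wp_{22}\lambda_4+4\lambda_4\wp_{11}\wp_{33}-2\wp_{23}\lambda_5\wp_{11}-4\lambda_1\wp_{22}+8\wp_{13}\Delta-2\wp_{22}\Delta-2\wp_{12}\wp_{11}+4\wp_{12}\wp_{13}\wp_{23}-2\lambda_1\wp_{33}\wp_{23}+2\wp_{11}\wp_{22}\wp_{33}+4\lambda_4\wp_{13}^2+8\lambda_0\wp_{33}^2-2\wp_{12}^2\wp_{33}-2\wp_{11}\wp_{23}^2-2\lambda_3\wp_{33}\wp_{12}+2\wp_{13}\wp_{22}^2-2\lambda_3\wp_{11}-4\lambda_4\Delta-2\wp_{13}^2\wp_{22}+4\lambda_1\wp_{13}-4\lambda_1\lambda_4+2\wp_{12}\wp_{23}\wp_{22}$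 $\wp_{123}^2=4\wp_{13}\Delta+4\wp_{12}\wp_{13}\wp_{23}+4\lambda_4\wp_{13}^2+4\lambda_0\wp_{33}^2$ $\wp_{122}\wp_{223}=-4\lambda_1\lambda_4-2\wp_{33}\lambda_1\lambda_5+4\lambda_5\wp_{13}\wp_{12}+4\lambda_3\wp_{23}\wp_{13}+4\wp_{13}\wp_{22}\lambda_4-4\lambda_1\wp_{22}-8\lambda_6\lambda_0\wp_{33}-4\lambda_6\wp_{13}\wp_{11}-4\lambda_5\lambda_0-12\wp_{13}\Delta+4\wp_{22}\Delta-4\wp_{12}\wp_{13}\wp_{23}+2\wp_{13}^2\wp_{22}+6\lambda_1\wp_{13}-8\lambda_0\wp_{23}-8\lambda_4\wp_{13}^2-8\lambda_0\wp_{33}^2+2\wp_{12}^2\wp_{33}+2\wp_{11}\wp_{23}^2-4\lambda_2\wp_{33}\wp_{13}-2\wp_{11}\wp_{22}\wp_{33}-2\lambda_3\wp_{11}+2\lambda_5\lambda_3\wp_{13}+4\wp_{12}\wp_{23}\wp_{22}$ $\wp_{122}\wp_{133}=-4\wp_{13}\Delta+2\wp_{12}\wp_{11}-4\lambda_5\lambda_0+2\wp_{12}^2\wp_{33}+2\wp_{13}^2\wp_{22}-8\lambda_6\lambda_0\wp_{33}+2\lambda_5\wp_{13}\wp_{12}-4\lambda_6\wp_{13}\wp_{11}+2\lambda_1\wp_{13}-8\lambda_0\wp_{23}-8\lambda_0\wp_{33}^2$ $\wp_{113}\wp_{223}=-4\wp_{13}\Delta+2\wp_{11}\wp_{23}^2+2\lambda_3\wp_{23}\wp_{13}+2\lambda_1\wp_{33}\wp_{23}-4\lambda_2\wp_{33}\wp_{13}+2\wp_{13}^2\wp_{22}+2\lambda_1\wp_{13}-4\lambda_0\wp_{23}$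 $\wp_{113}\wp_{133}=-2\wp_{13}\Delta+2\wp_{11}\wp_{13}\wp_{33}+2\wp_{13}^3+2\lambda_1\wp_{13}-4\lambda_0\wp_{23}$ $\wp_{112}\wp_{233}=8\wp_{13}\Delta-2\wp_{22}\Delta-4\wp_{12}\wp_{11}+4\wp_{12}\wp_{13}\wp_{23}-4\lambda_1\wp_{33}\wp_{23}+8\lambda_2\wp_{33}\wp_{13}+8\lambda_6\wp_{13}\wp_{11}+8\lambda_6\lambda_2\wp_{13}+2\wp_{11}\wp_{22}\wp_{33}-4\lambda_6\lambda_1\wp_{23}-4\lambda_2\wp_{12}-2\wp_{13}^2\wp_{22}-4\lambda_1\wp_{13}+2\lambda_1\wp_{22}$ $\wp_{111}\wp_{333}=2\lambda_5\wp_{13}\wp_{12}+2\lambda_3\wp_{23}\wp_{13}+6\wp_{11}\wp_{13}\wp_{33}-4\lambda_4\wp_{11}\wp_{33}+2\wp_{23}\lambda_5\wp_{11}-4\wp_{12}\wp_{13}\wp_{23}-2\wp_{11}\wp_{22}\wp_{33}+2\wp_{13}^2\wp_{22}-4\lambda_4\wp_{13}^2+2\wp_{12}^2\wp_{33}+2\wp_{11}\wp_{23}^2+2\lambda_5\lambda_3\wp_{13}+4\lambda_4\Delta-10\wp_{13}\Delta+4\wp_{22}\Delta-2\wp_{13}^3+2\lambda_3\wp_{33}\wp_{12}$ $\wp_{122}\wp_{222}=-8\lambda_6\lambda_4\lambda_1-4\lambda_2\wp_{33}\wp_{12}-6\lambda_1\wp_{33}\wp_{22}+4\lambda_3\wp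_{13}\wp_{22}-16\lambda_0\wp_{22}+2\lambda_1\wp_{23}^2+4\lambda_5\lambda_1\wp_{23}+8\lambda_6\lambda_1\wp_{13}-8\lambda_5\lambda_0\wp_{33}+4\lambda_4\wp_{22}\wp_{12}-8\lambda_1\lambda_4\wp_{33}-4\lambda_6\wp_{12}\wp_{11}-8\lambda_6\lambda_1\wp_{22}-4\lambda_6\lambda_3\wp_{11}+4\wp_{12}\wp_{22}^2+2\lambda_5\wp_{12}^2-4\wp_{12}\Delta-16\lambda_4\lambda_0-2\lambda_1\wp_{12}-4\lambda_3\Delta-4\lambda_2\wp_{11}+2\lambda_5\lambda_3\wp_{12}+16\lambda_0\wp_{13}+2\lambda_5^2\lambda_1-2\lambda_5\wp_{22}\wp_{11}-2\lambda_3\lambda_1$ $\wp_{122}\wp_{123}=2\wp_{12}^2\wp_{23}-8\lambda_4\lambda_0+2\wp_{12}\Delta+2\wp_{11}^2+2\wp_{12}\wp_{22}\wp_{13}+4\lambda_4\wp_{13}\wp_{12}-2\lambda_5\wp_{13}\wp_{11}-2\lambda_1\wp_{33}\wp_{13}-4\lambda_5\lambda_0\wp_{33}-8\lambda_0\wp_{22}+2\lambda_3\wp_{13}^2+8\lambda_0\wp_{13}$ $\wp_{113}\wp_{222}=2\lambda_3\wp_{11}\wp_{33}+8\lambda_0\wp_{33}\wp_{23}-2\wp_{12}^2\wp_{23}-2\lambda_3\lambda_1-4\wp_{12}\Delta-4\wp_{11}^2-8\lambda_1\wp_{33}\wp_{13}-4\lambda_2\wp_{33}\wp_{12}+2\lambda_1\wp_{33}\wp_{22}+2\lambda_3\wp_{13}\wp_{22}+2\lambda_3\wp_{13}^2-2\lambda_1\wp_{12}+4\wp_{12}\wp_{22}\wp_{13}+2\wp_{11}\wp_{22}\wp_{23}-2\lambda_3\Delta-4\lambda_2\wp_{11}$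 $\wp_{113}\wp_{123}=4\lambda_0\wp_{33}\wp_{23}+2\wp_{13}^2\wp_{12}+2\wp_{11}\wp_{13}\wp_{23}-2\lambda_1\wp_{33}\wp_{13}+2\lambda_3\wp_{13}^2$ $\wp_{112}\wp_{223}=-8\lambda_0\wp_{33}\wp_{23}+2\wp_{12}^2\wp_{23}-2\lambda_3\lambda_1-4\wp_{11}^2+2\wp_{11}\wp_{22}\wp_{23}+4\lambda_5\wp_{13}\wp_{11}+4\lambda_1\wp_{33}\wp_{13}+4\lambda_2\lambda_5\wp_{13}-8\lambda_6\lambda_0\wp_{23}+4\lambda_2\wp_{23}\wp_{13}+2\lambda_3\wp_{13}\wp_{22}-4\lambda_2\wp_{11}+4\lambda_6\lambda_1\wp_{13}+4\lambda_0\wp_{22}-2\lambda_1\wp_{23}^2-4\lambda_3\wp_{13}^2-4\lambda_1\wp_{12}-8\lambda_0\wp_{13}-2\lambda_5\lambda_1\wp_{23}$ $\wp_{112}\wp_{133}=-8\lambda_0\wp_{33}\wp_{23}+2\wp_{13}^2\wp_{12}-2\wp_{12}\Delta+2\wp_{11}\wp_{33}\wp_{12}+4\lambda_1\wp_{33}\wp_{13}-8\lambda_6\lambda_0\wp_{23}+4\lambda_6\lambda_1\wp_{13}+4\lambda_0\wp_{22}-2\lambda_1\wp_{12}-8\lambda_0\wp_{13}$ $\wp_{111}\wp_{233}=-2\lambda_3\wp_{11}\wp_{33}-2\wp_{13}^2\wp_{12}+2\wp_{12}\Delta+4\wp_{11}\wp_{13}\wp_{23}+2\wp_{11}\wp_{33}\wp_{12}+4\lambda_2\lambda_5\wp_{13}+4\lambda_2\wp_{23}\wp_{13}+4\lambda_2\wp_{33}\wp_{12}-2\lambda_1\wp_{33}\wp_{22}-2\lambda_5\lambda_1\wp_{23}+4\lambda_5\wp_{13}\wp_{11}+4\lambda_1\wp_{33}\wp_{13}-2\lambda_1\wp_{23}^2-2\lambda_3\wp_{13}^2+2\lambda_3\Delta$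 $\wp_{122}^2=-16\lambda_6\lambda_4\lambda_0+4\wp_{12}^2\wp_{22}+4\wp_{11}\Delta+4\lambda_5^2\lambda_0-8\lambda_3\lambda_0-4\lambda_5\wp_{12}\wp_{11}-4\lambda_1\wp_{11}+4\lambda_2\wp_{13}^2-16\lambda_4\lambda_0\wp_{33}-4\lambda_1\wp_{23}\wp_{13}+8\lambda_5\lambda_0\wp_{23}-8\lambda_0\wp_{33}\wp_{22}-8\lambda_0\wp_{12}+4\lambda_3\wp_{13}\wp_{12}-4\lambda_1\wp_{33}\wp_{12}+4\lambda_6\wp_{11}^2+8\lambda_0\wp_{23}^2+16\lambda_6\lambda_0\wp_{13}+4\lambda_4\wp_{12}^2-16\lambda_6\lambda_0\wp_{22}$ $\wp_{113}\wp_{122}=2\wp_{13}\wp_{12}^2-4\lambda_3\lambda_0+2\wp_{11}\wp_{13}\wp_{22}-8\lambda_0\wp_{33}\wp_{13}+4\lambda_0\wp_{23}^2-2\lambda_1\wp_{11}+4\lambda_2\wp_{13}^2-4\lambda_1\wp_{23}\wp_{13}+4\lambda_0\wp_{33}\wp_{22}-4\lambda_0\wp_{12}+2\lambda_3\wp_{13}\wp_{12}-2\lambda_1\wp_{33}\wp_{12}$ $\wp_{113}^2=4\wp_{11}\wp_{13}^2+4\lambda_0\wp_{23}^2+4\lambda_2\wp_{13}^2-4\lambda_1\wp_{23}\wp_{13}$ $\wp_{112}\wp_{222}=2\wp_{11}\wp_{22}^2+2\wp_{12}^2\wp_{22}-4\lambda_6\lambda_3\lambda_1-8\wp_{11}\Delta-8\lambda_3\lambda_0-8\lambda_2\wp_{11}\wp_{33}-4\lambda_3\lambda_1\wp_{33}-8\lambda_6\lambda_2\wp_{11}+2\lambda_3\wp_{22}\wp_{12}-2\lambda_5\lambda_1\wp_{22}+8\lambda_5\lambda_1\wp_{13}-8\lambda_0\wp_{23}^2-4\lambda_1\wp_{11}+8\lambda_1\wp_{23}\wp_{13}-8\lambda_5\lambda_0\wp_{23}-8\lambda_0\wp_{12}-4\lambda_1\wp_{33}\wp_{12}+4\lambda_2\wp_{12}\wp_{23}+4\lambda_5\wp_{12}\wp_{11}-2\lambda_1\wp_{23}\wp_{22}-4\lambda_6\lambda_1\wp_{12}-8\lambda_6\wp_{11}^2+4\lambda_2\lambda_5\wp_{12}$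 $\wp_{112}\wp_{123}=2\wp_{13}\wp_{12}^2-4\lambda_3\lambda_0+2\wp_{11}\wp_{23}\wp_{12}+2\lambda_5\lambda_1\wp_{13}-4\lambda_0\wp_{23}^2-2\lambda_1\wp_{11}+2\lambda_1\wp_{23}\wp_{13}-4\lambda_5\lambda_0\wp_{23}-4\lambda_0\wp_{12}+2\lambda_3\wp_{13}\wp_{12}$ $\wp_{111}\wp_{223}=-2\wp_{13}\wp_{12}^2+4\wp_{11}\Delta+2\wp_{11}\wp_{13}\wp_{22}+4\wp_{11}\wp_{23}\wp_{12}-4\lambda_2\wp_{11}\wp_{33}-2\lambda_3^2\wp_{13}+2\lambda_3\lambda_1\wp_{33}+8\lambda_4\wp_{13}\wp_{11}-2\lambda_3\wp_{23}\wp_{11}-4\lambda_1\lambda_4\wp_{23}+2\lambda_5\lambda_1\wp_{13}+6\lambda_1\wp_{23}\wp_{13}-4\lambda_5\lambda_0\wp_{23}-4\lambda_0\wp_{33}\wp_{22}-4\lambda_3\wp_{13}\wp_{12}+4\lambda_1\wp_{33}\wp_{12}+8\lambda_2\lambda_4\wp_{13}+8\lambda_2\Delta-4\lambda_1\wp_{23}\wp_{22}+8\lambda_0\wp_{33}\wp_{13}+8\lambda_2\wp_{12}\wp_{23}-4\lambda_0\wp_{23}^2$ $\wp_{111}\wp_{133}=2\wp_{11}^2\wp_{33}-2\wp_{11}\Delta+8\lambda_0\wp_{33}\wp_{13}+2\wp_{11}\wp_{13}^2+2\lambda_5\lambda_1\wp_{13}-4\lambda_0\wp_{23}^2+2\lambda_1\wp_{23}\wp_{13}-4\lambda_5\lambda_0\wp_{23}-4\lambda_0\wp_{33}\wp_{22}+2\lambda_1\wp_{33}\wp_{12}$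 $\wp_{112}\wp_{122}=2\wp_{11}\wp_{12}\wp_{22}+2\lambda_1^2-8\lambda_2\lambda_0-8\lambda_6\lambda_3\lambda_0+2\wp_{12}^3-8\lambda_3\lambda_0\wp_{33}+2\lambda_5\lambda_1\wp_{12}+4\lambda_1\wp_{13}^2-8\lambda_6\lambda_0\wp_{12}+4\lambda_2\wp_{13}\wp_{12}+8\lambda_5\lambda_0\wp_{13}-4\lambda_1\wp_{11}\wp_{33}-2\lambda_1\wp_{13}\wp_{22}-8\lambda_0\wp_{33}\wp_{12}-4\lambda_6\lambda_1\wp_{11}-8\lambda_0\wp_{11}-4\lambda_5\lambda_0\wp_{22}+2\lambda_3\wp_{12}^2$ $\wp_{112}\wp_{113}=4\wp_{11}\wp_{12}\wp_{13}+2\lambda_1^2-8\lambda_2\lambda_0+4\lambda_0\wp_{23}\wp_{22}+2\lambda_1\Delta-8\lambda_0\wp_{23}\wp_{13}+6\lambda_1\wp_{13}^2+4\lambda_2\wp_{13}\wp_{12}-2\lambda_1\wp_{11}\wp_{33}-4\lambda_1\wp_{13}\wp_{22}-8\lambda_0\wp_{11}$ $\wp_{111}\wp_{222}=18\lambda_1\wp_{13}\wp_{22}+8\lambda_3\wp_{13}\wp_{11}+2\lambda_1\wp_{11}\wp_{33}+6\wp_{11}\wp_{12}\wp_{22}-16\lambda_4\lambda_0\wp_{23}+8\lambda_4\wp_{12}\wp_{11}+8\lambda_3\lambda_0\wp_{33}-14\lambda_1\wp_{13}^2-4\lambda_3\wp_{12}^2+2\lambda_1\Delta-4\lambda_5\wp_{11}^2-16\lambda_0\wp_{23}\wp_{22}+16\lambda_0\wp_{23}\wp_{13}+16\lambda_1\lambda_4\wp_{13}+8\lambda_0\wp_{33}\wp_{12}-2\lambda_5\lambda_1\wp_{12}-2\lambda_3\lambda_1\wp_{23}-4\lambda_2\lambda_5\wp_{11}-4\lambda_2\wp_{23}\wp_{11}+8\lambda_2\lambda_4\wp_{12}-2\lambda_3\wp_{22}\wp_{11}-2\lambda_3^2\wp_{12}-4\lambda_1\lambda_4\wp_{22}+8\lambda_2\wp_{22}\wp_{12}-4\lambda_1\wp_{22}^2-8\lambda_2\wp_{13}\wp_{12}-2\lambda_5\lambda_3\lambda_1-2\wp_{12}^3$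 $\wp_{111}\wp_{123}=2\wp_{11}^2\wp_{23}+2\wp_{11}\wp_{12}\wp_{13}-8\lambda_0\wp_{23}\wp_{22}+8\lambda_0\wp_{23}\wp_{13}+4\lambda_1\lambda_4\wp_{13}+4\lambda_3\lambda_0\wp_{33}-4\lambda_1\wp_{13}^2+2\lambda_1\wp_{11}\wp_{33}+4\lambda_1\wp_{13}\wp_{22}-8\lambda_4\lambda_0\wp_{23}+2\lambda_3\wp_{13}\wp_{11}+4\lambda_0\wp_{33}\wp_{12}$ $\wp_{112}^2=-16\lambda_0\Delta+4\lambda_6\lambda_1^2-16\lambda_6\lambda_2\lambda_0+4\wp_{11}\wp_{12}^2+8\lambda_1\wp_{13}\wp_{12}-16\lambda_6\lambda_0\wp_{11}-16\lambda_0\wp_{12}\wp_{23}-16\lambda_2\lambda_0\wp_{33}+4\lambda_0\wp_{22}^2-4\lambda_1\wp_{22}\wp_{12}+4\lambda_2\wp_{12}^2+4\lambda_1^2\wp_{33}$ $\wp_{111}\wp_{122}=2\wp_{11}^2\wp_{22}-4\lambda_5\lambda_3\lambda_0+2\wp_{11}\wp_{12}^2-8\lambda_3\lambda_0\wp_{23}-4\lambda_1\wp_{23}\wp_{11}+4\lambda_2\wp_{13}\wp_{11}+8\lambda_0\wp_{11}\wp_{33}-2\lambda_1\wp_{13}\wp_{12}+4\lambda_1\lambda_4\wp_{12}-2\lambda_5\lambda_1\wp_{11}-4\lambda_5\lambda_0\wp_{12}-8\lambda_4\lambda_0\wp_{22}-8\lambda_0\wp_{12}\wp_{23}+8\lambda_2\lambda_0\wp_{33}-8\lambda_0\wp_{22}^2+4\lambda_1\wp_{22}\wp_{12}-2\lambda_1^2\wp_{33}+24\lambda_0\wp_{13}\wp_{22}+16\lambda_4\lambda_0\wp_{13}+2\lambda_3\lambda_1\wp_{13}+2\lambda_3\wp_{12}\wp_{11}-16\lambda_0\wp_{13}^2$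 $\wp_{111}\wp_{113}=4\wp_{11}^2\wp_{13}-4\lambda_3\lambda_0\wp_{23}-2\lambda_1\wp_{23}\wp_{11}+4\lambda_2\wp_{13}\wp_{11}+8\lambda_0\wp_{11}\wp_{33}+2\lambda_1\wp_{13}\wp_{12}+2\lambda_3\lambda_1\wp_{13}-4\lambda_0\wp_{12}\wp_{23}+8\lambda_2\lambda_0\wp_{33}-2\lambda_1^2\wp_{33}$ $\wp_{111}\wp_{112}=2\lambda_5\lambda_1^2-8\lambda_2\lambda_5\lambda_0+4\wp_{11}^2\wp_{12}-8\lambda_0\wp_{23}\wp_{11}+2\lambda_3\lambda_1\wp_{12}-4\lambda_0\wp_{22}\wp_{12}-8\lambda_2\lambda_0\wp_{23}+8\lambda_0\wp_{13}\wp_{12}+4\lambda_1\wp_{13}\wp_{11}-4\lambda_3\lambda_0\wp_{22}+4\lambda_2\wp_{12}\wp_{11}-2\lambda_1\wp_{22}\wp_{11}+8\lambda_3\lambda_0\wp_{13}-8\lambda_5\lambda_0\wp_{11}+2\lambda_1\wp_{12}^2+2\lambda_1^2\wp_{23}$ $\wp_{111}^2=4\wp_{11}^3+4\lambda_1^2\lambda_4+4\lambda_3^2\lambda_0-16\lambda_2\lambda_4\lambda_0+8\lambda_3\lambda_0\wp_{12}+4\lambda_0\wp_{12}^2+4\lambda_2\wp_{11}^2-16\lambda_2\lambda_0\wp_{22}+16\lambda_0\wp_{13}\wp_{11}-16\lambda_0\wp_{22}\wp_{11}+4\lambda_1\wp_{12}\wp_{11}+16\lambda_2\lambda_0\wp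_{13}+4\lambda_3\lambda_1\wp_{11}-16\lambda_4\lambda_0\wp_{11}-4\lambda_1^2\wp_{13}+4\lambda_1^2\wp_{22}$
   Context: Let $C$ be the compact Riemann surface (genus $3$, one point $\infty$ at infinity) of the cyclic $(2,7)$-curve $y^2=x^7+\lambda_6x^6+\dots+\lambda_1x+\lambda_0$, assumed non-singular, $\lambda_j\in\mathbb C$, $\lambda_7:=1$. Put $\boldsymbol{du}=\big(\frac{dx}{2y},\frac{x\,dx}{2y},\frac{x^2dx}{2y}\big)$. $\Lambda\subset\mathbb C^3$ is the lattice of all periods of $\boldsymbol{du}$ over $H_1(C,\mathbb Z)$, $J=\mathbb C^3/\Lambda$, $\kappa:\mathbb C^3\to J$ the projection, $W^{[2]}\subset J$ the image of $(P_1,P_2)\mapsto\int_\infty^{P_1}\boldsymbol{du}+\int_\infty^{P_2}\boldsymbol{du}$, and $\Theta^{[2]}=W^{[2]}\cup(-W^{[2]})$. The Kleinian sigma function $\sigma(\boldsymbol u)$, $\boldsymbol u=(u_1,u_2,u_3)\in\mathbb C^3$, is classically $c\exp(\frac12\boldsymbol u\eta'(\omega')^{-1}\boldsymbol u^T)$ times the Riemann theta function whose characteristic gives the Riemann constant with base point $\infty$. It is uniquely determined by: (i) $\sigma$ is entire, with zeros of order one along $\kappa^{-1}(\Theta^{[2]})$ and no other zeros; (ii) for each $\boldsymbol\ell\in\Lambda$, $\sigma(\boldsymbol u+\boldsymbol\ell)=\chi(\boldsymbol\ell)\exp(L(\boldsymbol u+\frac12\boldsymbol\ell,\boldsymbol\ell))\sigma(\boldsymbol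 u)$ with $\chi(\boldsymbol\ell)\in\{\pm1\}$ and $L(\cdot,\boldsymbol\ell)$ a $\mathbb C$-linear form; (iii) $\sigma(-\boldsymbol u)=\sigma(\boldsymbol u)$; (iv) giving $u_1,u_2,u_3$ weights $5,3,1$, the lowest-weight part of the Taylor expansion of $\sigma$ at $0$ is $\frac1{45}u_3^6-\frac13u_3^3u_2-u_2^2+u_3u_1$; (v) (normalisation of the quadratic exponential factor, corresponding to the standard choice of second kind differentials) with $\wp_{ij}=-\partial_{u_i}\partial_{u_j}\log\sigma$, for generic $P_k=(x_k,y_k)$ ($k=1,2,3$), $\boldsymbol u=\sum_k\int_\infty^{P_k}\boldsymbol{du}$ and $P=(x,y)$, one has for each $k$: $\sum_{i,j=1}^3\wp_{ij}\big(\int_\infty^P\boldsymbol{du}-\boldsymbol u\big)x^{i-1}x_k^{j-1}=\frac{\mathcal F(x,x_k)+2yy_k}{(x-x_k)^2}$, where $\mathcal F(x,z)=\sum_{j=0}^3x^jz^j\big(2\lambda_{2j}+\lambda_{2j+1}(x+z)\big)$. For $m\ge2$, $\wp_{i_1\dots i_m}=-\frac{\partial}{\partial u_{i_1}}\cdots\frac{\partial}{\partial u_{i_m}}\log\sigma$. "Quadratic 3-index relations" are relations expressing the products of two 3-index functions $\wp_{ijk}\wp_{lmn}$ as polynomials of degree at most three in the 2-index functions $\wp_{ij}$. *)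

theory Defs
  imports "HOL-Analysis.Analysis"
begin

text \<open>
  The coefficients of the curve are \<open>lam 0, \<dots>, lam 6\<close> together with \<open>lam 7\<close>, which the
  theorem assumes to be 1.
  Coordinates of \<open>complex ^ 3\<close> are indexed by the numeral type \<open>3\<close>, whose elements are
  \<open>1, 2, 3\<close> (with \<open>3 = 0\<close>).
\<close>

definition curve_poly :: "(nat \<Rightarrow> complex) \<Rightarrow> complex \<Rightarrow> complex" where
  "curve_poly lam x = (\<Sum>j\<le>7. lam j * x ^ j)"

text \<open>The partial derivatives of \<open>y ^ 2 - f x\<close> have no common zero on the affine curve. The model
  at infinity below is then smooth at its additional point without further assumptions.\<close>

definition nonsingular_curve :: "(nat \<Rightarrow> complex) \<Rightarrow> bool" where
  "nonsingular_curve lam \<longleftrightarrow>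
     (\<forall>x y. y ^ 2 = curve_poly lam x \<longrightarrow> \<not> (2 * y = 0 \<and> deriv (curve_poly lam) x = 0))"


text \<open>
  The compact Riemann surface is obtained by gluing the smooth affine curves
  \<open>y ^ 2 = f x\<close> and \<open>Y ^ 2 = X ^ 8 * f (1 / X)\<close> along \<open>X = 1 / x\<close>, \<open>Y = y / x ^ 4\<close>; the only
  point of the second one with \<open>X = 0\<close> is \<open>(X, Y) = (0, 0)\<close>.  It is represented here by its set of
  points, \<open>None\<close> being the point at infinity, and by the coordinates of the two affine pieces.
\<close>

type_synonym curve_point = "(complex \<times> complex) option"

definition curve :: "(nat \<Rightarrow> complex) \<Rightarrow> curve_point set" where
  "curve lam = insert None {Some (x, y) | x y. y ^ 2 = curve_poly lam x}"

definition affine_part :: "curve_point set" where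
  "affine_part = - {None}"

fun affine_coords :: "curve_point \<Rightarrow> complex \<times> complex" where
  "affine_coords (Some (x, y)) = (x, y)"
| "affine_coords None = (0, 0)"

definition infinity_part :: "curve_point set" where
  "infinity_part = {P. \<forall>x y. P = Some (x, y) \<longrightarrow> x \<noteq> 0}"

fun infinity_coords :: "curve_point \<Rightarrow> complex \<times> complex" where
  "infinity_coords (Some (x, y)) = (1 / x, y / x ^ 4)"
| "infinity_coords None = (0, 0)"

text \<open>Piecewise smooth paths on the compact surface; they may pass through the branch points and
  through infinity.\<close>

definition curve_path :: "(nat \<Rightarrow> complex) \<Rightarrow> (real \<Rightarrow> curve_point) \<Rightarrow> bool" where
  "curve_path lam \<gamma> \<longleftrightarrow>
     \<gamma> ` {0..1} \<subseteq> curve lam \<and>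
     (\<forall>t\<in>{0..1}. \<exists>e>0. let I = {0..1} \<inter> {t - e..t + e} in
        (\<gamma> ` I \<subseteq> affine_part \<and> (affine_coords \<circ> \<gamma>) piecewise_C1_differentiable_on I) \<or>
        (\<gamma> ` I \<subseteq> infinity_part \<and> (infinity_coords \<circ> \<gamma>) piecewise_C1_differentiable_on I))"

text \<open>
  The value of \<open>du = (dx / 2y, x dx / 2y, x ^ 2 dx / 2y)\<close> along a path.  At times when the path
  is at infinity or at a point with \<open>y = 0\<close> the formula returns 0.  Almost everywhere this is the
  right value: apart from countably many such times the velocity of the path on the surface
  vanishes.  Since \<open>du\<close> is holomorphic on the compact surface, the integral below exists for every
  \<open>curve_path\<close>.
\<close>

fun du_form :: "curve_point \<Rightarrow> complex \<Rightarrow> complex ^ 3" where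
  "du_form (Some (x, y)) dx = vector [dx / (2 * y), x * dx / (2 * y), x ^ 2 * dx / (2 * y)]"
| "du_form None dx = 0"

definition du_integral :: "(real \<Rightarrow> curve_point) \<Rightarrow> complex ^ 3" where
  "du_integral \<gamma> =
     integral {0..1} (\<lambda>t. du_form (\<gamma> t) (vector_derivative (\<lambda>s. fst (affine_coords (\<gamma> s))) (at t)))"

text \<open>The integral from infinity to \<open>P\<close> depends on the path; this is the set of all its values.\<close>

definition abel_values :: "(nat \<Rightarrow> complex) \<Rightarrow> curve_point \<Rightarrow> (complex ^ 3) set" where
  "abel_values lam P = {du_integral \<gamma> | \<gamma>. curve_path lam \<gamma> \<and> \<gamma> 0 = None \<and> \<gamma> 1 = P}"

text \<open>Classes in \<open>H\<^sub>1(C, \<int>)\<close> are represented by integral combinations of closed paths.\<close>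

definition period_lattice :: "(nat \<Rightarrow> complex) \<Rightarrow> (complex ^ 3) set" where
  "period_lattice lam =
     {\<Sum>i<n. of_int (k i) *s du_integral (\<gamma> i) | (n :: nat) (k :: nat \<Rightarrow> int) \<gamma>.
        \<forall>i<n. curve_path lam (\<gamma> i) \<and> \<gamma> i 0 = \<gamma> i 1}"

text \<open>Points of the Jacobian are the cosets of the period lattice.\<close>

definition kappa :: "(nat \<Rightarrow> complex) \<Rightarrow> complex ^ 3 \<Rightarrow> (complex ^ 3) set" where
  "kappa lam u = {u + l | l. l \<in> period_lattice lam}"

definition W2 :: "(nat \<Rightarrow> complex) \<Rightarrow> (complex ^ 3) set set" where
  "W2 lam = {kappa lam (a + b) | a b P1 P2.
     P1 \<in> curve lam \<and> P2 \<in> curve lam \<and> a \<in> abel_values lam P1 \<and> b \<in> abel_values lam P2}"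

definition Theta2 :: "(nat \<Rightarrow> complex) \<Rightarrow> (complex ^ 3) set set" where
  "Theta2 lam = W2 lam \<union> (\<lambda>A. uminus ` A) ` W2 lam"


definition entire3 :: "(complex ^ 3 \<Rightarrow> complex) \<Rightarrow> bool" where
  "entire3 f \<longleftrightarrow> (\<forall>u. \<exists>D. (f has_derivative D) (at u) \<and> Vector_Spaces.linear (*s) (*) D)"

definition pd :: "3 \<Rightarrow> (complex ^ 3 \<Rightarrow> complex) \<Rightarrow> complex ^ 3 \<Rightarrow> complex" where
  "pd i f u = deriv (\<lambda>t. f (u + t *s axis i 1)) 0"

text \<open>Since \<open>log \<sigma>\<close> is multi-valued, its first derivatives are written as \<open>\<partial>\<^sub>j \<sigma> / \<sigma>\<close>.
  The values are meaningful where \<open>\<sigma>\<close> does not vanish.\<close>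

definition wp2 :: "(complex ^ 3 \<Rightarrow> complex) \<Rightarrow> 3 \<Rightarrow> 3 \<Rightarrow> complex ^ 3 \<Rightarrow> complex" where
  "wp2 \<sigma> i j u = - pd i (\<lambda>v. pd j \<sigma> v / \<sigma> v) u"

definition wp3 :: "(complex ^ 3 \<Rightarrow> complex) \<Rightarrow> 3 \<Rightarrow> 3 \<Rightarrow> 3 \<Rightarrow> complex ^ 3 \<Rightarrow> complex" where
  "wp3 \<sigma> i j k u = - pd i (pd j (\<lambda>v. pd k \<sigma> v / \<sigma> v)) u"

text \<open>The part of weight \<open>w\<close> of the Taylor expansion at 0, where \<open>u\<^sub>1, u\<^sub>2, u\<^sub>3\<close> have
  weights 5, 3, 1.\<close>

definition weight_part :: "(complex ^ 3 \<Rightarrow> complex) \<Rightarrow> nat \<Rightarrow> complex ^ 3 \<Rightarrow> complex" where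
  "weight_part \<sigma> w u = (\<Sum>(a, b, c) \<in> {(a, b, c). 5 * a + 3 * b + c = w}.
     (pd 1 ^^ a) ((pd 2 ^^ b) ((pd 3 ^^ c) \<sigma>)) 0 / (fact a * fact b * fact c)
       * (u $ 1) ^ a * (u $ 2) ^ b * (u $ 3) ^ c)"

definition klein_polar :: "(nat \<Rightarrow> complex) \<Rightarrow> complex \<Rightarrow> complex \<Rightarrow> complex" where
  "klein_polar lam x z =
     (\<Sum>j\<le>3. x ^ j * z ^ j * (2 * lam (2 * j) + lam (2 * j + 1) * (x + z)))"

text \<open>
  The conditions that determine the Kleinian sigma function uniquely.  The zeros have order one
  along the divisor in the sense that generic zeros, i.e. those of a dense subset of the divisor,
  are simple (the divisor itself has singular points, such as 0).  In the last condition
  genericity of the points means that their \<open>x\<close>-coordinates are distinct and that the argument is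
  not a pole.
\<close>

definition kleinian_sigma :: "(nat \<Rightarrow> complex) \<Rightarrow> (complex ^ 3 \<Rightarrow> complex) \<Rightarrow> bool" where
  "kleinian_sigma lam \<sigma> \<longleftrightarrow>
     entire3 \<sigma> \<and>
     {u. \<sigma> u = 0} = {u. kappa lam u \<in> Theta2 lam} \<and>
     {u. \<sigma> u = 0} \<subseteq> closure {u. \<sigma> u = 0 \<and> (\<exists>i. pd i \<sigma> u \<noteq> 0)} \<and>
     (\<forall>l \<in> period_lattice lam. \<exists>c L. c \<in> {1, -1} \<and> Vector_Spaces.linear (*s) (*) L \<and>
        (\<forall>u. \<sigma> (u + l) = c * exp (L (u + (1 / 2) *s l)) * \<sigma> u)) \<and>
     (\<forall>u. \<sigma> (- u) = \<sigma> u) \<and>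
     (\<forall>w<6. \<forall>u. weight_part \<sigma> w u = 0) \<and>
     (\<forall>u. weight_part \<sigma> 6 u =
        1 / 45 * (u $ 3) ^ 6 - 1 / 3 * (u $ 3) ^ 3 * u $ 2 - (u $ 2) ^ 2 + u $ 3 * u $ 1) \<and>
     (\<forall>(xs :: 3 \<Rightarrow> complex) ys bs x y a.
        (\<forall>k. Some (xs k, ys k) \<in> curve lam \<and> bs k \<in> abel_values lam (Some (xs k, ys k))) \<and>
        Some (x, y) \<in> curve lam \<and> a \<in> abel_values lam (Some (x, y)) \<and>
        inj xs \<and> x \<notin> range xs \<and> \<sigma> (a - (\<Sum>k\<in>UNIV. bs k)) \<noteq> 0 \<longrightarrow>
        (\<forall>k. (\<Sum>i=1..3. \<Sum>j=1..3. wp2 \<sigma> (of_nat i) (of_nat j) (a - (\<Sum>k\<in>UNIV. bs k))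
                * x ^ (i - 1) * xs k ^ (j - 1))
             = (klein_polar lam x (xs k) + 2 * y * ys k) / (x - xs k) ^ 2))"

end

theory Submission
  imports Defs "HOL-Complex_Analysis.Conformal_Mappings"
begin

text \<open>
  Put \<open>P(z) = z\<^sup>3 - \<wp>\<^sub>3\<^sub>3 z\<^sup>2 - \<wp>\<^sub>2\<^sub>3 z - \<wp>\<^sub>1\<^sub>3\<close> and
  \<open>Q(z) = \<wp>\<^sub>3\<^sub>3\<^sub>3 z\<^sup>2 + \<wp>\<^sub>2\<^sub>3\<^sub>3 z + \<wp>\<^sub>1\<^sub>3\<^sub>3\<close>. For
  \<open>u\<close> the sum of the integrals to three points \<open>(x\<^sub>k, y\<^sub>k)\<close>, condition (v) degenerates, when one of
  its four points tends to infinity, to Jacobi inversion \<open>P(x\<^sub>k) = 0\<close> and to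
  \<open>G(x\<^sub>k, x\<^sub>l) = 2 y\<^sub>k y\<^sub>l\<close>, where
  \<open>G(z, w) = F(z, w) - (z - w)\<^sup>2 \<Sum> \<wp>\<^sub>i\<^sub>j z\<^sup>i\<^sup>-\<^sup>1 w\<^sup>j\<^sup>-\<^sup>1\<close>. Differentiating
  Jacobi inversion gives \<open>Q(x\<^sub>k) = 2 y\<^sub>k\<close>. By interpolation there is a monic quartic \<open>R\<close> with
  \<open>G(z, w) = Q(z) Q(w) / 2 + P(z) R(w) + R(z) P(w)\<close>, and differentiating the values of \<open>G\<close> shows that
  \<open>\<Sum> \<wp>\<^sub>i\<^sub>j\<^sub>k w\<^sup>i\<^sup>-\<^sup>1 z\<^sup>j\<^sup>-\<^sup>1 t\<^sup>k\<^sup>-\<^sup>1\<close> is minus the determinant of the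
  values of \<open>P, Q, R\<close> at \<open>w, z, t\<close> divided by the Vandermonde determinant. Hence each \<open>\<wp>\<^sub>i\<^sub>j\<^sub>k\<close> is a
  combination of \<open>3 \<times> 3\<close> minors of the coefficient matrix of \<open>P, Q, R\<close>. The product of two such minors is
  \<open>-2\<close> times a \<open>3 \<times> 3\<close> minor of the coefficient matrix of \<open>G\<close>, whose entries are affine in the
  \<open>\<wp>\<^sub>i\<^sub>j\<close>; this is a relation for \<open>\<wp>\<^sub>i\<^sub>j\<^sub>k \<wp>\<^sub>l\<^sub>m\<^sub>n\<close>.

  It suffices to take the three points near infinity, joined to infinity by explicit paths: the
  vectors \<open>u\<close> obtained in this way contain an open set, and the identities spread to
  \<open>\<sigma> \<noteq> 0\<close> along complex lines.
\<close>

section \<open>Holomorphic functions of three variables\<close>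

text \<open>The real Frechet derivative is required to be the complex linear form with coefficients
  \<open>c\<close>; this makes \<open>f\<close> complex differentiable with gradient
  \<open>c\<close>.\<close>

definition has_partials :: "(complex ^ 3 \<Rightarrow> complex) \<Rightarrow> (3 \<Rightarrow> complex) \<Rightarrow> complex ^ 3 \<Rightarrow> bool" where
  "has_partials f c u \<longleftrightarrow> (f has_derivative (\<lambda>v. \<Sum>i\<in>UNIV. v $ i * c i)) (at u)"

definition holomorphic3_on :: "(complex ^ 3 \<Rightarrow> complex) \<Rightarrow> (complex ^ 3) set \<Rightarrow> bool" where
  "holomorphic3_on f S \<longleftrightarrow> (\<forall>u\<in>S. \<exists>c. has_partials f c u)"

text \<open>The fixed shift \<open>a\<close> serves the case where one of three points moves:
  \<open>a\<close> then collects the Abel images of the other two.\<close>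

lemma has_partials_chain:
  assumes "has_partials f c (a + z)" "(G has_derivative (\<lambda>h. h *s w)) (at s)" "G s = z"
  shows "((\<lambda>s. f (a + G s)) has_field_derivative (\<Sum>i\<in>UNIV. w $ i * c i)) (at s)"
proof -
  have "((\<lambda>s. a + G s) has_derivative (\<lambda>h. h *s w)) (at s)"
    using assms(2) by (auto intro!: derivative_eq_intros)
  moreover have "(f has_derivative (\<lambda>v. \<Sum>i\<in>UNIV. v $ i * c i)) (at (a + G s))"
    using assms(1,3) by (simp add: has_partials_def)
  ultimately have "((\<lambda>s. f (a + G s)) has_derivative (\<lambda>h. \<Sum>i\<in>UNIV. (h *s w) $ i * c i)) (at s)"
    by (rule has_derivative_compose)
  moreover have "(\<lambda>h. \<Sum>i\<in>UNIV. (h *s w) $ i * c i) = (*) (\<Sum>i\<in>UNIV. w $ i * c i)"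
    by (auto simp: fun_eq_iff sum_distrib_left sum_distrib_right mult.commute mult.left_commute)
  ultimately show ?thesis
    by (simp add: has_field_derivative_def)
qed

lemma has_derivative_vector_scale: "((\<lambda>t. t *s w) has_derivative (\<lambda>h. h *s w)) (at (s::complex))"
  for w :: "complex ^ 3"
proof -
  have "linear (\<lambda>h::complex. h *s w)"
    by (rule linearI) (auto simp: vec_eq_iff algebra_simps)
  then have "bounded_linear (\<lambda>h::complex. h *s w)"
    by (rule linear_conv_bounded_linear[THEN iffD1])
  then show ?thesis by (rule bounded_linear_imp_has_derivative)
qed

lemma has_partials_line:
  assumes "has_partials f c (a + s *s w)"
  shows "((\<lambda>s. f (a + s *s w)) has_field_derivative (\<Sum>i\<in>UNIV. w $ i * c i)) (at s)"
  by (rule has_partials_chain[OF assms has_derivative_vector_scale refl])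

lemma has_partials_imp_pd:
  assumes "has_partials f c u"
  shows "pd i f u = c i"
proof -
  have "((\<lambda>t. f (u + t *s axis i 1)) has_field_derivative
          (\<Sum>j\<in>UNIV. axis i 1 $ j * c j)) (at 0)"
    by (rule has_partials_line) (use assms in simp)
  moreover have "(\<Sum>j\<in>UNIV. axis i 1 $ j * c j) = c i"
    by (simp add: axis_def if_distrib[where f="\<lambda>x. x * _"] cong: if_cong)
  ultimately show ?thesis
    unfolding pd_def by (simp add: DERIV_imp_deriv)
qed

lemma holomorphic3_on_has_partials:
  assumes "holomorphic3_on f S" "u \<in> S"
  shows "has_partials f (\<lambda>i. pd i f u) u"
proof -
  obtain c where c: "has_partials f c u"
    using assms by (auto simp: holomorphic3_on_def)
  then have "c = (\<lambda>i. pd i f u)"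
    by (auto simp: has_partials_imp_pd)
  with c show ?thesis by simp
qed

lemma holomorphic3_on_subset: "holomorphic3_on f S \<Longrightarrow> T \<subseteq> S \<Longrightarrow> holomorphic3_on f T"
  by (auto simp: holomorphic3_on_def)

lemma holomorphic3_on_imp_continuous_on: "holomorphic3_on f S \<Longrightarrow> continuous_on S f"
  unfolding holomorphic3_on_def has_partials_def
  by (meson continuous_at_imp_continuous_on has_derivative_continuous)

lemma holomorphic3_on_line:
  assumes "holomorphic3_on f S"
  shows "(\<lambda>t. f (a + t *s w)) holomorphic_on {t. a + t *s w \<in> S}"
proof -
  have "(\<lambda>t. f (a + t *s w)) field_differentiable (at t)" if "a + t *s w \<in> S" for t
    unfolding field_differentiable_def
    using has_partials_line[OF holomorphic3_on_has_partials[OF assms that]] by blast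
  then show ?thesis
    unfolding holomorphic_on_def by (blast intro: field_differentiable_at_within)
qed

lemma has_partials_transform:
  assumes "has_partials f c u" "open S" "u \<in> S" "\<And>v. v \<in> S \<Longrightarrow> g v = f v"
  shows "has_partials g c u"
  unfolding has_partials_def
  by (rule has_derivative_transform_within_open[OF assms(1)[unfolded has_partials_def] assms(2,3)])
     (simp add: assms(4))

lemma pd_cong:
  assumes "open S" "u \<in> S" "\<And>v. v \<in> S \<Longrightarrow> g v = f v" "holomorphic3_on f S"
  shows "pd i g u = pd i f u"
  using has_partials_transform[OF holomorphic3_on_has_partials[OF assms(4,2)] assms(1,2,3)]
    has_partials_imp_pd by auto

lemma has_partials_const: "has_partials (\<lambda>v. k) (\<lambda>i. 0) u"
  by (simp add: has_partials_def)

lemma has_partials_add: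
  assumes "has_partials f c u" "has_partials g d u"
  shows "has_partials (\<lambda>v. f v + g v) (\<lambda>i. c i + d i) u"
  using has_derivative_add[OF assms[unfolded has_partials_def]]
  by (simp add: has_partials_def algebra_simps sum.distrib)

lemma has_partials_mult:
  assumes "has_partials f c u" "has_partials g d u"
  shows "has_partials (\<lambda>v. f v * g v) (\<lambda>i. f u * d i + c i * g u) u"
  using has_derivative_mult[OF assms[unfolded has_partials_def]]
  by (simp add: has_partials_def algebra_simps sum.distrib sum_distrib_left sum_distrib_right)

lemma has_partials_minus:
  assumes "has_partials f c u"
  shows "has_partials (\<lambda>v. - f v) (\<lambda>i. - c i) u"
  using has_derivative_minus[OF assms[unfolded has_partials_def]]
  by (simp add: has_partials_def sum_negf)

lemma has_partials_inverse:
  assumes "has_partials f c u" "f u \<noteq> 0"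
  shows "has_partials (\<lambda>v. inverse (f v)) (\<lambda>i. - c i / (f u)\<^sup>2) u"
proof -
  have "(\<lambda>v. - (inverse (f u) * (\<Sum>i\<in>UNIV. v $ i * c i) * inverse (f u))) =
        (\<lambda>v. \<Sum>i\<in>UNIV. v $ i * (- c i / (f u)\<^sup>2))"
    by (simp add: fun_eq_iff sum_distrib_left sum_distrib_right sum_negf divide_inverse
          power2_eq_square mult_ac)
  with Deriv.has_derivative_inverse[OF assms(2) assms(1)[unfolded has_partials_def]] show ?thesis
    by (simp add: has_partials_def)
qed

lemma holomorphic3_on_const [simp]: "holomorphic3_on (\<lambda>v. k) S"
  using has_partials_const by (auto simp: holomorphic3_on_def)

lemma holomorphic3_on_add:
  "holomorphic3_on f S \<Longrightarrow> holomorphic3_on g S \<Longrightarrow> holomorphic3_on (\<lambda>v. f v + g v) S"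
  unfolding holomorphic3_on_def using has_partials_add by blast

lemma holomorphic3_on_mult:
  "holomorphic3_on f S \<Longrightarrow> holomorphic3_on g S \<Longrightarrow> holomorphic3_on (\<lambda>v. f v * g v) S"
  unfolding holomorphic3_on_def using has_partials_mult by blast

lemma holomorphic3_on_minus: "holomorphic3_on f S \<Longrightarrow> holomorphic3_on (\<lambda>v. - f v) S"
  unfolding holomorphic3_on_def using has_partials_minus by blast

lemma holomorphic3_on_diff:
  "holomorphic3_on f S \<Longrightarrow> holomorphic3_on g S \<Longrightarrow> holomorphic3_on (\<lambda>v. f v - g v) S"
  using holomorphic3_on_add[of f S "\<lambda>v. - g v"] holomorphic3_on_minus by simp

lemma holomorphic3_on_divide:
  assumes "holomorphic3_on f S" "holomorphic3_on g S" "\<And>v. v \<in> S \<Longrightarrow> g v \<noteq> 0"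
  shows "holomorphic3_on (\<lambda>v. f v / g v) S"
proof -
  have "holomorphic3_on (\<lambda>v. inverse (g v)) S"
    using assms(2,3) has_partials_inverse unfolding holomorphic3_on_def by blast
  from holomorphic3_on_mult[OF assms(1) this] show ?thesis
    by (simp add: divide_inverse)
qed

lemmas holomorphic3_intros = holomorphic3_on_const holomorphic3_on_add holomorphic3_on_mult
  holomorphic3_on_minus holomorphic3_on_diff

lemma entire3_imp_holomorphic3_on:
  assumes "entire3 f"
  shows "holomorphic3_on f UNIV"
  unfolding holomorphic3_on_def
proof
  fix u
  obtain D where D: "(f has_derivative D) (at u)" and "Vector_Spaces.linear (*s) (*) D"
    using assms by (auto simp: entire3_def)
  then interpret D: Vector_Spaces.linear "(*s)" "(*)" D by simp
  have "D v = (\<Sum>i\<in>UNIV. v $ i * D (axis i 1))" for v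
  proof -
    have "D v = D (\<Sum>i\<in>UNIV. v $ i *s axis i 1)"
      by (simp add: basis_expansion)
    then show ?thesis by (simp add: D.sum D.scale)
  qed
  then have "D = (\<lambda>v. \<Sum>i\<in>UNIV. v $ i * D (axis i 1))" by (rule ext)
  with D have "has_partials f (\<lambda>i. D (axis i 1)) u"
    by (simp add: has_partials_def)
  then show "\<exists>c. has_partials f c u" by blast
qed

section \<open>Cauchy integrals for partial derivatives\<close>

definition circ :: "real \<Rightarrow> real \<Rightarrow> complex" where
  "circ r \<theta> = of_real r * exp (2 * of_real pi * \<i> * of_real \<theta>)"

lemma norm_circ: "r > 0 \<Longrightarrow> norm (circ r \<theta>) = r"
  by (simp add: circ_def norm_mult)

lemma continuous_on_circ: "continuous_on S (circ r)"
  unfolding circ_def by (intro continuous_intros)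

lemma continuous_on_vector_scale: "continuous_on S (\<lambda>t::complex. t *s w)" for w :: "complex ^ 3"
  by (rule continuous_at_imp_continuous_on)
     (blast intro: has_derivative_continuous has_derivative_vector_scale)

lemma norm_scale_axis: "norm (t *s axis i (1::complex) :: complex ^ 3) = norm t"
proof -
  have "(norm ((t *s axis i (1::complex) :: complex ^ 3) $ j))\<^sup>2 = (if j = i then (norm t)\<^sup>2 else 0)" for j
    by (simp add: axis_def)
  then show ?thesis
    by (simp add: norm_vec_def L2_set_def)
qed

text \<open>The doubled radius leaves room for two moves: from \<open>u\<close> to \<open>v\<close>,
  and then along a coordinate direction from \<open>v\<close>.\<close>

lemma shift_circ_in:
  fixes u v :: "complex ^ 3"
  assumes "cball u (2 * r) \<subseteq> S" "v \<in> cball u r" "norm t \<le> r"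
  shows "v + t *s axis i 1 \<in> S"
proof -
  have "dist u (v + t *s axis i 1) \<le> dist u v + dist v (v + t *s axis i 1)"
    by (rule dist_triangle)
  also have "dist v (v + t *s axis i 1) = norm (t *s axis i (1::complex) :: complex ^ 3)"
    by (simp add: dist_norm)
  also have "dist u v + \<dots> \<le> 2 * r" using assms by (simp add: norm_scale_axis)
  finally show ?thesis using assms(1) by (auto simp: mem_cball)
qed

text \<open>Cauchy's formula for the first derivative of the slice in direction \<open>i\<close>.
  One radius serves all centres \<open>v\<close> near \<open>u\<close>, so the formula can be
  differentiated in \<open>v\<close> under the integral sign.\<close>

lemma pd_Cauchy_integral:
  assumes f: "holomorphic3_on f S" and S: "cball u (2 * r) \<subseteq> S" and r: "r > 0" and v: "v \<in> cball u r"
  shows "((\<lambda>\<theta>. f (v + circ r \<theta> *s axis i 1) / circ r \<theta>) has_integral pd i f v) {0..1}"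
proof -
  define h where "h = (\<lambda>t. f (v + t *s axis i 1))"
  have "h holomorphic_on cball 0 r"
    unfolding h_def by (rule holomorphic_on_subset[OF holomorphic3_on_line[OF f]])
      (use shift_circ_in[OF S v] in auto)
  then have "((\<lambda>w. h w / (w - 0) ^ Suc 1) has_contour_integral
       (2 * pi * \<i>) / fact 1 * (deriv ^^ 1) h 0) (circlepath 0 r)"
    using r by (intro Cauchy_has_contour_integral_higher_derivative_circlepath
        holomorphic_on_imp_continuous_on) (auto intro: holomorphic_on_subset)
  then have "((\<lambda>w. h w / w\<^sup>2) has_contour_integral (2 * pi * \<i>) * pd i f v) (circlepath 0 r)"
    by (simp add: pd_def h_def power2_eq_square)
  then have "((\<lambda>\<theta>. h (circlepath 0 r \<theta>) / (circlepath 0 r \<theta>)\<^sup>2 *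
      vector_derivative (circlepath 0 r) (at \<theta> within {0..1}))
      has_integral (2 * pi * \<i>) * pd i f v) {0..1}"
    by (simp add: has_contour_integral_def)
  \<comment> \<open>On the circle, \<open>dw\<close> is \<open>2 pi i w d\<theta>\<close>, so one of
    the two factors \<open>w\<close> in the denominator cancels.\<close>
  then have "((\<lambda>\<theta>. (2 * pi * \<i>) * (h (circ r \<theta>) / circ r \<theta>))
      has_integral (2 * pi * \<i>) * pd i f v) {0..1}"
  proof (rule has_integral_eq[rotated])
    fix \<theta> :: real assume "\<theta> \<in> {0..1}"
    then have "vector_derivative (circlepath 0 r) (at \<theta> within {0..1}) = (2 * pi * \<i>) * circ r \<theta>"
      by (simp add: vector_derivative_circlepath01 circ_def)
    moreover have "circlepath 0 r \<theta> = circ r \<theta>"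
      by (simp add: circlepath circ_def)
    ultimately show "h (circlepath 0 r \<theta>) / (circlepath 0 r \<theta>)\<^sup>2 *
        vector_derivative (circlepath 0 r) (at \<theta> within {0..1}) =
        (2 * pi * \<i>) * (h (circ r \<theta>) / circ r \<theta>)"
      by (simp add: power2_eq_square)
  qed
  then have "((\<lambda>\<theta>. inverse (2 * pi * \<i>) * ((2 * pi * \<i>) * (h (circ r \<theta>) / circ r \<theta>)))
      has_integral inverse (2 * pi * \<i>) * ((2 * pi * \<i>) * pd i f v)) {0..1}"
    by (rule has_integral_mult_right)
  moreover have "inverse (2 * pi * \<i>) * ((2 * pi * \<i>) * z) = z" for z
    by (simp add: field_simps)
  ultimately show ?thesis by (simp only: h_def)
qed

lemma continuous_on_shifted_circ:
  fixes f :: "complex ^ 3 \<Rightarrow> complex" and i :: 3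
  assumes "continuous_on S f" "cball u (2 * r) \<subseteq> S" "r > 0"
  shows "continuous_on (cball u r \<times> cbox 0 1) (\<lambda>(v, \<theta>). f (v + circ r \<theta> *s axis i 1) / circ r \<theta>)"
proof -
  have "continuous_on (cball u r \<times> cbox 0 1) (\<lambda>x. fst x + circ r (snd x) *s axis i (1::complex))"
    by (intro continuous_intros continuous_on_compose2[OF continuous_on_vector_scale[of UNIV]]
        continuous_on_compose2[OF continuous_on_circ[of UNIV]]) auto
  moreover have "(\<lambda>x. fst x + circ r (snd x) *s axis i 1) ` (cball u r \<times> cbox 0 1) \<subseteq> S"
    using shift_circ_in[OF assms(2)] norm_circ[OF assms(3)] by auto
  ultimately have "continuous_on (cball u r \<times> cbox 0 1) (\<lambda>x. f (fst x + circ r (snd x) *s axis i 1))"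
    by (rule continuous_on_compose2[OF assms(1)])
  moreover have "continuous_on (cball u r \<times> cbox (0::real) 1) (\<lambda>x. circ r (snd x))"
    by (intro continuous_on_compose2[OF continuous_on_circ[of UNIV]] continuous_intros) auto
  ultimately have "continuous_on (cball u r \<times> cbox 0 1)
      (\<lambda>x. f (fst x + circ r (snd x) *s axis i 1) / circ r (snd x))"
    using norm_circ[OF assms(3)] assms(3)
    by (intro continuous_on_divide) (metis norm_zero less_irrefl)+
  then show ?thesis by (simp add: case_prod_unfold)
qed

lemma obtain_double_cball:
  assumes "open S" "u \<in> S"
  obtains r where "r > 0" "cball (u :: complex ^ 3) (2 * r) \<subseteq> S"
proof -
  obtain e where "e > 0" "cball u e \<subseteq> S"
    using assms open_contains_cball by blast
  then show thesis using that[of "e / 2"] by simp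
qed

lemma continuous_on_pd:
  assumes "holomorphic3_on f S" "open S"
  shows "continuous_on S (pd i f)"
proof (rule continuous_at_imp_continuous_on, rule ballI)
  fix u assume "u \<in> S"
  then obtain r where r: "r > 0" "cball u (2 * r) \<subseteq> S"
    using obtain_double_cball assms(2) by blast
  have "continuous_on (cball u r) (\<lambda>v. integral (cbox 0 1) (\<lambda>\<theta>. f (v + circ r \<theta> *s axis i 1) / circ r \<theta>))"
    by (rule integral_continuous_on_param continuous_on_shifted_circ
        holomorphic3_on_imp_continuous_on assms(1) r)+
  moreover have "integral (cbox 0 1) (\<lambda>\<theta>. f (v + circ r \<theta> *s axis i 1) / circ r \<theta>) = pd i f v"
    if "v \<in> cball u r" for v
    using integral_unique[OF pd_Cauchy_integral[OF assms(1) r(2,1) that]] by simp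
  ultimately have "continuous_on (cball u r) (pd i f)"
    by (subst (asm) continuous_on_cong[OF refl, where g="pd i f"]) auto
  then show "continuous (at u) (pd i f)"
    using r by (auto intro: continuous_on_interior simp: interior_cball)
qed

text \<open>Differentiation under the integral sign in the Cauchy formula. The coefficient with
  index \<open>j\<close> is the Cauchy integral of \<open>pd j f\<close> in direction
  \<open>i\<close>; this shape yields the symmetry of second derivatives in
  \<open>pd_commute\<close>.\<close>

lemma has_partials_pd:
  assumes f: "holomorphic3_on f S" and S: "cball u (2 * r) \<subseteq> S" "open S" and r: "r > 0"
  shows "has_partials (pd i f)
           (\<lambda>j. integral {0..1} (\<lambda>\<theta>. pd j f (u + circ r \<theta> *s axis i 1) / circ r \<theta>)) u"
proof -
  define F where "F = (\<lambda>v \<theta>. f (v + circ r \<theta> *s axis i 1) / circ r \<theta>)"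
  define G where "G = (\<lambda>j v \<theta>. pd j f (v + circ r \<theta> *s axis i 1) / circ r \<theta>)"
  \<comment> \<open>The derivative of the integrand in \<open>v\<close>, packed as a bounded linear
    map because \<open>leibniz_rule\<close> integrates derivatives of that type.\<close>
  define B where "B = (\<lambda>v \<theta>. Blinfun (\<lambda>w::complex^3. \<Sum>j\<in>UNIV. w $ j * G j v \<theta>))"
  have B: "blinfun_apply (B v \<theta>) = (\<lambda>w. \<Sum>j\<in>UNIV. w $ j * G j v \<theta>)" for v \<theta>
    unfolding B_def
    by (rule bounded_linear_Blinfun_apply)
       (intro bounded_linear_sum bounded_linear_mult_const bounded_linear_vec_nth)
  have contG: "continuous_on (cball u r \<times> cbox 0 1) (\<lambda>(v, \<theta>). G j v \<theta>)" for j
    unfolding G_def by (intro continuous_on_shifted_circ[OF continuous_on_pd[OF f S(2)] S(1) r])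
  have contGu: "continuous_on {0..1} (\<lambda>\<theta>. G j u \<theta>)" for j
  proof -
    have "continuous_on {0..1} (\<lambda>\<theta>. case (u, \<theta>) of (v, \<theta>) \<Rightarrow> G j v \<theta>)"
      by (rule continuous_on_compose2[OF contG]) (use r in \<open>auto intro!: continuous_intros\<close>)
    then show ?thesis by simp
  qed
  have D: "((\<lambda>v. integral (cbox 0 1) (F v)) has_derivative blinfun_apply (integral (cbox 0 1) (B u)))
          (at u within cball u r)"
  proof (rule leibniz_rule)
    fix v and \<theta> :: real assume v: "v \<in> cball u r"
    have "has_partials f (\<lambda>j. pd j f (v + circ r \<theta> *s axis i 1)) (v + circ r \<theta> *s axis i 1)"
      by (rule holomorphic3_on_has_partials[OF f shift_circ_in[OF S(1) v]])
         (simp add: norm_circ[OF r])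
    then have "(f has_derivative (\<lambda>w. \<Sum>j\<in>UNIV. w $ j * pd j f (v + circ r \<theta> *s axis i 1)))
        (at (v + circ r \<theta> *s axis i 1))"
      by (simp add: has_partials_def)
    then have "((\<lambda>v. f (v + circ r \<theta> *s axis i 1)) has_derivative
        (\<lambda>w. \<Sum>j\<in>UNIV. w $ j * pd j f (v + circ r \<theta> *s axis i 1))) (at v)"
      by (rule has_derivative_compose[rotated]) (auto intro!: derivative_eq_intros)
    then have "((\<lambda>v. f (v + circ r \<theta> *s axis i 1) * inverse (circ r \<theta>)) has_derivative
        (\<lambda>w. (\<Sum>j\<in>UNIV. w $ j * pd j f (v + circ r \<theta> *s axis i 1)) * inverse (circ r \<theta>))) (at v)"
      by (rule has_derivative_mult_left)
    then have "((\<lambda>v. F v \<theta>) has_derivative blinfun_apply (B v \<theta>)) (at v)"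
      by (simp add: F_def B G_def divide_inverse sum_distrib_right mult.assoc)
    then show "((\<lambda>v. F v \<theta>) has_derivative blinfun_apply (B v \<theta>)) (at v within cball u r)"
      by (rule has_derivative_at_withinI)
  next
    fix v assume "v \<in> cball u r"
    from pd_Cauchy_integral[OF f S(1) r this, of i]
    show "F v integrable_on cbox 0 1"
      unfolding F_def by (auto simp: has_integral_integrable)
  next
    show "continuous_on (cball u r \<times> cbox 0 1) (\<lambda>(v, \<theta>). B v \<theta>)"
      using contG
      by (intro continuous_on_blinfun_componentwise)
         (auto simp: B case_prod_unfold intro!: continuous_intros)
  qed (use r in auto)
  have "B u integrable_on cbox 0 1"
  proof (rule integrable_continuous)
    show "continuous_on (cbox 0 1) (B u)"
    proof (rule continuous_on_blinfun_componentwise)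
      fix b :: "complex ^ 3"
      show "continuous_on (cbox 0 1) (\<lambda>\<theta>. blinfun_apply (B u \<theta>) b)"
        by (auto simp: B intro!: continuous_intros contGu)
    qed
  qed
  moreover have "integral {0..1} (\<lambda>\<theta>. \<Sum>j\<in>UNIV. w $ j * G j u \<theta>)
      = (\<Sum>j\<in>UNIV. w $ j * integral {0..1} (G j u))" for w
    by (subst integral_sum) (auto intro!: integrable_continuous_interval continuous_intros contGu)
  ultimately have "blinfun_apply (integral (cbox 0 1) (B u)) =
      (\<lambda>w. \<Sum>j\<in>UNIV. w $ j * integral {0..1} (G j u))"
    by (intro ext) (simp add: blinfun_apply_integral B)
  with D have "((\<lambda>v. integral (cbox 0 1) (F v)) has_derivative
      (\<lambda>w. \<Sum>j\<in>UNIV. w $ j * integral {0..1} (G j u))) (at u within cball u r)"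
    by simp
  then have "((\<lambda>v. integral (cbox 0 1) (F v)) has_derivative
      (\<lambda>w. \<Sum>j\<in>UNIV. w $ j * integral {0..1} (G j u))) (at u)"
    using r by (subst (asm) at_within_interior) (auto simp: interior_cball)
  moreover have "integral (cbox 0 1) (F v) = pd i f v" if "v \<in> ball u r" for v
    using integral_unique[OF pd_Cauchy_integral[OF f S(1) r, of v]] that by (simp add: F_def)
  ultimately show ?thesis
    unfolding has_partials_def G_def
    by (elim has_derivative_transform_within_open[where s="ball u r"]) (use r in auto)
qed

lemma holomorphic3_on_pd:
  assumes "holomorphic3_on f S" "open S"
  shows "holomorphic3_on (pd i f) S"
  unfolding holomorphic3_on_def
proof
  fix u assume "u \<in> S"
  then obtain r where "r > 0" "cball u (2 * r) \<subseteq> S"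
    using obtain_double_cball assms(2) by blast
  then show "\<exists>c. has_partials (pd i f) c u"
    using has_partials_pd[OF assms(1) _ assms(2)] by blast
qed

text \<open>Both iterated derivatives equal the Cauchy integral of \<open>pd j f\<close> around the
  circle in direction \<open>i\<close>.\<close>

lemma pd_commute:
  assumes "holomorphic3_on f S" "open S" "u \<in> S"
  shows "pd j (pd i f) u = pd i (pd j f) u"
proof -
  obtain r where r: "r > 0" "cball u (2 * r) \<subseteq> S"
    using obtain_double_cball assms by blast
  have "pd j (pd i f) u = integral {0..1} (\<lambda>\<theta>. pd j f (u + circ r \<theta> *s axis i 1) / circ r \<theta>)"
    by (rule has_partials_imp_pd[OF has_partials_pd[OF assms(1) r(2) assms(2) r(1)]])
  also have "\<dots> = pd i (pd j f) u"
    by (rule integral_unique[OF pd_Cauchy_integral[OF holomorphic3_on_pd[OF assms(1,2)] r(2,1)]])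
       (use r in simp)
  finally show ?thesis .
qed

text \<open>On the complex line through \<open>v0\<close> and \<open>u\<close> the function
  \<open>\<sigma>\<close> does not vanish identically, so its zeros there are countable, and
  removing them leaves the plane connected. The one-variable identity theorem then leads from the
  parameter 0 to the parameter 1.\<close>

lemma holomorphic3_zero_on_open:
  assumes \<sigma>: "holomorphic3_on \<sigma> UNIV" and F: "holomorphic3_on F {v. \<sigma> v \<noteq> 0}"
    and V: "open V" "v0 \<in> V" "\<sigma> v0 \<noteq> 0" "\<And>v. v \<in> V \<Longrightarrow> F v = 0" and u: "\<sigma> u \<noteq> 0"
  shows "F u = 0"
proof -
  define L where "L = (\<lambda>t. v0 + t *s (u - v0))"
  define Z where "Z = {t. \<sigma> (L t) = 0}"
  have hol: "(\<lambda>t. \<sigma> (L t)) holomorphic_on UNIV"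
    using holomorphic3_on_line[OF \<sigma>, of v0 "u - v0"] unfolding L_def by simp
  have contL: "continuous_on UNIV L"
    unfolding L_def by (intro continuous_intros continuous_on_vector_scale)
  have "countable Z"
  \<comment> \<open>Countability of zeros is a statement on nonconstant functions. A constant slice
    has the nonzero value \<open>\<sigma> v0\<close> everywhere, hence no zeros.\<close>
  proof (cases "(\<lambda>t. \<sigma> (L t)) constant_on UNIV")
    case True
    then obtain y where "\<And>t. \<sigma> (L t) = y"
      unfolding constant_on_def by blast
    then have "\<sigma> (L t) = \<sigma> (L 0)" for t by simp
    then have "Z = {}" using V(3) by (auto simp: Z_def L_def)
    then show ?thesis by simp
  next
    case False
    then show ?thesis
      using holomorphic_countable_zeros[OF hol _ _ _ False] fsigma_in_topspace[of euclidean]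
      by (simp add: Z_def connected_UNIV)
  qed
  then have conn: "connected (UNIV - Z)"
    by (intro connected_open_diff_countable) auto
  have "closed Z"
    unfolding Z_def using holomorphic_on_imp_continuous_on[OF hol]
    by (intro closed_Collect_eq continuous_intros) auto
  then have op: "open (UNIV - Z)" by auto
  have hol: "(\<lambda>t. F (L t)) holomorphic_on UNIV - Z"
  proof -
    have "{t. v0 + t *s (u - v0) \<in> {v. \<sigma> v \<noteq> 0}} = UNIV - Z"
      by (auto simp: Z_def L_def)
    with holomorphic3_on_line[OF F, of v0 "u - v0"] show ?thesis
      by (simp only: L_def)
  qed
  have mem: "0 \<in> UNIV - Z" "1 \<in> UNIV - Z"
    using V(3) u by (auto simp: Z_def L_def)
  have "open (L -` V)"
    by (rule open_vimage[OF V(1) contL])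
  then have "open (L -` V \<inter> (UNIV - Z))"
    using op by (rule open_Int)
  moreover have "0 \<in> L -` V \<inter> (UNIV - Z)"
    using mem V(2) by (simp add: L_def)
  ultimately have lim: "0 islimpt (L -` V \<inter> (UNIV - Z))"
    by (rule open_imp_islimpt)
  have "F (L 1) = 0"
    by (rule analytic_continuation[OF hol op conn _ mem(1) lim _ mem(2)]) (use V(4) in auto)
  then show ?thesis by (simp add: L_def)
qed

section \<open>Interpolation and products of minors\<close>

text \<open>The determinant of the columns \<open>i\<close>, \<open>j\<close>, \<open>k\<close> of
  the matrix with rows \<open>p\<close>, \<open>q\<close>, \<open>r\<close>, expanded along column
  \<open>i\<close>.\<close>

definition minor :: "(nat \<Rightarrow> complex) \<Rightarrow> (nat \<Rightarrow> complex) \<Rightarrow> (nat \<Rightarrow> complex) \<Rightarrow> nat \<Rightarrow> nat \<Rightarrow> nat \<Rightarrow> complex" where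
  "minor p q r i j k = p i * (q j * r k - q k * r j) - q i * (p j * r k - p k * r j)
     + r i * (p j * q k - p k * q j)"

text \<open>With \<open>M\<close> the matrix with rows \<open>p\<close>, \<open>q\<close>,
  \<open>r\<close>, this is an entry of \<open>M^T S M\<close>, where \<open>S\<close> is symmetric
  with 1 at the two places joining \<open>p\<close> and \<open>r\<close>, 1/2 in the middle and 0
  elsewhere, so that \<open>det S = -1/2\<close>.\<close>

definition gram :: "(nat \<Rightarrow> complex) \<Rightarrow> (nat \<Rightarrow> complex) \<Rightarrow> (nat \<Rightarrow> complex) \<Rightarrow> nat \<Rightarrow> nat \<Rightarrow> complex" where
  "gram p q r i j = q i * q j / 2 + p i * r j + p j * r i"

text \<open>A 3 x 3 minor of \<open>M^T S M\<close> is the product of a minor of \<open>M\<close>,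
  of \<open>det S\<close> and of another minor of \<open>M\<close>; the factor -2 is the inverse of
  \<open>det S\<close>.\<close>

lemma minor_times_minor:
  "minor p q r i j k * minor p q r l m n =
    - 2 * (gram p q r i l * (gram p q r j m * gram p q r k n - gram p q r j n * gram p q r k m)
      - gram p q r i m * (gram p q r j l * gram p q r k n - gram p q r j n * gram p q r k l)
      + gram p q r i n * (gram p q r j l * gram p q r k m - gram p q r j m * gram p q r k l))"
  unfolding minor_def gram_def by (simp add: field_simps)

text \<open>The form in which a product of minors appears once associativity has nested it to the
  right and the second minor carries a further factor \<open>c\<close>.\<close>

lemma minor_times_minor_left:
  "minor p q r i j k * (minor p q r l m n * c) =
    - 2 * (gram p q r i l * (gram p q r j m * gram p q r k n - gram p q r j n * gram p q r k m)
      - gram p q r i m * (gram p q r j l * gram p q r k n - gram p q r j n * gram p q r k l)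
      + gram p q r i n * (gram p q r j l * gram p q r k m - gram p q r j m * gram p q r k l)) * c"
  by (simp only: minor_times_minor mult.assoc[symmetric])

text \<open>\<open>\<Sum> a\<^sub>i\<^sub>j z\<^sup>i\<^sup>-\<^sup>1 w\<^sup>j\<^sup>-\<^sup>1\<close> for a symmetric matrix \<open>a\<close>, and below its derivative in \<open>z\<close>.\<close>

definition sym_form :: "complex \<Rightarrow> complex \<Rightarrow> complex \<Rightarrow> complex \<Rightarrow> complex \<Rightarrow> complex \<Rightarrow> complex \<Rightarrow> complex \<Rightarrow> complex" where
  "sym_form a11 a12 a13 a22 a23 a33 z w =
     a11 + a12 * (z + w) + a13 * (z\<^sup>2 + w\<^sup>2) + a22 * z * w + a23 * (z\<^sup>2 * w + z * w\<^sup>2) + a33 * z\<^sup>2 * w\<^sup>2"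

definition sym_form_deriv :: "complex \<Rightarrow> complex \<Rightarrow> complex \<Rightarrow> complex \<Rightarrow> complex \<Rightarrow> complex \<Rightarrow> complex \<Rightarrow> complex \<Rightarrow> complex" where
  "sym_form_deriv a11 a12 a13 a22 a23 a33 z w =
     a12 + 2 * a13 * z + a22 * w + a23 * (2 * z * w + w\<^sup>2) + 2 * a33 * z * w\<^sup>2"

text \<open>The derivative is taken in the first argument. In the summand \<open>j = 0\<close> the
  truncated exponent \<open>j - 1\<close> meets the factor 0.\<close>

definition klein_polar_deriv :: "(nat \<Rightarrow> complex) \<Rightarrow> complex \<Rightarrow> complex \<Rightarrow> complex" where
  "klein_polar_deriv lam x z =
     (\<Sum>j\<le>3. of_nat j * x ^ (j - 1) * z ^ j * (2 * lam (2 * j) + lam (2 * j + 1) * (x + z))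
        + x ^ j * z ^ j * lam (2 * j + 1))"

definition curve_poly_deriv :: "(nat \<Rightarrow> complex) \<Rightarrow> complex \<Rightarrow> complex" where
  "curve_poly_deriv lam x = (\<Sum>j\<le>7. of_nat j * lam j * x ^ (j - 1))"

lemma klein_polar_expand:
  "klein_polar lam x z = 2 * lam 0 + lam 1 * (x + z) + x * z * (2 * lam 2 + lam 3 * (x + z))
     + x\<^sup>2 * z\<^sup>2 * (2 * lam 4 + lam 5 * (x + z)) + x ^ 3 * z ^ 3 * (2 * lam 6 + lam 7 * (x + z))"
  by (simp add: klein_polar_def eval_nat_numeral)

lemma klein_polar_deriv_expand:
  "klein_polar_deriv lam x z = lam 1 + z * (2 * lam 2 + lam 3 * (x + z)) + x * z * lam 3
     + 2 * x * z\<^sup>2 * (2 * lam 4 + lam 5 * (x + z)) + x\<^sup>2 * z\<^sup>2 * lam 5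
     + 3 * x\<^sup>2 * z ^ 3 * (2 * lam 6 + lam 7 * (x + z)) + x ^ 3 * z ^ 3 * lam 7"
  by (simp add: klein_polar_deriv_def eval_nat_numeral)

lemma curve_poly_expand:
  "curve_poly lam x = lam 0 + lam 1 * x + lam 2 * x\<^sup>2 + lam 3 * x ^ 3 + lam 4 * x ^ 4
     + lam 5 * x ^ 5 + lam 6 * x ^ 6 + lam 7 * x ^ 7"
  by (simp add: curve_poly_def eval_nat_numeral)

lemma klein_polar_diag: "klein_polar lam z z = 2 * curve_poly lam z"
  unfolding klein_polar_expand curve_poly_expand by algebra

lemma curve_poly_deriv_expand:
  "curve_poly_deriv lam x = lam 1 + 2 * lam 2 * x + 3 * lam 3 * x\<^sup>2 + 4 * lam 4 * x ^ 3
     + 5 * lam 5 * x ^ 4 + 6 * lam 6 * x ^ 5 + 7 * lam 7 * x ^ 6"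
  by (simp add: curve_poly_deriv_def eval_nat_numeral)

text \<open>The polar form is symmetric and equals \<open>2 f\<close> on the diagonal, so its
  derivative in one argument is half of \<open>2 f'\<close> there.\<close>

lemma klein_polar_deriv_diag: "klein_polar_deriv lam z z = curve_poly_deriv lam z"
  unfolding klein_polar_deriv_expand curve_poly_deriv_expand
  by (simp add: algebra_simps eval_nat_numeral)

lemma quadratic_three_zeros:
  fixes x :: "3 \<Rightarrow> complex"
  assumes x: "inj x" and zero: "\<And>k. a + b * x k + c * (x k)\<^sup>2 = 0"
  shows "a = 0 \<and> b = 0 \<and> c = 0"
proof -
  have ne: "x 1 \<noteq> x 2" "x 1 \<noteq> x 3" "x 2 \<noteq> x 3"
    using x by (auto dest: injD)
  have "(x 1 - x 2) * (b + c * (x 1 + x 2)) = 0" "(x 1 - x 3) * (b + c * (x 1 + x 3)) = 0"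
    using zero[of 1] zero[of 2] zero[of 3] by algebra+
  then have b: "b + c * (x 1 + x 2) = 0" "b + c * (x 1 + x 3) = 0"
    using ne by auto
  then have "c * (x 2 - x 3) = 0" by algebra
  then have "c = 0" using ne by simp
  with b zero[of 1] show ?thesis by simp
qed

lemma sym_form_diff:
  "sym_form (a11 - b11) (a12 - b12) (a13 - b13) (a22 - b22) (a23 - b23) (a33 - b33) z w =
     sym_form a11 a12 a13 a22 a23 a33 z w - sym_form b11 b12 b13 b22 b23 b33 z w"
  by (simp add: sym_form_def algebra_simps)

text \<open>The form is quadratic in each variable, so \<open>quadratic_three_zeros\<close> applies
  first in \<open>x k\<close> and then, to each of the three coefficients, in
  \<open>x l\<close>.\<close>

lemma sym_form_grid_zero:
  fixes x :: "3 \<Rightarrow> complex"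
  assumes x: "inj x" and zero: "\<And>k l. sym_form a11 a12 a13 a22 a23 a33 (x k) (x l) = 0"
  shows "a11 = 0 \<and> a12 = 0 \<and> a13 = 0 \<and> a22 = 0 \<and> a23 = 0 \<and> a33 = 0"
proof -
  have "(a11 + a12 * x l + a13 * (x l)\<^sup>2) + (a12 + a22 * x l + a23 * (x l)\<^sup>2) * x k
      + (a13 + a23 * x l + a33 * (x l)\<^sup>2) * (x k)\<^sup>2 = 0" for k l
    using zero[of k l] unfolding sym_form_def by algebra
  from quadratic_three_zeros[OF x this]
  have "a11 + a12 * x l + a13 * (x l)\<^sup>2 = 0" "a12 + a22 * x l + a23 * (x l)\<^sup>2 = 0"
    "a13 + a23 * x l + a33 * (x l)\<^sup>2 = 0" for l
    by blast+
  from this[THEN quadratic_three_zeros[OF x]] show ?thesis by simp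
qed

text \<open>The algebraic core, with numbers in place of functions: \<open>J\<close> and
  \<open>K\<close> are the inversion and pair formulas, \<open>dJ\<close> and \<open>dK\<close>
  their derivatives. All conclusions come from polynomials of low degree that agree at the three
  distinct abscissae.\<close>

lemma interpolation_relations:
  fixes lam :: "nat \<Rightarrow> complex" and x y :: "3 \<Rightarrow> complex"
    and p11 p12 p13 p22 p23 p33 :: complex
    and p111 p112 p113 p122 p123 p133 p222 p223 p233 p333 :: complex
  defines "r3 \<equiv> lam 6 + p33"
  defines "p \<equiv> (!) [- p13, - p23, - p33, 1, 0]"
    and "q \<equiv> (!) [p133, p233, p333, 0, 0]"
    and "r \<equiv> (!) [- p12 + p13 * r3, 2 * p13 - p22 + p23 * r3, lam 5 + p23 + p33 * r3, r3, 1]"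
    and "W \<equiv> sym_form p11 p12 p13 p22 p23 p33"
    and "T3 \<equiv> sym_form p113 p123 p133 p223 p233 p333"
    and "T2 \<equiv> sym_form p112 p122 p123 p222 p223 p233"
    and "T1 \<equiv> sym_form p111 p112 p113 p122 p123 p133"
  assumes lam7: "lam 7 = 1" and x: "inj x"
    and curve: "\<And>k. (y k)\<^sup>2 = curve_poly lam (x k)"
    and J: "\<And>k. x k ^ 3 = p33 * (x k)\<^sup>2 + p23 * x k + p13"
    and K: "\<And>k l. k \<noteq> l \<Longrightarrow> W (x k) (x l) * (x k - x l)\<^sup>2 = klein_polar lam (x k) (x l) - 2 * y k * y l"
    and dJ: "\<And>k l. k \<noteq> l \<Longrightarrow> T3 (x k) (x l) = 0"
      "\<And>k. T3 (x k) (x k) = 2 * y k * (3 * (x k)\<^sup>2 - 2 * p33 * x k - p23)"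
    and dK: "\<And>k l. k \<noteq> l \<Longrightarrow>
      (T1 (x k) (x l) + T2 (x k) (x l) * x k + T3 (x k) (x l) * (x k)\<^sup>2) * (x k - x l)\<^sup>2 =
        2 * y k * (klein_polar_deriv lam (x k) (x l)
          - sym_form_deriv p11 p12 p13 p22 p23 p33 (x k) (x l) * (x k - x l)\<^sup>2
          - 2 * W (x k) (x l) * (x k - x l))
        - 2 * curve_poly_deriv lam (x k) * y l"
  shows "gram p q r 0 0 = 2 * lam 0 \<and> gram p q r 0 1 = lam 1 \<and> gram p q r 0 2 = - p11 \<and>
      gram p q r 1 1 = 2 * lam 2 + 2 * p11 \<and> gram p q r 1 2 = lam 3 + p12 \<and>
      gram p q r 2 2 = 2 * lam 4 - 2 * p13 + 2 * p22 \<and>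
      p223 = - minor p q r 1 2 4 - minor p q r 0 3 4 \<and>
      p123 = - minor p q r 0 2 4 \<and> p113 = - minor p q r 0 1 4 \<and>
      p222 = - minor p q r 1 2 3 - 2 * minor p q r 0 2 4 \<and>
      p122 = - minor p q r 0 2 3 - minor p q r 0 1 4 \<and>
      p112 = - minor p q r 0 1 3 \<and> p111 = - minor p q r 0 1 2"
proof -
  \<comment> \<open>The coefficients of \<open>R\<close> are forced: \<open>P\<close> is a monic
    cubic and \<open>Q\<close> is quadratic, so comparing the terms with \<open>w^3\<close> and
    \<open>w^4\<close> in \<open>G = Q Q / 2 + P R + R P\<close> determines them. The terms of
    degree at most 2 in both variables remain to be proved.\<close>
  define r0 where "r0 = - p12 + p13 * r3"
  define r1 where "r1 = 2 * p13 - p22 + p23 * r3"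
  define r2 where "r2 = lam 5 + p23 + p33 * r3"
  note rdefs = r0_def r1_def r2_def r3_def
  have p: "p 0 = - p13" "p (Suc 0) = - p23" "p 2 = - p33" "p 3 = 1" "p 4 = 0"
    and q: "q 0 = p133" "q (Suc 0) = p233" "q 2 = p333" "q 3 = 0" "q 4 = 0"
    and r: "r 0 = r0" "r (Suc 0) = r1" "r 2 = r2" "r 3 = r3" "r 4 = 1"
    by (simp_all add: p_def q_def r_def r0_def r1_def r2_def eval_nat_numeral)
  define P where "P = (\<lambda>z. z ^ 3 - p33 * z\<^sup>2 - p23 * z - p13)"
  define Q where "Q = (\<lambda>z. p333 * z\<^sup>2 + p233 * z + p133)"
  define R where "R = (\<lambda>z. z ^ 4 + r3 * z ^ 3 + r2 * z\<^sup>2 + r1 * z + r0)"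
  define P' where "P' = (\<lambda>z. 3 * z\<^sup>2 - 2 * p33 * z - p23)"
  define Q' where "Q' = (\<lambda>z. 2 * p333 * z + p233)"
  define R' where "R' = (\<lambda>z. 4 * z ^ 3 + 3 * r3 * z\<^sup>2 + 2 * r2 * z + r1)"
  have P0: "P (x k) = 0" for k
    using J[of k] by (simp add: P_def)

  have Qy: "Q (x k) = 2 * y k" for k
  proof -
    \<comment> \<open>\<open>z^2 + c1 z + c0\<close> is the quotient of \<open>P z\<close> by
      \<open>z - x k\<close>. Both \<open>T3 z (x k)\<close> and \<open>2 y k\<close> times this
      quotient vanish at the other two abscissae and agree at \<open>x k\<close>; comparing leading
      coefficients gives \<open>Q (x k) = 2 y k\<close>.\<close>
    define c1 where "c1 = x k - p33"
    define c0 where "c0 = (x k)\<^sup>2 - p33 * x k - p23"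
    have T3q: "T3 z (x k) = (p113 + p123 * x k + p133 * (x k)\<^sup>2)
        + (p123 + p223 * x k + p233 * (x k)\<^sup>2) * z + Q (x k) * z\<^sup>2" for z
      unfolding T3_def sym_form_def Q_def by algebra
    have "(p113 + p123 * x k + p133 * (x k)\<^sup>2 - 2 * y k * c0)
        + (p123 + p223 * x k + p233 * (x k)\<^sup>2 - 2 * y k * c1) * x l
        + (Q (x k) - 2 * y k) * (x l)\<^sup>2 = 0" for l
    proof -
      have "T3 (x l) (x k) - 2 * y k * (c0 + c1 * x l + (x l)\<^sup>2) = 0"
      proof (cases "l = k")
        case True
        show ?thesis
          unfolding True dJ(2) c0_def c1_def by algebra
      next
        case False
        then have "x l \<noteq> x k" using x by (auto dest: injD)
        moreover have "P (x l) - P (x k) = (x l - x k) * (c0 + c1 * x l + (x l)\<^sup>2)"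
          unfolding P_def c0_def c1_def by algebra
        ultimately have "c0 + c1 * x l + (x l)\<^sup>2 = 0" by (simp add: P0)
        then show ?thesis using dJ(1)[OF False] by simp
      qed
      then show ?thesis unfolding T3q by algebra
    qed
    from quadratic_three_zeros[OF x this] show ?thesis by simp
  qed

  define G where "G = (\<lambda>z w. klein_polar lam z w - (z - w)\<^sup>2 * W z w)"
  \<comment> \<open>The discrepancies of the coefficients with both indices at most 2. Those with an
    index 3 or 4 vanish by the choice of \<open>R\<close>, so the two sides differ by a
    \<open>sym_form\<close>.\<close>
  define e11 where "e11 = gram p q r 0 0 - 2 * lam 0"
  define e12 where "e12 = gram p q r 0 1 - lam 1"
  define e13 where "e13 = gram p q r 0 2 - (- p11)"
  define e22 where "e22 = gram p q r 1 1 - (2 * lam 2 + 2 * p11)"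
  define e23 where "e23 = gram p q r 1 2 - (lam 3 + p12)"
  define e33 where "e33 = gram p q r 2 2 - (2 * lam 4 - 2 * p13 + 2 * p22)"
  have edefs: "e11 = p133 * p133 / 2 - 2 * p13 * r0 - 2 * lam 0"
    "e12 = p133 * p233 / 2 - p13 * r1 - p23 * r0 - lam 1"
    "e13 = p133 * p333 / 2 - p13 * r2 - p33 * r0 + p11"
    "e22 = p233 * p233 / 2 - 2 * p23 * r1 - 2 * lam 2 - 2 * p11"
    "e23 = p233 * p333 / 2 - p23 * r2 - p33 * r1 - lam 3 - p12"
    "e33 = p333 * p333 / 2 - 2 * p33 * r2 - 2 * lam 4 + 2 * p13 - 2 * p22"
    by (simp_all add: e11_def e12_def e13_def e22_def e23_def e33_def gram_def p q r algebra_simps)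
  have Gdiff: "Q z * Q w / 2 + P z * R w + P w * R z - G z w =
      sym_form e11 e12 e13 e22 e23 e33 z w" for z w
    unfolding edefs G_def Q_def P_def R_def W_def sym_form_def klein_polar_expand lam7 rdefs
    by (simp add: field_simps) algebra
  \<comment> \<open>On the grid \<open>P\<close> vanishes and \<open>Q\<close> is
    \<open>2 y\<close>, so both sides take the value \<open>2 y k y l\<close>; on the diagonal this
    uses the equation of the curve.\<close>
  have "sym_form e11 e12 e13 e22 e23 e33 (x k) (x l) = 0" for k l
  proof -
    have "G (x k) (x l) = 2 * y k * y l"
    proof (cases "k = l")
      case True
      show ?thesis
        by (simp add: G_def True klein_polar_diag curve[symmetric] power2_eq_square)
    next
      case False
      then show ?thesis using K[OF False] by (simp add: G_def algebra_simps)
    qed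
    then show ?thesis by (simp add: Gdiff[symmetric] P0 Qy)
  qed
  from sym_form_grid_zero[OF x this]
  have e0: "e11 = 0" "e12 = 0" "e13 = 0" "e22 = 0" "e23 = 0" "e33 = 0" by auto

  define s113 where "s113 = - minor p q r 0 1 4"
  define s123 where "s123 = - minor p q r 0 2 4"
  define s223 where "s223 = - minor p q r 1 2 4 - minor p q r 0 3 4"
  have sdefs3: "s113 = p13 * p233 - p23 * p133" "s123 = p13 * p333 - p33 * p133"
    "s223 = p23 * p333 - p33 * p233 + p133"
    by (simp_all add: s113_def s123_def s223_def minor_def p q r)
  \<comment> \<open>The candidate form is the Bezoutian of \<open>P\<close> and \<open>Q\<close>;
    its diagonal value in \<open>Bdiag\<close> is their Wronskian.\<close>
  have B: "(z - w) * sym_form s113 s123 p133 s223 p233 p333 w z = Q w * P z - Q z * P w" for w z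
    unfolding sym_form_def sdefs3 P_def Q_def by (simp add: algebra_simps eval_nat_numeral)
  have Bdiag: "sym_form s113 s123 p133 s223 p233 p333 z z = Q z * P' z - Q' z * P z" for z
    unfolding sym_form_def sdefs3 P_def Q_def P'_def Q'_def
    by (simp add: algebra_simps eval_nat_numeral)
  have "sym_form (p113 - s113) (p123 - s123) (p133 - p133) (p223 - s223) (p233 - p233) (p333 - p333)
      (x k) (x l) = 0" for k l
  proof -
    have "T3 (x k) (x l) = sym_form s113 s123 p133 s223 p233 p333 (x k) (x l)"
    proof (cases "k = l")
      case True
      then show ?thesis using dJ(2)[of k] by (simp add: Bdiag P0 Qy P'_def)
    next
      case False
      then have "x k \<noteq> x l" using x by (auto dest: injD)
      then show ?thesis using B[of "x l" "x k"] dJ(1)[OF False] by (simp add: P0)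
    qed
    then show ?thesis unfolding sym_form_diff T3_def by simp
  qed
  from sym_form_grid_zero[OF x this]
  have s3: "p113 = s113" "p123 = s123" "p223 = s223" by auto

  define s222 where "s222 = - minor p q r 1 2 3 - 2 * minor p q r 0 2 4"
  define s122 where "s122 = - minor p q r 0 2 3 - minor p q r 0 1 4"
  define s112 where "s112 = - minor p q r 0 1 3"
  define s111 where "s111 = - minor p q r 0 1 2"
  have sdefs: "s222 = - (- p23 * (p333 * r3) - p233 * (- p33 * r3 - r2) + r1 * (- p333)) + 2 * s123"
    "s122 = - (- p13 * (p333 * r3) - p133 * (- p33 * r3 - r2) + r0 * (- p333)) + s113"
    "s112 = - (- p13 * (p233 * r3) - p133 * (- p23 * r3 - r1) + r0 * (- p233))"
    "s111 = - (- p13 * (p233 * r2 - p333 * r1) - p133 * (- p23 * r2 + p33 * r1)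
       + r0 * (- p23 * p333 + p33 * p233))"
    by (simp_all add: s222_def s122_def s112_def s111_def s113_def s123_def minor_def p q r)
  \<comment> \<open>\<open>S w t\<close> is the candidate cubic form with two of its three arguments
    equal to \<open>w\<close>. The identity that follows expresses it as minus a confluent
    determinant of \<open>P\<close>, \<open>Q\<close>, \<open>R\<close> (values at \<open>w\<close>,
    derivatives at \<open>w\<close>, values at \<open>t\<close>) divided by the confluent
    Vandermonde determinant \<open>(t - w)^2\<close>.\<close>
  define S where "S = (\<lambda>w z. sym_form s111 s112 s113 s122 s123 p133 w z
     + sym_form s112 s122 s123 s222 s223 p233 w z * w + sym_form s113 s123 p133 s223 p233 p333 w z * w\<^sup>2)"
  have S: "S w t * (t - w)\<^sup>2 = P' w * (Q w * R t - Q t * R w)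
      - P w * (Q' w * R t - Q t * R' w) - P t * (Q w * R' w - Q' w * R w)" for w t
    unfolding S_def sym_form_def sdefs sdefs3 P_def Q_def R_def P'_def Q'_def R'_def
    by (simp add: algebra_simps eval_nat_numeral)
  have Seq: "S (x k) (x l) = T1 (x k) (x l) + T2 (x k) (x l) * x k + T3 (x k) (x l) * (x k)\<^sup>2"
    if "k \<noteq> l" for k l
  proof -
    have G: "G z w = Q z * Q w / 2 + P z * R w + P w * R z" for z w
      using Gdiff[of z w] by (simp add: e0 sym_form_def)
    \<comment> \<open>The derivative of \<open>G\<close> in its first argument. On the diagonal it
      equals \<open>f'\<close>, so \<open>f'\<close> at the three points can be written through
      \<open>Q'\<close>, \<open>P'\<close> and \<open>R\<close>.\<close>
    define G1 where "G1 = (\<lambda>z w. klein_polar_deriv lam z w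
          - sym_form_deriv p11 p12 p13 p22 p23 p33 z w * (z - w)\<^sup>2 - 2 * W z w * (z - w))"
    have "Q' z * Q w / 2 + P' z * R w + P w * R' z - G1 z w =
      sym_form_deriv e11 e12 e13 e22 e23 e33 z w" for z w
      unfolding edefs G1_def Q_def P_def R_def Q'_def P'_def R'_def W_def sym_form_def
        sym_form_deriv_def klein_polar_deriv_expand lam7 rdefs
      by (simp add: field_simps eval_nat_numeral)
    then have G1: "G1 z w = Q' z * Q w / 2 + P' z * R w + P w * R' z" for z w
      by (simp add: e0 sym_form_deriv_def)
    have "curve_poly_deriv lam z = G1 z z" for z
      by (simp add: G1_def klein_polar_deriv_diag)
    then have f': "curve_poly_deriv lam (x k) = Q' (x k) * y k + P' (x k) * R (x k)"
      by (simp add: G1 P0 Qy)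
    have ne: "x k \<noteq> x l" using x that by (auto dest: injD)
    have "(T1 (x k) (x l) + T2 (x k) (x l) * x k + T3 (x k) (x l) * (x k)\<^sup>2) * (x k - x l)\<^sup>2
        = 2 * y k * G1 (x k) (x l) - 2 * curve_poly_deriv lam (x k) * y l"
      using dK[OF that] by (simp add: G1_def)
    also have "\<dots> = S (x k) (x l) * (x l - x k)\<^sup>2"
      unfolding S G1 f' P0 Qy by (simp add: algebra_simps)
    also have "(x l - x k)\<^sup>2 = (x k - x l)\<^sup>2" by (rule power2_commute)
    finally show ?thesis
      using ne by (metis mult_right_cancel power_not_zero right_minus_eq)
  qed
  \<comment> \<open>Once \<open>p113\<close>, \<open>p123\<close> and \<open>p223\<close> are known,
    four differences are left, and the expression is linear in \<open>z\<close>.\<close>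
  have Sdiff: "T1 w z + T2 w z * w + T3 w z * w\<^sup>2 - S w z =
      (p111 - s111 + 2 * (p112 - s112) * w + (p122 - s122) * w\<^sup>2)
      + (p112 - s112 + 2 * (p122 - s122) * w + (p222 - s222) * w\<^sup>2) * z" for w z
  proof -
    have "T1 w z + T2 w z * w + T3 w z * w\<^sup>2 - S w z =
      sym_form (p111 - s111) (p112 - s112) (p113 - s113) (p122 - s122) (p123 - s123) (p133 - p133) w z
      + sym_form (p112 - s112) (p122 - s122) (p123 - s123) (p222 - s222) (p223 - s223) (p233 - p233) w z * w"
      unfolding sym_form_diff T1_def T2_def T3_def S_def s3 by (simp add: algebra_simps)
    then show ?thesis
      by (simp add: s3 sym_form_def algebra_simps power2_eq_square)
  qed
  have E: "(p111 - s111 + 2 * (p112 - s112) * x k + (p122 - s122) * (x k)\<^sup>2)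
      + (p112 - s112 + 2 * (p122 - s122) * x k + (p222 - s222) * (x k)\<^sup>2) * x l = 0"
    if "k \<noteq> l" for k l
    unfolding Sdiff[symmetric] Seq[OF that] by (rule diff_self)
  have "(p111 - s111) + (2 * (p112 - s112)) * x k + (p122 - s122) * (x k)\<^sup>2 = 0 \<and>
      (p112 - s112) + (2 * (p122 - s122)) * x k + (p222 - s222) * (x k)\<^sup>2 = 0" (is "?A = 0 \<and> ?B = 0") for k
  proof -
    \<comment> \<open>For fixed \<open>k\<close> the expression in \<open>E\<close> is linear in
      \<open>x l\<close> and vanishes for the two indices other than \<open>k\<close>, so both of
      its coefficients vanish. These are quadratics in \<open>x k\<close> and thus vanish at three
      points.\<close>
    obtain l m :: 3 where lm: "l \<noteq> m" "k \<noteq> l" "k \<noteq> m"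
    proof -
      consider "k = 1" | "k = 2" | "k = 3" using exhaust_3[of k] by blast
      then show thesis
      proof cases
        case 1 show thesis by (rule that[of 2 3]) (simp_all add: 1)
      next
        case 2 show thesis by (rule that[of 1 3]) (simp_all add: 2)
      next
        case 3 show thesis by (rule that[of 1 2]) (simp_all add: 3)
      qed
    qed
    have AB: "?A + ?B * x l = 0" "?A + ?B * x m = 0"
      using E[OF lm(2)] E[OF lm(3)] by simp_all
    then have "?A + ?B * x l = ?A + ?B * x m" by (simp only:)
    then have "?B * x l = ?B * x m" by (rule add_left_imp_eq)
    moreover have "x l \<noteq> x m" using x lm by (auto dest: injD)
    ultimately have "?B = 0" using mult_left_cancel by blast
    with AB(1) show ?thesis by simp
  qed
  then have "(p111 - s111) + (2 * (p112 - s112)) * x k + (p122 - s122) * (x k)\<^sup>2 = 0"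
    "(p112 - s112) + (2 * (p122 - s122)) * x k + (p222 - s222) * (x k)\<^sup>2 = 0" for k
    by blast+
  from this[THEN quadratic_three_zeros[OF x]]
  have "p111 = s111" "p112 = s112" "p122 = s122" "p222 = s222" by auto
  note eqs = this s3
  show ?thesis
    using e0 unfolding e11_def e12_def e13_def e22_def e23_def e33_def right_minus_eq
    unfolding eqs s111_def s112_def s122_def s222_def s113_def s123_def s223_def by blast
qed

section \<open>The curve near infinity\<close>

context
  fixes \<sigma> :: "complex ^ 3 \<Rightarrow> complex"
  assumes \<sigma>: "holomorphic3_on \<sigma> UNIV"
begin

lemma open_nonzero: "open {v. \<sigma> v \<noteq> 0}"
  using holomorphic3_on_imp_continuous_on[OF \<sigma>] by (intro open_Collect_neq) auto

lemma holomorphic3_on_log_deriv: "holomorphic3_on (\<lambda>v. pd k \<sigma> v / \<sigma> v) {v. \<sigma> v \<noteq> 0}"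
proof (rule holomorphic3_on_divide)
  show "holomorphic3_on (pd k \<sigma>) {v. \<sigma> v \<noteq> 0}"
    by (rule holomorphic3_on_subset[OF holomorphic3_on_pd[OF \<sigma> open_UNIV] subset_UNIV])
  show "holomorphic3_on \<sigma> {v. \<sigma> v \<noteq> 0}"
    by (rule holomorphic3_on_subset[OF \<sigma> subset_UNIV])
qed simp

lemma holomorphic3_on_wp2: "holomorphic3_on (wp2 \<sigma> i j) {v. \<sigma> v \<noteq> 0}"
  unfolding wp2_def[abs_def]
  by (intro holomorphic3_on_minus holomorphic3_on_pd holomorphic3_on_log_deriv open_nonzero)

lemma holomorphic3_on_wp3: "holomorphic3_on (wp3 \<sigma> i j k) {v. \<sigma> v \<noteq> 0}"
  unfolding wp3_def[abs_def]
  by (intro holomorphic3_on_minus holomorphic3_on_pd holomorphic3_on_log_deriv open_nonzero)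

lemma pd_wp2:
  assumes "\<sigma> u \<noteq> 0"
  shows "pd i (wp2 \<sigma> j k) u = wp3 \<sigma> i j k u"
proof -
  have "holomorphic3_on (pd j (\<lambda>v. pd k \<sigma> v / \<sigma> v)) {v. \<sigma> v \<noteq> 0}"
    by (intro holomorphic3_on_pd holomorphic3_on_log_deriv open_nonzero)
  from holomorphic3_on_has_partials[OF this, of u] assms
  have "has_partials (\<lambda>v. - pd j (\<lambda>v. pd k \<sigma> v / \<sigma> v) v)
      (\<lambda>i. - pd i (pd j (\<lambda>v. pd k \<sigma> v / \<sigma> v)) u) u"
    by (intro has_partials_minus) simp
  from has_partials_imp_pd[OF this] show ?thesis
    by (simp add: wp2_def[abs_def] wp3_def)
qed

text \<open>The quotient rule produces a product of two first derivatives and a mixed second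
  derivative of \<open>\<sigma>\<close>, both symmetric in the indices.\<close>

lemma wp2_commute:
  assumes "\<sigma> u \<noteq> 0"
  shows "wp2 \<sigma> i j u = wp2 \<sigma> j i u"
proof -
  have pd_log: "pd i (\<lambda>v. pd j \<sigma> v / \<sigma> v) u =
      pd j \<sigma> u * (- pd i \<sigma> u / (\<sigma> u)\<^sup>2) + pd i (pd j \<sigma>) u * inverse (\<sigma> u)" for i j
  proof -
    have "has_partials (pd j \<sigma>) (\<lambda>i. pd i (pd j \<sigma>) u) u"
      by (rule holomorphic3_on_has_partials[OF holomorphic3_on_pd[OF \<sigma> open_UNIV] UNIV_I])
    moreover have "has_partials (\<lambda>v. inverse (\<sigma> v)) (\<lambda>i. - pd i \<sigma> u / (\<sigma> u)\<^sup>2) u"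
      by (rule has_partials_inverse[OF holomorphic3_on_has_partials[OF \<sigma> UNIV_I] assms])
    ultimately show ?thesis
      unfolding divide_inverse[of "pd j \<sigma> _"]
      by (rule has_partials_imp_pd[OF has_partials_mult])
  qed
  show ?thesis
    unfolding wp2_def pd_log pd_commute[OF \<sigma> open_UNIV UNIV_I, of i j u]
    by (simp add: mult_ac)
qed

lemma wp3_commute12:
  assumes "\<sigma> u \<noteq> 0"
  shows "wp3 \<sigma> i j k u = wp3 \<sigma> j i k u"
  unfolding wp3_def neg_equal_iff_equal
  by (rule pd_commute[OF holomorphic3_on_log_deriv open_nonzero]) (use assms in simp)

text \<open>The symmetry of \<open>wp2\<close> holds on the open set where \<open>\<sigma>\<close>
  does not vanish, and may therefore be differentiated there.\<close>

lemma wp3_commute23: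
  assumes "\<sigma> u \<noteq> 0"
  shows "wp3 \<sigma> i j k u = wp3 \<sigma> i k j u"
proof -
  have "pd i (wp2 \<sigma> j k) u = pd i (wp2 \<sigma> k j) u"
    by (rule pd_cong[OF open_nonzero _ _ holomorphic3_on_wp2]) (simp_all add: assms wp2_commute[of _ j k])
  then show ?thesis by (simp only: pd_wp2[OF assms])
qed

end

text \<open>\<open>s\<close> is the local parameter at infinity with \<open>x = s\<^sup>-\<^sup>2\<close> and \<open>y = g(s) s\<^sup>-\<^sup>7\<close>, where
  \<open>g(s)\<^sup>2 = s\<^sup>1\<^sup>4 f(s\<^sup>-\<^sup>2)\<close>. In it \<open>du = omega g s ds\<close>.\<close>

definition omega :: "(complex \<Rightarrow> complex) \<Rightarrow> complex \<Rightarrow> complex ^ 3" where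
  "omega g s = vector [- (s ^ 4) / g s, - (s ^ 2) / g s, - 1 / g s]"

definition infinity_point :: "(complex \<Rightarrow> complex) \<Rightarrow> complex \<Rightarrow> curve_point" where
  "infinity_point g s = (if s = 0 then None else Some (1 / s\<^sup>2, g s / s ^ 7))"

lemma infinity_coords_infinity_point:
  "infinity_coords (infinity_point g s) = (s\<^sup>2, s * g s)"
  by (simp add: infinity_point_def field_simps eval_nat_numeral)

lemma fst_affine_coords_infinity_point:
  "fst (affine_coords (infinity_point g s)) = 1 / s\<^sup>2"
  by (simp add: infinity_point_def)

text \<open>The second argument of \<open>du_form\<close> is the derivative in \<open>t\<close> of
  \<open>x = 1 / (t s)^2\<close> along the ray through \<open>s\<close>; the factor \<open>s\<close>
  on the right comes from the chain rule.\<close>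

lemma du_form_infinity_point:
  assumes "s \<noteq> 0" "t \<noteq> 0" "g (t * s) \<noteq> 0"
  shows "du_form (infinity_point g (t * s)) (- 2 / (t ^ 3 * s\<^sup>2)) = s *s omega g (t * s)"
  using assms by (simp add: infinity_point_def omega_def vec_eq_iff forall_3 field_simps eval_nat_numeral)

text \<open>The coordinates at infinity are \<open>(s^2, s * g s)\<close>, holomorphic in the
  parameter, so a ray is smooth in them, including its start at infinity.\<close>

lemma C1_path_infinity_point:
  assumes g: "g holomorphic_on ball 0 \<rho>" and s: "s \<in> ball 0 \<rho>"
  shows "(infinity_coords \<circ> (\<lambda>t. infinity_point g (of_real t * s))) C1_differentiable_on {0..1}"
proof -
  have mem: "of_real t * s \<in> ball 0 \<rho>" if "t \<in> {0..1}" for t :: real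
  proof -
    have "norm (of_real t * s) \<le> 1 * norm s"
      using that by (simp add: norm_mult mult_left_le_one_le)
    then show ?thesis using s by simp
  qed
  have hol: "(\<lambda>s. s * g s) holomorphic_on ball 0 \<rho>"
    by (intro holomorphic_intros g)
  define D where "D = (\<lambda>t::real. (2 * of_real t * s\<^sup>2, s * deriv (\<lambda>s. s * g s) (of_real t * s)))"
  have "((\<lambda>t. ((of_real t * s)\<^sup>2, (of_real t * s) * g (of_real t * s))) has_vector_derivative D t) (at t)"
    if "t \<in> {0..1}" for t :: real
  proof -
    have "((\<lambda>z. (z * s)\<^sup>2) has_field_derivative 2 * of_real t * s\<^sup>2) (at (of_real t))"
      by (auto intro!: derivative_eq_intros simp: power2_eq_square)
    moreover have "((\<lambda>s. s * g s) has_field_derivative deriv (\<lambda>s. s * g s) (of_real t * s)) (at (of_real t * s))"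
      using holomorphic_derivI[OF hol open_ball mem[OF that]] .
    then have "((\<lambda>z. (z * s) * g (z * s)) has_field_derivative
        deriv (\<lambda>s. s * g s) (of_real t * s) * s) (at (of_real t))"
      by (rule DERIV_chain2) (auto intro!: derivative_eq_intros)
    ultimately show ?thesis
      unfolding D_def
      by (intro has_vector_derivative_Pair has_vector_derivative_real_field[of "\<lambda>z. (z * s)\<^sup>2"]
          has_vector_derivative_real_field[of "\<lambda>z. (z * s) * g (z * s)"]) (simp_all add: mult.commute)
  qed
  moreover have "continuous_on {0..1} D"
  proof -
    have "continuous_on (ball 0 \<rho>) (deriv (\<lambda>s. s * g s))"
      by (intro holomorphic_on_imp_continuous_on holomorphic_deriv hol open_ball)
    then have "continuous_on {0..1} (\<lambda>t::real. deriv (\<lambda>s. s * g s) (of_real t * s))"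
      by (rule continuous_on_compose2) (use mem in \<open>auto intro!: continuous_intros\<close>)
    then show ?thesis
      unfolding D_def by (intro continuous_intros)
  qed
  ultimately have "(\<lambda>t. ((of_real t * s)\<^sup>2, (of_real t * s) * g (of_real t * s))) C1_differentiable_on {0..1}"
    unfolding C1_differentiable_on_def by blast
  then show ?thesis
    by (simp only: o_def infinity_coords_infinity_point)
qed

text \<open>The path is the image of the segment from 0 to \<open>s\<close> in the parameter disc.
  As \<open>A\<close> is a primitive of \<open>omega g\<close>, the fundamental theorem of calculus
  evaluates the integral.\<close>

lemma infinity_point_abel_value:
  assumes g: "g holomorphic_on ball 0 \<rho>" and g0: "\<And>s. s \<in> ball 0 \<rho> \<Longrightarrow> g s \<noteq> 0"
    and curve: "\<And>s. s \<in> ball 0 \<rho> \<Longrightarrow> infinity_point g s \<in> curve lam"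
    and A: "\<And>s. s \<in> ball 0 \<rho> \<Longrightarrow> (A has_derivative (\<lambda>h. h *s omega g s)) (at s)" and A0: "A 0 = 0"
    and s: "s \<in> ball 0 \<rho>" "s \<noteq> 0"
  shows "A s \<in> abel_values lam (Some (1 / s\<^sup>2, g s / s ^ 7))"
proof -
  define \<gamma> where "\<gamma> = (\<lambda>t::real. infinity_point g (of_real t * s))"
  have mem: "of_real t * s \<in> ball 0 \<rho>" if "t \<in> {0..1}" for t :: real
  proof -
    have "norm (of_real t * s) \<le> 1 * norm s"
      using that by (simp add: norm_mult mult_left_le_one_le)
    then show ?thesis using s by simp
  qed
  have "curve_path lam \<gamma>"
    unfolding curve_path_def Let_def
  proof (intro conjI ballI)
    show "\<gamma> ` {0..1} \<subseteq> curve lam"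
      using curve mem unfolding \<gamma>_def by blast
    fix t :: real assume "t \<in> {0..1}"
    \<comment> \<open>Since \<open>x = 1 / (t s)^2\<close> is never 0, the piece at infinity
      contains the whole path, and the radius 1 works at every time.\<close>
    have "\<gamma> ` I \<subseteq> infinity_part" for I
      using s by (auto simp: \<gamma>_def infinity_point_def infinity_part_def split: if_splits)
    moreover have "(infinity_coords \<circ> \<gamma>) piecewise_C1_differentiable_on I" if "I \<subseteq> {0..1}" for I
      using C1_path_infinity_point[OF g s(1)] that unfolding \<gamma>_def
      by (blast intro: C1_differentiable_imp_piecewise C1_differentiable_on_subset)
    ultimately show "\<exists>e>0.
        \<gamma> ` ({0..1} \<inter> {t - e..t + e}) \<subseteq> affine_part \<and>
        (affine_coords \<circ> \<gamma>) piecewise_C1_differentiable_on {0..1} \<inter> {t - e..t + e} \<or>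
        \<gamma> ` ({0..1} \<inter> {t - e..t + e}) \<subseteq> infinity_part \<and>
        (infinity_coords \<circ> \<gamma>) piecewise_C1_differentiable_on {0..1} \<inter> {t - e..t + e}"
      by (intro exI[of _ 1]) simp
  qed
  moreover have "\<gamma> 0 = None" "\<gamma> 1 = Some (1 / s\<^sup>2, g s / s ^ 7)"
    using s by (simp_all add: \<gamma>_def infinity_point_def)
  moreover have "du_integral \<gamma> = A s"
  proof -
    define F where "F = (\<lambda>t. du_form (\<gamma> t) (vector_derivative (\<lambda>s. fst (affine_coords (\<gamma> s))) (at t)))"
    have A': "((\<lambda>t::real. A (of_real t * s)) has_derivative (\<lambda>h. h *\<^sub>R (s *s omega g (of_real t * s)))) (at t)"
      if "t \<in> {0..1}" for t :: real
    proof -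
      have "((\<lambda>t::real. of_real t * s) has_derivative (\<lambda>h. of_real h * s)) (at t)"
        by (auto intro!: derivative_eq_intros)
      from has_derivative_compose[OF this A[OF mem[OF that]]]
      have "((\<lambda>t::real. A (of_real t * s)) has_derivative (\<lambda>h. (of_real h * s) *s omega g (of_real t * s))) (at t)" .
      moreover have "(\<lambda>h::real. (of_real h * s) *s omega g (of_real t * s)) =
          (\<lambda>h. h *\<^sub>R (s *s omega g (of_real t * s)))"
        by (auto simp: fun_eq_iff vec_eq_iff scaleR_conv_of_real[symmetric])
      ultimately show ?thesis by simp
    qed
    \<comment> \<open>Derivatives are compared in the interior only: at \<open>t = 0\<close> the
      path is at infinity, where \<open>du_form\<close> returns the default value 0.\<close>
    have "(F has_integral A (of_real 1 * s) - A (of_real 0 * s)) {0..1}"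
    proof (rule fundamental_theorem_of_calculus_interior)
      show "continuous_on {0..1} (\<lambda>t::real. A (of_real t * s))"
        using A' by (intro continuous_at_imp_continuous_on ballI) (blast intro: has_derivative_continuous)
      fix t :: real assume t: "t \<in> {0<..<1}"
      have "((\<lambda>z. 1 / (z * s)\<^sup>2) has_field_derivative - 2 / (of_real t ^ 3 * s\<^sup>2)) (at (of_real t))"
        using t s(2) by (auto intro!: derivative_eq_intros simp: field_simps eval_nat_numeral)
      from vector_derivative_at[OF has_vector_derivative_real_field[OF this]]
      have "vector_derivative (\<lambda>s'. fst (affine_coords (\<gamma> s'))) (at t) = - 2 / (of_real t ^ 3 * s\<^sup>2)"
        by (simp only: \<gamma>_def fst_affine_coords_infinity_point)
      then have "F t = s *s omega g (of_real t * s)"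
        using du_form_infinity_point[OF s(2), of "of_real t" g] t g0[OF mem[of t]]
        by (simp only: F_def \<gamma>_def) simp
      then show "((\<lambda>t. A (of_real t * s)) has_vector_derivative F t) (at t)"
        using A'[of t] t by (simp add: has_vector_derivative_def)
    qed simp
    then show ?thesis
      by (simp add: du_integral_def F_def A0 integral_unique)
  qed
  ultimately show ?thesis
    unfolding abel_values_def by (smt (verit) mem_Collect_eq)
qed

text \<open>The polynomial \<open>h s = s^14 f(s^-2)\<close> has the value \<open>lam 7 = 1\<close>
  at 0. Its principal square root \<open>g\<close> is holomorphic near 0, and even because
  \<open>h\<close> is.\<close>

lemma exists_infinity_chart:
  assumes "lam 7 = 1"
  obtains \<rho> g A where "\<rho> > 0" "g holomorphic_on ball 0 \<rho>" "\<And>s. g (- s) = g s"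
    "\<And>s. s \<in> ball 0 \<rho> \<Longrightarrow> g s \<noteq> 0"
    "\<And>s. s \<noteq> 0 \<Longrightarrow> (g s / s ^ 7)\<^sup>2 = curve_poly lam (1 / s\<^sup>2)"
    "\<And>s. A (- s) = - A s"
    "\<And>s. s \<in> ball 0 \<rho> \<Longrightarrow> (A has_derivative (\<lambda>h. h *s omega g s)) (at s)"
proof -
  define h where "h = (\<lambda>s. 1 + lam 6 * s ^ 2 + lam 5 * s ^ 4 + lam 4 * s ^ 6 + lam 3 * s ^ 8
     + lam 2 * s ^ 10 + lam 1 * s ^ 12 + lam 0 * s ^ 14)"
  define g where "g = (\<lambda>s. csqrt (h s))"
  have "h holomorphic_on UNIV"
    unfolding h_def by (intro holomorphic_intros)
  then have "continuous_on UNIV h" by (rule holomorphic_on_imp_continuous_on)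
  then have "isCont h 0" by (simp add: continuous_on_eq_continuous_at)
  \<comment> \<open>Distance less than 1 from \<open>h 0 = 1\<close> keeps the real part of
    \<open>h\<close> positive, away from the branch cut of \<open>csqrt\<close>.\<close>
  then obtain \<rho> where \<rho>: "\<rho> > 0" "\<And>s. dist s 0 < \<rho> \<Longrightarrow> dist (h s) (h 0) < 1"
    using zero_less_one unfolding continuous_at_eps_delta by blast
  have hnp: "h s \<notin> \<real>\<^sub>\<le>\<^sub>0" if "s \<in> ball 0 \<rho>" for s
  proof
    assume "h s \<in> \<real>\<^sub>\<le>\<^sub>0"
    then have "Re (h s) \<le> 0" by (auto simp: complex_nonpos_Reals_iff)
    moreover have "norm (h s - 1) < 1"
      using \<rho>(2)[of s] that by (simp add: dist_norm h_def)
    then have "\<bar>Re (h s - 1)\<bar> < 1"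
      using abs_Re_le_cmod[of "h s - 1"] by linarith
    ultimately show False by simp
  qed
  have "h holomorphic_on ball 0 \<rho>"
    unfolding h_def by (intro holomorphic_intros)
  then have g: "g holomorphic_on ball 0 \<rho>"
    unfolding g_def using hnp by (rule holomorphic_on_csqrt')
  have even: "g (- s) = g s" for s by (simp add: g_def h_def)
  have g0: "g s \<noteq> 0" if "s \<in> ball 0 \<rho>" for s
    using hnp[OF that] by (auto simp: g_def)
  have curve: "(g s / s ^ 7)\<^sup>2 = curve_poly lam (1 / s\<^sup>2)" if "s \<noteq> 0" for s
  proof -
    have pow: "s ^ 14 * (1 / s\<^sup>2) ^ j = s ^ (14 - 2 * j)" if "j \<le> 7" for j
    proof -
      have "(1 / s\<^sup>2) ^ j = 1 / s ^ (2 * j)"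
        by (simp add: power_one_over power_mult)
      moreover have "s ^ (14 - 2 * j) = s ^ 14 / s ^ (2 * j)"
        by (rule power_diff) (use \<open>s \<noteq> 0\<close> that in auto)
      ultimately show ?thesis by simp
    qed
    have "s ^ 14 * curve_poly lam (1 / s\<^sup>2) = (\<Sum>j\<le>7. lam j * s ^ (14 - 2 * j))"
      unfolding curve_poly_def sum_distrib_left
      by (rule sum.cong) (simp_all add: pow mult.left_commute[of "s ^ 14"])
    also have "{..7::nat} = {0, 1, 2, 3, 4, 5, 6, 7}" by auto
    also have "(\<Sum>j\<in>\<dots>. lam j * s ^ (14 - 2 * j)) = h s"
      by (simp add: h_def assms)
    finally have "h s = s ^ 14 * curve_poly lam (1 / s\<^sup>2)" ..
    moreover have "(g s / s ^ 7)\<^sup>2 = h s / s ^ 14"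
      by (simp add: power_divide g_def flip: power_mult)
    ultimately show ?thesis using that by simp
  qed
  have "\<exists>a. \<forall>s\<in>ball 0 \<rho>. (a has_field_derivative omega g s $ i) (at s)" for i
  proof -
    have "(\<lambda>s. omega g s $ i) holomorphic_on ball 0 \<rho>"
      using exhaust_3[of i] g0 by (auto simp: omega_def intro!: holomorphic_intros g)
    from holomorphic_convex_primitive'[OF convex_ball open_ball this] obtain a
      where "\<And>s. s \<in> ball 0 \<rho> \<Longrightarrow> (a has_field_derivative omega g s $ i) (at s within ball 0 \<rho>)"
      by blast
    then show ?thesis by (auto simp: at_within_open[OF _ open_ball] intro!: exI[of _ a])
  qed
  then have "\<exists>a. \<forall>i. \<forall>s\<in>ball 0 \<rho>. (a i has_field_derivative omega g s $ i) (at s)"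
    by (intro choice allI)
  then obtain a where a: "\<And>i s. s \<in> ball 0 \<rho> \<Longrightarrow> (a i has_field_derivative omega g s $ i) (at s)"
    by blast
  \<comment> \<open>As \<open>omega g\<close> is even, the odd part of a primitive is again a
    primitive. Oddness turns the hyperelliptic involution, which is \<open>s\<close> to
    \<open>- s\<close> in this parameter, into negation, and gives \<open>A 0 = 0\<close>.\<close>
  define A :: "complex \<Rightarrow> complex ^ 3" where "A = (\<lambda>s. \<chi> i. (a i s - a i (- s)) / 2)"
  have A_sum: "A = (\<lambda>s. \<Sum>i\<in>UNIV. ((a i s - a i (- s)) / 2) *s axis i 1)"
  proof
    fix s show "A s = (\<Sum>i\<in>UNIV. ((a i s - a i (- s)) / 2) *s axis i 1)"
      using basis_expansion[of "A s"] by (simp add: A_def)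
  qed
  have A_odd: "A (- s) = - A s" for s
    by (simp add: A_def vec_eq_iff minus_divide_left)
  have A': "(A has_derivative (\<lambda>h. h *s omega g s)) (at s)" if s: "s \<in> ball 0 \<rho>" for s
  proof -
    have omega1: "omega g (- s) = omega g s"
      by (simp add: omega_def even)
    have "((\<lambda>s. (a i s - a i (- s)) / 2) has_field_derivative omega g s $ i) (at s)" for i
    proof -
      have "((\<lambda>s. a i (- s)) has_field_derivative omega g (- s) $ i * (- 1)) (at s)"
        by (rule DERIV_chain2[OF a]) (use s in \<open>auto intro!: derivative_eq_intros\<close>)
      from DERIV_cdivide[OF DERIV_diff[OF a[OF s, of i] this], where c = 2] show ?thesis
        by (simp add: omega1)
    qed
    then have "((\<lambda>s. (a i s - a i (- s)) / 2) has_derivative (\<lambda>h. h * omega g s $ i)) (at s)" for i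
      by (simp add: has_field_derivative_def mult.commute[of _ "omega g s $ i"])
    then have "((\<lambda>s. ((a i s - a i (- s)) / 2) *s (axis i 1 :: complex ^ 3)) has_derivative
        (\<lambda>h. (h * omega g s $ i) *s axis i 1)) (at s)" for i
      by (rule has_derivative_compose[OF _ has_derivative_vector_scale])
    then have "(A has_derivative (\<lambda>h. \<Sum>i\<in>UNIV. (h * omega g s $ i) *s axis i 1)) (at s)"
      unfolding A_sum by (intro has_derivative_sum)
    moreover have "(\<Sum>i\<in>UNIV. (h * omega g s $ i) *s axis i 1) = h *s omega g s" for h
      using basis_expansion[of "h *s omega g s"] by simp
    ultimately show ?thesis by simp
  qed
  show thesis
    by (rule that[OF \<rho>(1) g even g0 curve A_odd A'])
qed

text \<open>The prescribed Taylor part of weight 6 has the value \<open>1 / 45 + 1\<close> at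
  \<open>(1, 0, 1)\<close>, whereas all derivatives of the zero function vanish.\<close>

lemma not_all_zero_kleinian_sigma:
  assumes "kleinian_sigma lam \<sigma>"
  shows "\<exists>u. \<sigma> u \<noteq> 0"
proof (rule ccontr)
  assume "\<nexists>u. \<sigma> u \<noteq> 0"
  then have "\<sigma> = (\<lambda>u. 0)" by auto
  moreover have pd0: "pd i (\<lambda>u. 0) = (\<lambda>u. 0)" for i
    by (simp add: pd_def fun_eq_iff)
  then have "(pd i ^^ n) (\<lambda>u. 0) = (\<lambda>u. 0)" for i n
    by (induction n) auto
  ultimately have "weight_part \<sigma> 6 u = 0" for u
    by (simp add: weight_part_def case_prod_unfold)
  moreover have "weight_part \<sigma> 6 (vector [1, 0, 1]) = 1 / 45 + 1"
    using assms unfolding kleinian_sigma_def by simp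
  ultimately show False by simp
qed

text \<open>Allows an identity that holds for all nearby parameters to be differentiated.\<close>

lemma DERIV_eventually_zero:
  assumes "(f has_field_derivative D) (at a)" "eventually (\<lambda>t. f t = 0) (nhds a)"
  shows "D = (0 :: 'a::real_normed_field)"
proof -
  have "((\<lambda>t. 0) has_field_derivative D) (at a)"
    using DERIV_cong_ev[OF refl assms(2) refl] assms(1) by simp
  then show ?thesis by (rule DERIV_unique) simp
qed

lemma klein_sum_eq_sym_form:
  assumes "holomorphic3_on \<sigma> UNIV" "\<sigma> v \<noteq> 0"
  shows "(\<Sum>i=1..3. \<Sum>j=1..3. wp2 \<sigma> (of_nat i) (of_nat j) v * x ^ (i - 1) * z ^ (j - 1)) =
    sym_form (wp2 \<sigma> 1 1 v) (wp2 \<sigma> 1 2 v) (wp2 \<sigma> 1 3 v) (wp2 \<sigma> 2 2 v) (wp2 \<sigma> 2 3 v) (wp2 \<sigma> 3 3 v) x z"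
proof -
  have *: "{1..3::nat} = {1, 2, 3}" by auto
  show ?thesis
    unfolding * using wp2_commute[OF assms, of 2 1] wp2_commute[OF assms, of 3 1] wp2_commute[OF assms, of 3 2]
    by (simp add: sym_form_def algebra_simps power2_eq_square)
qed

section \<open>Relations for the Kleinian functions\<close>

lemma has_field_derivative_sym_form:
  assumes "(a11 has_field_derivative d11) (at t)" "(a12 has_field_derivative d12) (at t)"
    "(a13 has_field_derivative d13) (at t)" "(a22 has_field_derivative d22) (at t)"
    "(a23 has_field_derivative d23) (at t)" "(a33 has_field_derivative d33) (at t)"
    "(x has_field_derivative x') (at t)"
  shows "((\<lambda>t. sym_form (a11 t) (a12 t) (a13 t) (a22 t) (a23 t) (a33 t) (x t) z) has_field_derivative
    sym_form d11 d12 d13 d22 d23 d33 (x t) z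
      + sym_form_deriv (a11 t) (a12 t) (a13 t) (a22 t) (a23 t) (a33 t) (x t) z * x') (at t)"
  unfolding sym_form_def
  by (rule assms derivative_eq_intros refl)+ (simp add: sym_form_deriv_def algebra_simps power2_eq_square)

lemma has_field_derivative_klein_polar:
  "((\<lambda>x. klein_polar lam x z) has_field_derivative klein_polar_deriv lam x z) (at x)"
  unfolding klein_polar_expand
  by (rule derivative_eq_intros refl)+
     (simp add: klein_polar_deriv_expand algebra_simps eval_nat_numeral)

lemma has_field_derivative_curve_poly:
  "(curve_poly lam has_field_derivative curve_poly_deriv lam x) (at x)"
  unfolding curve_poly_expand[abs_def]
  by (rule derivative_eq_intros refl)+
     (simp add: curve_poly_deriv_expand algebra_simps eval_nat_numeral)

text \<open>The coefficients of \<open>P\<close>, \<open>Q\<close>, \<open>R\<close> up to degree 4.\<close>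

definition p_coeffs :: "(complex ^ 3 \<Rightarrow> complex) \<Rightarrow> complex ^ 3 \<Rightarrow> nat \<Rightarrow> complex" where
  "p_coeffs \<sigma> u = (!) [- wp2 \<sigma> 1 3 u, - wp2 \<sigma> 2 3 u, - wp2 \<sigma> 3 3 u, 1, 0]"

definition q_coeffs :: "(complex ^ 3 \<Rightarrow> complex) \<Rightarrow> complex ^ 3 \<Rightarrow> nat \<Rightarrow> complex" where
  "q_coeffs \<sigma> u = (!) [wp3 \<sigma> 1 3 3 u, wp3 \<sigma> 2 3 3 u, wp3 \<sigma> 3 3 3 u, 0, 0]"

definition r_coeffs :: "(nat \<Rightarrow> complex) \<Rightarrow> (complex ^ 3 \<Rightarrow> complex) \<Rightarrow> complex ^ 3 \<Rightarrow> nat \<Rightarrow> complex" where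
  "r_coeffs lam \<sigma> u = (let r3 = lam 6 + wp2 \<sigma> 3 3 u in
     (!) [- wp2 \<sigma> 1 2 u + wp2 \<sigma> 1 3 u * r3,
          2 * wp2 \<sigma> 1 3 u - wp2 \<sigma> 2 2 u + wp2 \<sigma> 2 3 u * r3,
          lam 5 + wp2 \<sigma> 2 3 u + wp2 \<sigma> 3 3 u * r3, r3, 1])"

text \<open>The analogous equations for entries of \<open>gram\<close> with an index 3 or 4 and for \<open>\<wp>\<^sub>i\<^sub>3\<^sub>3\<close> hold by the
  choice of the coefficients.\<close>

definition minor_relations :: "(nat \<Rightarrow> complex) \<Rightarrow> (complex ^ 3 \<Rightarrow> complex) \<Rightarrow> complex ^ 3 \<Rightarrow> bool" where
  "minor_relations lam \<sigma> u \<longleftrightarrow>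
     (let p = p_coeffs \<sigma> u; q = q_coeffs \<sigma> u; r = r_coeffs lam \<sigma> u in
      gram p q r 0 0 = 2 * lam 0 \<and> gram p q r 0 1 = lam 1 \<and> gram p q r 0 2 = - wp2 \<sigma> 1 1 u \<and>
      gram p q r 1 1 = 2 * lam 2 + 2 * wp2 \<sigma> 1 1 u \<and> gram p q r 1 2 = lam 3 + wp2 \<sigma> 1 2 u \<and>
      gram p q r 2 2 = 2 * lam 4 - 2 * wp2 \<sigma> 1 3 u + 2 * wp2 \<sigma> 2 2 u \<and>
      wp3 \<sigma> 2 2 3 u = - minor p q r 1 2 4 - minor p q r 0 3 4 \<and>
      wp3 \<sigma> 1 2 3 u = - minor p q r 0 2 4 \<and> wp3 \<sigma> 1 1 3 u = - minor p q r 0 1 4 \<and>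
      wp3 \<sigma> 2 2 2 u = - minor p q r 1 2 3 - 2 * minor p q r 0 2 4 \<and>
      wp3 \<sigma> 1 2 2 u = - minor p q r 0 2 3 - minor p q r 0 1 4 \<and>
      wp3 \<sigma> 1 1 2 u = - minor p q r 0 1 3 \<and> wp3 \<sigma> 1 1 1 u = - minor p q r 0 1 2)"

text \<open>Joins a sigma function of the curve with one chart at infinity as produced by
  \<open>exists_infinity_chart\<close>; all points of the curve used below have parameters in the
  disc of radius \<open>\<rho>\<close>.\<close>

locale kleinian_chart =
  fixes lam :: "nat \<Rightarrow> complex" and \<sigma> :: "complex ^ 3 \<Rightarrow> complex"
    and \<rho> :: real and g :: "complex \<Rightarrow> complex" and A :: "complex \<Rightarrow> complex ^ 3"
  assumes lam7: "lam 7 = 1" and sigma: "kleinian_sigma lam \<sigma>" and rho: "\<rho> > 0"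
    and g_hol: "g holomorphic_on ball 0 \<rho>" and g_even: "\<And>s. g (- s) = g s"
    and g_nz: "\<And>s. s \<in> ball 0 \<rho> \<Longrightarrow> g s \<noteq> 0"
    and g_curve: "\<And>s. s \<noteq> 0 \<Longrightarrow> (g s / s ^ 7)\<^sup>2 = curve_poly lam (1 / s\<^sup>2)"
    and A_odd: "\<And>s. A (- s) = - A s"
    and A_deriv: "\<And>s. s \<in> ball 0 \<rho> \<Longrightarrow> (A has_derivative (\<lambda>h. h *s omega g s)) (at s)"
begin

definition xc :: "complex \<Rightarrow> complex" where "xc s = 1 / s\<^sup>2"
definition yc :: "complex \<Rightarrow> complex" where "yc s = g s / s ^ 7"
definition U :: "(3 \<Rightarrow> complex) \<Rightarrow> complex ^ 3" where "U s = (\<Sum>k\<in>UNIV. A (s k))"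
text \<open>Since \<open>x = s^-2\<close>, distinct squares mean distinct
  \<open>x\<close>-coordinates.\<close>

definition generic :: "(3 \<Rightarrow> complex) \<Rightarrow> bool" where
  "generic s \<longleftrightarrow> (\<forall>k. s k \<in> ball 0 \<rho> \<and> s k \<noteq> 0) \<and> inj (\<lambda>k. (s k)\<^sup>2) \<and> \<sigma> (U s) \<noteq> 0"

abbreviation W :: "complex ^ 3 \<Rightarrow> complex \<Rightarrow> complex \<Rightarrow> complex" where
  "W v \<equiv> sym_form (wp2 \<sigma> 1 1 v) (wp2 \<sigma> 1 2 v) (wp2 \<sigma> 1 3 v) (wp2 \<sigma> 2 2 v) (wp2 \<sigma> 2 3 v) (wp2 \<sigma> 3 3 v)"

section \<open>Condition (v) near infinity and its limits\<close>

lemma holo: "holomorphic3_on \<sigma> UNIV"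
  using sigma by (auto simp: kleinian_sigma_def intro: entire3_imp_holomorphic3_on)

lemma A_zero: "A 0 = 0"
proof -
  have "A 0 + A 0 = 0" using A_odd[of 0] by (metis add.right_inverse minus_zero)
  then have "2 *\<^sub>R A 0 = 0" by (simp only: scaleR_2)
  then show ?thesis by simp
qed

lemma A_abel:
  assumes "s \<in> ball 0 \<rho>" "s \<noteq> 0"
  shows "A s \<in> abel_values lam (Some (xc s, yc s))"
  unfolding xc_def yc_def
proof (rule infinity_point_abel_value[OF g_hol g_nz _ A_deriv A_zero assms])
  fix s show "infinity_point g s \<in> curve lam"
    using g_curve[of s] by (simp add: infinity_point_def curve_def)
qed

lemma isCont_A: "s \<in> ball 0 \<rho> \<Longrightarrow> isCont A s"
  using A_deriv by (rule has_derivative_continuous)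

lemma xc_inj: "xc s = xc t \<longleftrightarrow> s\<^sup>2 = t\<^sup>2"
  by (simp add: xc_def)

lemma genericD:
  assumes "generic s"
  shows "s k \<in> ball 0 \<rho>" "s k \<noteq> 0" "k \<noteq> l \<Longrightarrow> (s k)\<^sup>2 \<noteq> (s l)\<^sup>2" "\<sigma> (U s) \<noteq> 0"
  using assms injD[of "\<lambda>k. (s k)\<^sup>2" k l] by (auto simp: generic_def)

text \<open>Condition (v) is applied to the conjugate points \<open>(x_k, - y_k)\<close>, with
  parameters \<open>- t k\<close>. By oddness of \<open>A\<close> the difference in its argument
  becomes the sum \<open>A e + U t\<close>, and the sign of the term with \<open>y y_k\<close>
  changes.\<close>

lemma klein_formula:
  assumes t: "\<And>k. t k \<in> ball 0 \<rho>" "\<And>k. t k \<noteq> 0" "inj (\<lambda>k. (t k)\<^sup>2)"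
    and e: "e \<in> ball 0 \<rho>" "e \<noteq> 0" "\<And>k. e\<^sup>2 \<noteq> (t k)\<^sup>2" and nz: "\<sigma> (A e + U t) \<noteq> 0"
  shows "W (A e + U t) (xc e) (xc (t k)) =
    (klein_polar lam (xc e) (xc (t k)) - 2 * yc e * yc (t k)) / (xc e - xc (t k))\<^sup>2"
proof -
  have v: "A e - (\<Sum>k\<in>UNIV. A (- t k)) = A e + U t"
    by (simp add: A_odd U_def sum_negf)
  have x_even: "xc (- s) = xc s" and y_odd: "yc (- s) = - yc s" for s
    by (simp_all add: xc_def yc_def g_even)
  have mem: "Some (xc s, - yc s) \<in> curve lam" "Some (xc s, yc s) \<in> curve lam" if "s \<noteq> 0" for s
    using g_curve[OF that] by (auto simp: curve_def xc_def yc_def)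
  have ab: "A (- t k) \<in> abel_values lam (Some (xc (t k), - yc (t k)))" for k
    using A_abel[of "- t k"] t by (simp add: x_even y_odd)
  have inj: "inj (\<lambda>k. xc (t k))"
    using t(3) by (simp add: inj_def xc_inj)
  have notin: "xc e \<notin> range (\<lambda>k. xc (t k))"
    using e(3) by (auto simp: xc_inj)
  have "\<forall>(xs :: 3 \<Rightarrow> complex) ys bs x y a.
        (\<forall>k. Some (xs k, ys k) \<in> curve lam \<and> bs k \<in> abel_values lam (Some (xs k, ys k))) \<and>
        Some (x, y) \<in> curve lam \<and> a \<in> abel_values lam (Some (x, y)) \<and>
        inj xs \<and> x \<notin> range xs \<and> \<sigma> (a - (\<Sum>k\<in>UNIV. bs k)) \<noteq> 0 \<longrightarrow>
        (\<forall>k. (\<Sum>i=1..3. \<Sum>j=1..3. wp2 \<sigma> (of_nat i) (of_nat j) (a - (\<Sum>k\<in>UNIV. bs k))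
                * x ^ (i - 1) * xs k ^ (j - 1))
             = (klein_polar lam x (xs k) + 2 * y * ys k) / (x - xs k) ^ 2)"
    using sigma unfolding kleinian_sigma_def by blast
  from this[rule_format, of "\<lambda>k. xc (t k)" "\<lambda>k. - yc (t k)" "\<lambda>k. A (- t k)" "xc e" "yc e" "A e" k]
  have "(\<Sum>i=1..3. \<Sum>j=1..3. wp2 \<sigma> (of_nat i) (of_nat j) (A e + U t) * xc e ^ (i - 1) * xc (t k) ^ (j - 1))
      = (klein_polar lam (xc e) (xc (t k)) + 2 * yc e * - yc (t k)) / (xc e - xc (t k))\<^sup>2"
    using mem t(2) ab e A_abel[OF e(1,2)] inj notin nz unfolding v by blast
  then show ?thesis
    unfolding klein_sum_eq_sym_form[OF holo nz] by simp
qed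

lemma generic_near_zero:
  assumes "generic s"
  shows "eventually (\<lambda>e. e \<in> ball 0 \<rho> \<and> e \<noteq> 0 \<and> (\<forall>k. e\<^sup>2 \<noteq> (s k)\<^sup>2) \<and> \<sigma> (A e + U s) \<noteq> 0) (at 0)"
proof -
  have "((\<lambda>e::complex. e\<^sup>2) \<longlongrightarrow> 0\<^sup>2) (at 0)"
    by (intro tendsto_intros)
  then have "eventually (\<lambda>e. e\<^sup>2 \<noteq> (s k)\<^sup>2) (at 0)" for k
    by (rule tendsto_imp_eventually_ne) (use assms in \<open>simp add: generic_def\<close>)
  then have "eventually (\<lambda>e. \<forall>k. e\<^sup>2 \<noteq> (s k)\<^sup>2) (at 0)"
    by (simp add: eventually_all_finite)
  moreover have "isCont \<sigma> (A 0 + U s)"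
    using holomorphic3_on_imp_continuous_on[OF holo] by (simp add: continuous_on_eq_continuous_at)
  then have "((\<lambda>e. \<sigma> (A e + U s)) \<longlongrightarrow> \<sigma> (A 0 + U s)) (at 0)"
    by (rule isCont_tendsto_compose) (use isCont_A[of 0] rho in \<open>auto intro!: tendsto_intros simp: isCont_def\<close>)
  then have "eventually (\<lambda>e. \<sigma> (A e + U s) \<noteq> 0) (at 0)"
    by (rule tendsto_imp_eventually_ne) (use assms in \<open>simp add: generic_def A_zero\<close>)
  moreover have "eventually (\<lambda>e. e \<in> ball 0 \<rho>) (at (0::complex))"
    using rho by (intro eventually_at_in_open') auto
  moreover have "eventually (\<lambda>e. e \<noteq> 0) (at (0::complex))"
    by (simp add: eventually_at_filter)
  ultimately show ?thesis by eventually_elim auto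
qed

lemma wp2_near_zero:
  assumes "generic s"
  shows "((\<lambda>e. wp2 \<sigma> i j (A e + U s)) \<longlongrightarrow> wp2 \<sigma> i j (U s)) (at 0)"
proof -
  have "isCont (wp2 \<sigma> i j) (A 0 + U s)"
    using holomorphic3_on_imp_continuous_on[OF holomorphic3_on_wp2[OF holo]] open_nonzero[OF holo] assms
    by (simp add: continuous_on_eq_continuous_at generic_def A_zero)
  then have "((\<lambda>e. wp2 \<sigma> i j (A e + U s)) \<longlongrightarrow> wp2 \<sigma> i j (A 0 + U s)) (at 0)"
    by (rule isCont_tendsto_compose) (use isCont_A[of 0] rho in \<open>auto intro!: tendsto_intros simp: isCont_def\<close>)
  then show ?thesis by (simp add: A_zero)
qed

text \<open>In condition (v), the point \<open>P\<close> tends to infinity.\<close>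

lemma jacobi_inversion:
  assumes s: "generic s"
  shows "xc (s k) ^ 3 = wp2 \<sigma> 3 3 (U s) * (xc (s k))\<^sup>2 + wp2 \<sigma> 2 3 (U s) * xc (s k) + wp2 \<sigma> 1 3 (U s)"
proof -
  define z where "z = xc (s k)"
  \<comment> \<open>\<open>L\<close> and \<open>R\<close> are the two sides of condition (v),
    cleared of the denominator and multiplied by \<open>e^8\<close>, where \<open>x = e^-2\<close>:
    one factor \<open>e^4\<close> goes to the quadratic form and one to \<open>(x - z)^2\<close>.
    Both sides are continuous at \<open>e = 0\<close>, where the coefficients of \<open>x^2\<close>
    in the form and of \<open>x^4\<close> in the polar form survive.\<close>
  define L where "L = (\<lambda>e. (let v = A e + U s in wp2 \<sigma> 1 1 v * e ^ 4 + wp2 \<sigma> 1 2 v * (e ^ 2 + e ^ 4 * z)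
      + wp2 \<sigma> 1 3 v * (1 + e ^ 4 * z ^ 2) + wp2 \<sigma> 2 2 v * e ^ 2 * z
      + wp2 \<sigma> 2 3 v * (z + e ^ 2 * z ^ 2) + wp2 \<sigma> 3 3 v * z ^ 2) * (1 - e ^ 2 * z) ^ 2)"
  define R where "R = (\<lambda>e. 2 * lam 0 * e ^ 8 + lam 1 * (e ^ 6 + e ^ 8 * z)
     + z * (2 * lam 2 * e ^ 6 + lam 3 * (e ^ 4 + e ^ 6 * z))
     + z\<^sup>2 * (2 * lam 4 * e ^ 4 + lam 5 * (e ^ 2 + e ^ 4 * z))
     + z ^ 3 * (2 * lam 6 * e ^ 2 + (1 + e ^ 2 * z)) - 2 * (e * g e) * yc (s k))"
  have "eventually (\<lambda>e. L e = R e) (at 0)"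
    using generic_near_zero[OF s]
  proof eventually_elim
    case (elim e)
    have "W (A e + U s) (xc e) z = (klein_polar lam (xc e) z - 2 * yc e * yc (s k)) / (xc e - z)\<^sup>2"
      unfolding z_def using elim s by (intro klein_formula) (auto simp: generic_def)
    moreover have "xc e - z \<noteq> 0"
      using elim by (auto simp: z_def xc_inj)
    ultimately have "W (A e + U s) (xc e) z * (xc e - z)\<^sup>2 = klein_polar lam (xc e) z - 2 * yc e * yc (s k)"
      by (simp add: field_simps)
    then have "(e ^ 4 * W (A e + U s) (xc e) z) * (e ^ 2 * (xc e - z))\<^sup>2 =
        e ^ 8 * klein_polar lam (xc e) z - 2 * (e ^ 8 * yc e) * yc (s k)"
      by algebra
    moreover have eX: "e ^ 2 * xc e = 1" "e ^ 4 * xc e = e ^ 2" "e ^ 4 * (xc e)\<^sup>2 = 1"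
        "e ^ 8 * xc e = e ^ 6" "e ^ 8 * (xc e)\<^sup>2 = e ^ 4" "e ^ 8 * xc e ^ 3 = e ^ 2" "e ^ 8 * xc e ^ 4 = 1"
      using elim by (simp_all add: xc_def field_simps eval_nat_numeral)
    have "e ^ 2 * (xc e - z) = 1 - e ^ 2 * z"
      by (simp add: right_diff_distrib eX)
    moreover have "e ^ 4 * sym_form a b c d f h (xc e) z = a * e ^ 4 + b * (e ^ 2 + e ^ 4 * z)
      + c * (1 + e ^ 4 * z ^ 2) + d * e ^ 2 * z + f * (z + e ^ 2 * z ^ 2) + h * z ^ 2" for a b c d f h
      unfolding sym_form_def using eX(2,3) by algebra
    ultimately have "L e = e ^ 8 * klein_polar lam (xc e) z - 2 * (e ^ 8 * yc e) * yc (s k)"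
      by (simp add: L_def Let_def)
    moreover have "e ^ 8 * yc e = e * g e"
      using elim by (simp add: yc_def field_simps eval_nat_numeral)
    moreover have "e ^ 8 * klein_polar lam (xc e) z - 2 * (e * g e) * yc (s k) = R e"
      unfolding klein_polar_expand lam7 R_def using eX(4-7) by algebra
    ultimately show ?case by simp
  qed
  moreover have "(L \<longlongrightarrow> (let v = U s in wp2 \<sigma> 1 1 v * 0 ^ 4 + wp2 \<sigma> 1 2 v * (0 ^ 2 + 0 ^ 4 * z)
      + wp2 \<sigma> 1 3 v * (1 + 0 ^ 4 * z ^ 2) + wp2 \<sigma> 2 2 v * 0 ^ 2 * z
      + wp2 \<sigma> 2 3 v * (z + 0 ^ 2 * z ^ 2) + wp2 \<sigma> 3 3 v * z ^ 2) * (1 - 0 ^ 2 * z) ^ 2) (at 0)"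
    unfolding L_def Let_def by (intro tendsto_intros wp2_near_zero[OF s])
  then have "(L \<longlongrightarrow> wp2 \<sigma> 1 3 (U s) + wp2 \<sigma> 2 3 (U s) * z + wp2 \<sigma> 3 3 (U s) * z ^ 2) (at 0)"
    by (simp add: Let_def)
  ultimately have "(R \<longlongrightarrow> wp2 \<sigma> 1 3 (U s) + wp2 \<sigma> 2 3 (U s) * z + wp2 \<sigma> 3 3 (U s) * z ^ 2) (at 0)"
    by (rule Lim_transform_eventually[rotated])
  moreover have "isCont g 0"
    using holomorphic_on_imp_continuous_on[OF g_hol] rho by (simp add: continuous_on_eq_continuous_at)
  then have "(R \<longlongrightarrow> 2 * lam 0 * 0 ^ 8 + lam 1 * (0 ^ 6 + 0 ^ 8 * z)
     + z * (2 * lam 2 * 0 ^ 6 + lam 3 * (0 ^ 4 + 0 ^ 6 * z))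
     + z\<^sup>2 * (2 * lam 4 * 0 ^ 4 + lam 5 * (0 ^ 2 + 0 ^ 4 * z))
     + z ^ 3 * (2 * lam 6 * 0 ^ 2 + (1 + 0 ^ 2 * z)) - 2 * (0 * g 0) * yc (s k)) (at 0)"
    unfolding R_def isCont_def by (intro tendsto_intros)
  then have "(R \<longlongrightarrow> z ^ 3) (at 0)" by simp
  ultimately have "z ^ 3 = wp2 \<sigma> 1 3 (U s) + wp2 \<sigma> 2 3 (U s) * z + wp2 \<sigma> 3 3 (U s) * z ^ 2"
    by (intro tendsto_unique[of "at 0" R]) auto
  then show ?thesis by (simp add: z_def)
qed

lemma U_upd: "U (s(k := t)) = (\<Sum>j\<in>UNIV - {k}. A (s j)) + A t"
  by (simp add: U_def sum.remove[of UNIV k] add.commute)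

lemma U_split: "U s = (\<Sum>j\<in>UNIV - {k}. A (s j)) + A (s k)"
  using U_upd[of s k "s k"] by simp

lemma inj_upd_square:
  assumes "inj (\<lambda>k. (s k)\<^sup>2)" "\<And>j. j \<noteq> k \<Longrightarrow> t\<^sup>2 \<noteq> (s j)\<^sup>2"
  shows "inj (\<lambda>j. ((s(k := t)) j)\<^sup>2)"
proof (rule injI)
  fix i j assume eq: "((s(k := t)) i)\<^sup>2 = ((s(k := t)) j)\<^sup>2"
  show "i = j"
    using eq assms(2)[of i] assms(2)[of j] injD[OF assms(1), of i j]
    by (cases "i = k"; cases "j = k") auto
qed

text \<open>In condition (v), one of the three points tends to infinity.\<close>

lemma klein_pair:
  assumes s: "generic s" and kl: "k \<noteq> l"
  shows "W (U s) (xc (s k)) (xc (s l)) * (xc (s k) - xc (s l))\<^sup>2 =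
    klein_polar lam (xc (s k)) (xc (s l)) - 2 * yc (s k) * yc (s l)"
proof -
  define c where "c = (klein_polar lam (xc (s k)) (xc (s l)) - 2 * yc (s k) * yc (s l)) / (xc (s k) - xc (s l))\<^sup>2"
  have "eventually (\<lambda>e. W (A e + U s) (xc (s k)) (xc (s l)) = c) (at 0)"
    using generic_near_zero[OF s]
  proof eventually_elim
    case (elim e)
    \<comment> \<open>The roles are exchanged: point \<open>k\<close> becomes the free point
      \<open>P\<close> of condition (v), and its place among the three is taken by the point with
      parameter \<open>e\<close>. The argument is still \<open>A e + U s\<close>, and the right-hand
      side for point \<open>l\<close> does not depend on \<open>e\<close>.\<close>
    have eq: "A (s k) + U (s(k := e)) = A e + U s"
      by (simp add: U_upd U_split[of s k])
    have "W (A (s k) + U (s(k := e))) (xc (s k)) (xc ((s(k := e)) l)) =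
      (klein_polar lam (xc (s k)) (xc ((s(k := e)) l)) - 2 * yc (s k) * yc ((s(k := e)) l))
        / (xc (s k) - xc ((s(k := e)) l))\<^sup>2"
    proof (rule klein_formula)
      show "inj (\<lambda>j. ((s(k := e)) j)\<^sup>2)"
      proof (rule inj_upd_square)
        show "inj (\<lambda>k. (s k)\<^sup>2)" using s by (simp add: generic_def)
        show "e\<^sup>2 \<noteq> (s j)\<^sup>2" for j using elim by blast
      qed
      show "(s k)\<^sup>2 \<noteq> ((s(k := e)) j)\<^sup>2" for j
      proof (cases "j = k")
        case True
        have "e\<^sup>2 \<noteq> (s k)\<^sup>2" using elim by blast
        then show ?thesis using True by auto
      next
        case False
        then show ?thesis using genericD(3)[OF s, of k j] by simp
      qed
      show "(s(k := e)) j \<in> ball 0 \<rho>" "(s(k := e)) j \<noteq> 0" for j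
        using s elim by (simp_all add: generic_def)
      show "s k \<in> ball 0 \<rho>" "s k \<noteq> 0"
        using s by (simp_all add: generic_def)
      show "\<sigma> (A (s k) + U (s(k := e))) \<noteq> 0"
        unfolding eq using elim by blast
    qed
    then show ?case using kl by (simp add: eq c_def)
  qed
  moreover have "((\<lambda>e. W (A e + U s) (xc (s k)) (xc (s l))) \<longlongrightarrow> W (U s) (xc (s k)) (xc (s l))) (at 0)"
    unfolding sym_form_def by (intro tendsto_intros wp2_near_zero[OF s])
  ultimately have "((\<lambda>e. c) \<longlongrightarrow> W (U s) (xc (s k)) (xc (s l))) (at (0::complex))"
    by (rule Lim_transform_eventually[rotated])
  then have "W (U s) (xc (s k)) (xc (s l)) = c"
    by (simp add: tendsto_const_iff)
  moreover have "(xc (s k) - xc (s l)) \<noteq> 0"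
    using genericD(3)[OF s kl] by (simp add: xc_inj)
  ultimately show ?thesis by (simp add: c_def)
qed

section \<open>Derivatives along one of the three points\<close>

lemma generic_upd:
  assumes s: "generic s"
  shows "eventually (\<lambda>t. generic (s(k := t))) (nhds (s k))"
proof -
  have id: "((\<lambda>t. t) \<longlongrightarrow> s k) (nhds (s k))" by (rule filterlim_ident)
  have "eventually (\<lambda>t. j \<noteq> k \<longrightarrow> t\<^sup>2 \<noteq> (s j)\<^sup>2) (nhds (s k))" for j
  proof (cases "j = k")
    case False
    then have "(s k)\<^sup>2 \<noteq> (s j)\<^sup>2"
      using genericD(3)[OF s, of k j] by simp
    from tendsto_imp_eventually_ne[OF tendsto_power[OF id] this] show ?thesis by simp
  qed simp
  then have sq: "eventually (\<lambda>t. \<forall>j. j \<noteq> k \<longrightarrow> t\<^sup>2 \<noteq> (s j)\<^sup>2) (nhds (s k))"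
    by (rule eventually_all_finite)
  have "isCont \<sigma> (U s)"
    using holomorphic3_on_imp_continuous_on[OF holo] by (simp add: continuous_on_eq_continuous_at)
  moreover have "((\<lambda>t. U (s(k := t))) \<longlongrightarrow> U s) (nhds (s k))"
    unfolding U_upd U_split[of s k]
    by (intro tendsto_add tendsto_const isCont_tendsto_compose[OF isCont_A[OF genericD(1)[OF s]] id])
  ultimately have "((\<lambda>t. \<sigma> (U (s(k := t)))) \<longlongrightarrow> \<sigma> (U s)) (nhds (s k))"
    by (rule isCont_tendsto_compose)
  then have "eventually (\<lambda>t. \<sigma> (U (s(k := t))) \<noteq> 0) (nhds (s k))"
    by (rule tendsto_imp_eventually_ne) (use s in \<open>simp add: generic_def\<close>)
  moreover have "eventually (\<lambda>t. t \<in> ball 0 \<rho> - {0}) (nhds (s k))"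
    using s by (intro eventually_nhds_in_open open_delete) (auto simp: generic_def)
  ultimately show ?thesis
    using sq
  proof eventually_elim
    case (elim t)
    have "inj (\<lambda>j. ((s(k := t)) j)\<^sup>2)"
    proof (rule inj_upd_square)
      show "inj (\<lambda>k. (s k)\<^sup>2)" using s by (simp add: generic_def)
      show "t\<^sup>2 \<noteq> (s j)\<^sup>2" if "j \<noteq> k" for j using elim that by blast
    qed
    moreover have "(s(k := t)) j \<in> ball 0 \<rho> \<and> (s(k := t)) j \<noteq> 0" for j
      using elim genericD(1,2)[OF s, of j] by simp
    ultimately show ?case
      using elim by (simp add: generic_def)
  qed
qed

text \<open>This is \<open>dx / (2 y ds)\<close>; the other two components of
  \<open>omega g s\<close> are \<open>x\<close> and \<open>x^2\<close> times it.\<close>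

definition omega1 :: "complex \<Rightarrow> complex" where "omega1 s = - (s ^ 4) / g s"

lemma wp2_deriv:
  assumes s: "generic s"
  shows "((\<lambda>t. wp2 \<sigma> i j (U (s(k := t)))) has_field_derivative
     omega1 (s k) * (wp3 \<sigma> 1 i j (U s) + xc (s k) * wp3 \<sigma> 2 i j (U s) + (xc (s k))\<^sup>2 * wp3 \<sigma> 3 i j (U s)))
     (at (s k))"
proof -
  have sk: "s k \<in> ball 0 \<rho>" "s k \<noteq> 0" "\<sigma> (U s) \<noteq> 0"
    using s by (auto simp: generic_def)
  have "has_partials (wp2 \<sigma> i j) (\<lambda>m. pd m (wp2 \<sigma> i j) (U s)) (U s)"
    by (rule holomorphic3_on_has_partials[OF holomorphic3_on_wp2[OF holo]]) (use sk in simp)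
  then have "has_partials (wp2 \<sigma> i j) (\<lambda>m. wp3 \<sigma> m i j (U s)) ((\<Sum>j\<in>UNIV - {k}. A (s j)) + A (s k))"
    using sk by (simp add: pd_wp2[OF holo] U_split[of s k, symmetric])
  from has_partials_chain[OF this A_deriv[OF sk(1)] refl]
  have "((\<lambda>t. wp2 \<sigma> i j (U (s(k := t)))) has_field_derivative
     (\<Sum>m\<in>UNIV. omega g (s k) $ m * wp3 \<sigma> m i j (U s))) (at (s k))"
    by (simp only: U_upd)
  moreover have "omega g (s k) $ 1 = omega1 (s k)" "omega g (s k) $ 2 = omega1 (s k) * xc (s k)"
    "omega g (s k) $ 3 = omega1 (s k) * (xc (s k))\<^sup>2"
    using sk g_nz[OF sk(1)] by (simp_all add: omega_def omega1_def xc_def field_simps eval_nat_numeral)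
  ultimately show ?thesis by (simp add: sum_3 algebra_simps)
qed

lemma xc_deriv:
  assumes "s \<in> ball 0 \<rho>" "s \<noteq> 0"
  shows "(xc has_field_derivative 2 * yc s * omega1 s) (at s)"
proof -
  have "(xc has_field_derivative - 2 / s ^ 3) (at s)"
    unfolding xc_def[abs_def] using assms(2)
    by (auto intro!: derivative_eq_intros simp: field_simps eval_nat_numeral)
  moreover have "- 2 / s ^ 3 = 2 * yc s * omega1 s"
    using assms g_nz[OF assms(1)] by (simp add: yc_def omega1_def field_simps eval_nat_numeral)
  ultimately show ?thesis by simp
qed

text \<open>The equation \<open>y^2 = f(x)\<close> is differentiated along the parameter and
  \<open>2 y\<close> is cancelled, which is nonzero because \<open>g\<close> has no zeros in the
  disc.\<close>

lemma yc_deriv: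
  assumes s: "s \<in> ball 0 \<rho>" "s \<noteq> 0"
  shows "(yc has_field_derivative curve_poly_deriv lam (xc s) * omega1 s) (at s)"
proof -
  have "yc holomorphic_on ball 0 \<rho> - {0}"
    unfolding yc_def[abs_def] by (intro holomorphic_intros holomorphic_on_subset[OF g_hol]) auto
  then have y: "(yc has_field_derivative deriv yc s) (at s)"
    using s by (intro holomorphic_derivI[of yc "ball 0 \<rho> - {0}"]) (auto intro: open_delete)
  have "((\<lambda>t. (yc t)\<^sup>2 - curve_poly lam (xc t)) has_field_derivative
      2 * yc s * deriv yc s - curve_poly_deriv lam (xc s) * (2 * yc s * omega1 s)) (at s)"
    using DERIV_diff[OF DERIV_power[OF y, of 2] DERIV_chain2[OF has_field_derivative_curve_poly xc_deriv[OF s]]]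
    by (simp add: mult_ac)
  moreover have "eventually (\<lambda>t. t \<in> - {0}) (nhds s)"
    using s by (intro eventually_nhds_in_open) auto
  then have "eventually (\<lambda>t. (yc t)\<^sup>2 - curve_poly lam (xc t) = 0) (nhds s)"
    by eventually_elim (use g_curve in \<open>simp add: xc_def yc_def\<close>)
  ultimately have "2 * yc s * deriv yc s - curve_poly_deriv lam (xc s) * (2 * yc s * omega1 s) = 0"
    by (rule DERIV_eventually_zero)
  then have "2 * yc s * (deriv yc s - curve_poly_deriv lam (xc s) * omega1 s) = 0"
    by (simp add: algebra_simps)
  moreover have "yc s \<noteq> 0" using s g_nz by (simp add: yc_def)
  ultimately show ?thesis using y by simp
qed

lemma wp3_sorted:
  assumes "\<sigma> v \<noteq> 0"
  shows "wp3 \<sigma> 2 1 1 v = wp3 \<sigma> 1 1 2 v" "wp3 \<sigma> 3 1 1 v = wp3 \<sigma> 1 1 3 v"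
    "wp3 \<sigma> 2 1 2 v = wp3 \<sigma> 1 2 2 v" "wp3 \<sigma> 3 1 2 v = wp3 \<sigma> 1 2 3 v"
    "wp3 \<sigma> 2 1 3 v = wp3 \<sigma> 1 2 3 v" "wp3 \<sigma> 3 1 3 v = wp3 \<sigma> 1 3 3 v"
    "wp3 \<sigma> 3 2 2 v = wp3 \<sigma> 2 2 3 v" "wp3 \<sigma> 3 2 3 v = wp3 \<sigma> 2 3 3 v"
  by (metis wp3_commute12[OF holo assms] wp3_commute23[OF holo assms])+

text \<open>Inversion at point \<open>l\<close> is differentiated along the parameter of point
  \<open>k\<close>. For \<open>l\<close> different from \<open>k\<close> only the coefficients vary;
  for \<open>l = k\<close> the variation \<open>2 y omega1\<close> of \<open>x_k\<close> enters as
  well. The common factor \<open>omega1\<close> cancels.\<close>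

lemma jacobi_inversion_deriv:
  fixes s k
  assumes s: "generic s"
  defines "T3 \<equiv> sym_form (wp3 \<sigma> 1 1 3 (U s)) (wp3 \<sigma> 1 2 3 (U s)) (wp3 \<sigma> 1 3 3 (U s))
      (wp3 \<sigma> 2 2 3 (U s)) (wp3 \<sigma> 2 3 3 (U s)) (wp3 \<sigma> 3 3 3 (U s))"
  shows "k \<noteq> l \<Longrightarrow> T3 (xc (s k)) (xc (s l)) = 0"
    and "T3 (xc (s k)) (xc (s k)) =
      2 * yc (s k) * (3 * (xc (s k))\<^sup>2 - 2 * wp2 \<sigma> 3 3 (U s) * xc (s k) - wp2 \<sigma> 2 3 (U s))"
proof -
  have sk: "s k \<in> ball 0 \<rho>" "s k \<noteq> 0" "\<sigma> (U s) \<noteq> 0"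
    using s by (auto simp: generic_def)
  have omega1: "omega1 (s k) \<noteq> 0" using sk g_nz by (simp add: omega1_def)
  define X where "X = (\<lambda>l t. xc ((s(k := t)) l))"
  have Xs: "X l (s k) = xc (s l)" for l by (simp add: X_def)
  have zero: "3 * (xc (s l))\<^sup>2 * d - (omega1 (s k) * T3 (xc (s k)) (xc (s l))
      + (2 * wp2 \<sigma> 3 3 (U s) * xc (s l) + wp2 \<sigma> 2 3 (U s)) * d) = 0"
    if X': "(X l has_field_derivative d) (at (s k))" for l d
  proof -
    have "((\<lambda>t. X l t ^ 3 - (wp2 \<sigma> 3 3 (U (s(k := t))) * (X l t)\<^sup>2 + wp2 \<sigma> 2 3 (U (s(k := t))) * X l t
        + wp2 \<sigma> 1 3 (U (s(k := t))))) has_field_derivative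
        3 * (xc (s l))\<^sup>2 * d - (omega1 (s k) * T3 (xc (s k)) (xc (s l))
      + (2 * wp2 \<sigma> 3 3 (U s) * xc (s l) + wp2 \<sigma> 2 3 (U s)) * d)) (at (s k))"
      by (rule derivative_eq_intros X' wp2_deriv[OF s] refl)+
         (simp add: Xs T3_def sym_form_def wp3_sorted[OF sk(3)] algebra_simps eval_nat_numeral)
    moreover have "eventually (\<lambda>t. X l t ^ 3 - (wp2 \<sigma> 3 3 (U (s(k := t))) * (X l t)\<^sup>2
        + wp2 \<sigma> 2 3 (U (s(k := t))) * X l t + wp2 \<sigma> 1 3 (U (s(k := t)))) = 0) (nhds (s k))"
      using generic_upd[OF s] by eventually_elim (simp only: X_def jacobi_inversion diff_self)
    ultimately show ?thesis by (rule DERIV_eventually_zero)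
  qed
  show "T3 (xc (s k)) (xc (s l)) = 0" if "k \<noteq> l"
  proof -
    have "(X l has_field_derivative 0) (at (s k))"
      using that by (simp add: X_def)
    from zero[OF this] omega1 show ?thesis by simp
  qed
  have "X k = xc" by (simp add: X_def)
  with xc_deriv[OF sk(1,2)] have "(X k has_field_derivative 2 * yc (s k) * omega1 (s k)) (at (s k))"
    by simp
  from zero[OF this]
  have "omega1 (s k) * T3 (xc (s k)) (xc (s k)) = omega1 (s k) *
      (2 * yc (s k) * (3 * (xc (s k))\<^sup>2 - 2 * wp2 \<sigma> 3 3 (U s) * xc (s k) - wp2 \<sigma> 2 3 (U s)))"
    by (simp add: algebra_simps)
  with omega1 show "T3 (xc (s k)) (xc (s k)) =
      2 * yc (s k) * (3 * (xc (s k))\<^sup>2 - 2 * wp2 \<sigma> 3 3 (U s) * xc (s k) - wp2 \<sigma> 2 3 (U s))"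
    by simp
qed

text \<open>The pair formula is differentiated along the parameter of point \<open>k\<close>, with
  point \<open>l\<close> fixed, and divided by the common factor \<open>omega1\<close>. The
  derivative of \<open>y_k\<close> contributes the term with
  \<open>curve_poly_deriv\<close>.\<close>

lemma klein_pair_deriv:
  fixes s k
  assumes s: "generic s" and kl: "k \<noteq> l"
  defines "T3 \<equiv> sym_form (wp3 \<sigma> 1 1 3 (U s)) (wp3 \<sigma> 1 2 3 (U s)) (wp3 \<sigma> 1 3 3 (U s))
      (wp3 \<sigma> 2 2 3 (U s)) (wp3 \<sigma> 2 3 3 (U s)) (wp3 \<sigma> 3 3 3 (U s))"
    and "T2 \<equiv> sym_form (wp3 \<sigma> 1 1 2 (U s)) (wp3 \<sigma> 1 2 2 (U s)) (wp3 \<sigma> 1 2 3 (U s))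
      (wp3 \<sigma> 2 2 2 (U s)) (wp3 \<sigma> 2 2 3 (U s)) (wp3 \<sigma> 2 3 3 (U s))"
    and "T1 \<equiv> sym_form (wp3 \<sigma> 1 1 1 (U s)) (wp3 \<sigma> 1 1 2 (U s)) (wp3 \<sigma> 1 1 3 (U s))
      (wp3 \<sigma> 1 2 2 (U s)) (wp3 \<sigma> 1 2 3 (U s)) (wp3 \<sigma> 1 3 3 (U s))"
    and "x \<equiv> xc (s k)" and "z \<equiv> xc (s l)"
  shows "(T1 x z + T2 x z * x + T3 x z * x\<^sup>2) * (x - z)\<^sup>2 =
        2 * yc (s k) * (klein_polar_deriv lam x z
          - sym_form_deriv (wp2 \<sigma> 1 1 (U s)) (wp2 \<sigma> 1 2 (U s)) (wp2 \<sigma> 1 3 (U s)) (wp2 \<sigma> 2 2 (U s))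
              (wp2 \<sigma> 2 3 (U s)) (wp2 \<sigma> 3 3 (U s)) x z * (x - z)\<^sup>2
          - 2 * W (U s) x z * (x - z))
        - 2 * curve_poly_deriv lam x * yc (s l)"
proof -
  have sk: "s k \<in> ball 0 \<rho>" "s k \<noteq> 0" "\<sigma> (U s) \<noteq> 0"
    using s by (auto simp: generic_def)
  have omega1: "omega1 (s k) \<noteq> 0" using sk g_nz by (simp add: omega1_def)
  define D where "D = (\<lambda>i j. omega1 (s k) * (wp3 \<sigma> 1 i j (U s) + x * wp3 \<sigma> 2 i j (U s) + x\<^sup>2 * wp3 \<sigma> 3 i j (U s)))"
  define SD where "SD = sym_form_deriv (wp2 \<sigma> 1 1 (U s)) (wp2 \<sigma> 1 2 (U s)) (wp2 \<sigma> 1 3 (U s)) (wp2 \<sigma> 2 2 (U s))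
              (wp2 \<sigma> 2 3 (U s)) (wp2 \<sigma> 3 3 (U s)) x z"
  have D: "sym_form (D 1 1) (D 1 2) (D 1 3) (D 2 2) (D 2 3) (D 3 3) x z =
      omega1 (s k) * (T1 x z + T2 x z * x + T3 x z * x\<^sup>2)"
    unfolding D_def wp3_sorted[OF sk(3)] T1_def T2_def T3_def sym_form_def by (simp add: algebra_simps)
  have D': "((\<lambda>t. wp2 \<sigma> i j (U (s(k := t)))) has_field_derivative D i j) (at (s k))" for i j
    unfolding D_def x_def by (rule wp2_deriv[OF s])
  have Wd: "((\<lambda>t. W (U (s(k := t))) (xc t) z) has_field_derivative
     omega1 (s k) * (T1 x z + T2 x z * x + T3 x z * x\<^sup>2) + SD * (2 * yc (s k) * omega1 (s k))) (at (s k))"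
    using has_field_derivative_sym_form[OF D' D' D' D' D' D' xc_deriv[OF sk(1,2)],
        of 1 1 1 2 1 3 2 2 2 3 3 3 z]
    unfolding x_def[symmetric] D by (simp add: SD_def)
  have kd: "((\<lambda>t. klein_polar lam (xc t) z) has_field_derivative
      klein_polar_deriv lam x z * (2 * yc (s k) * omega1 (s k))) (at (s k))"
    unfolding x_def by (rule DERIV_chain2[OF has_field_derivative_klein_polar xc_deriv[OF sk(1,2)]])
  have "((\<lambda>t. W (U (s(k := t))) (xc t) z * (xc t - z)\<^sup>2
       - (klein_polar lam (xc t) z - 2 * yc t * yc (s l))) has_field_derivative
     omega1 (s k) * ((T1 x z + T2 x z * x + T3 x z * x\<^sup>2) * (x - z)\<^sup>2 + 2 * yc (s k) * SD * (x - z)\<^sup>2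
       + 2 * yc (s k) * (2 * W (U s) x z * (x - z)) - 2 * yc (s k) * klein_polar_deriv lam x z
       + 2 * curve_poly_deriv lam x * yc (s l))) (at (s k))"
    by (rule derivative_eq_intros Wd kd xc_deriv[OF sk(1,2)] yc_deriv[OF sk(1,2)] refl)+
       (simp add: x_def[symmetric] algebra_simps)
  moreover have "eventually (\<lambda>t. W (U (s(k := t))) (xc t) z * (xc t - z)\<^sup>2
       - (klein_polar lam (xc t) z - 2 * yc t * yc (s l)) = 0) (nhds (s k))"
    using generic_upd[OF s, of k]
  proof eventually_elim
    case (elim t)
    from klein_pair[OF elim kl] kl show ?case by (simp add: z_def)
  qed
  ultimately have "omega1 (s k) * ((T1 x z + T2 x z * x + T3 x z * x\<^sup>2) * (x - z)\<^sup>2 + 2 * yc (s k) * SD * (x - z)\<^sup>2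
       + 2 * yc (s k) * (2 * W (U s) x z * (x - z)) - 2 * yc (s k) * klein_polar_deriv lam x z
       + 2 * curve_poly_deriv lam x * yc (s l)) = 0"
    by (rule DERIV_eventually_zero)
  then have "(T1 x z + T2 x z * x + T3 x z * x\<^sup>2) * (x - z)\<^sup>2 + 2 * yc (s k) * SD * (x - z)\<^sup>2
       + 2 * yc (s k) * (2 * W (U s) x z * (x - z)) - 2 * yc (s k) * klein_polar_deriv lam x z
       + 2 * curve_poly_deriv lam x * yc (s l) = 0"
    using omega1 by simp
  then show ?thesis unfolding SD_def by algebra
qed

lemma minor_relations_generic:
  assumes s: "generic s"
  shows "minor_relations lam \<sigma> (U s)"
  unfolding minor_relations_def p_coeffs_def q_coeffs_def r_coeffs_def Let_def
proof (rule interpolation_relations[where x = "\<lambda>k. xc (s k)" and y = "\<lambda>k. yc (s k)"])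
  show "inj (\<lambda>k. xc (s k))"
    using s by (simp add: generic_def inj_def xc_inj)
  show "(yc (s k))\<^sup>2 = curve_poly lam (xc (s k))" for k
    using g_curve[of "s k"] s by (simp add: xc_def yc_def generic_def)
qed (fact lam7 jacobi_inversion[OF s] klein_pair[OF s] jacobi_inversion_deriv[OF s] klein_pair_deriv[OF s])+

section \<open>From points near infinity to all arguments\<close>

lemma sigma_nonzero_in_open:
  assumes "open V" "v0 \<in> V"
  obtains v where "v \<in> V" "\<sigma> v \<noteq> 0"
proof -
  have "\<exists>v\<in>V. \<sigma> v \<noteq> 0"
  proof (rule ccontr)
    assume "\<not> (\<exists>v\<in>V. \<sigma> v \<noteq> 0)"
    then have zero: "\<sigma> v = 0" if "v \<in> V" for v using that by blast
    obtain u where "\<sigma> u \<noteq> 0" using not_all_zero_kleinian_sigma[OF sigma] by blast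
    moreover have "\<sigma> u = 0"
    \<comment> \<open>With the constant 1 in the role of \<open>\<sigma>\<close> the excluded zero
      set is empty, and the identity theorem applies to \<open>\<sigma>\<close> itself.\<close>
    proof (rule holomorphic3_zero_on_open[where \<sigma> = "\<lambda>v. 1" and F = \<sigma> and V = V])
      show "holomorphic3_on \<sigma> {v. (1::complex) \<noteq> 0}" using holo by simp
    qed (use assms zero in simp_all)
    ultimately show False by contradiction
  qed
  then show thesis using that by blast
qed

lemma has_derivative_U:
  fixes s :: "complex ^ 3"
  assumes "\<And>k. s $ k \<in> ball 0 \<rho>"
  shows "((\<lambda>s. U (($) s)) has_derivative (*v) (\<chi> i k. omega g (s $ k) $ i)) (at s)"
proof -
  have "((\<lambda>s. A (s $ k)) has_derivative (\<lambda>h. h $ k *s omega g (s $ k))) (at s)" for k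
    using has_derivative_compose[OF bounded_linear_imp_has_derivative[OF bounded_linear_vec_nth] A_deriv[OF assms]]
    by simp
  then have "((\<lambda>s. U (($) s)) has_derivative (\<lambda>h. \<Sum>k\<in>UNIV. h $ k *s omega g (s $ k))) (at s)"
    unfolding U_def by (intro has_derivative_sum)
  moreover have "(\<lambda>h. \<Sum>k\<in>UNIV. h $ k *s omega g (s $ k)) = (*v) (\<chi> i k. omega g (s $ k) $ i)"
    by (simp add: fun_eq_iff vec_eq_iff matrix_vector_mult_def mult.commute)
  ultimately show ?thesis by simp
qed

text \<open>Column \<open>k\<close> is \<open>- 1 / g (s k)\<close> times the vector of the fourth
  power, the square and 1, so this is a Vandermonde determinant in the squares.\<close>

lemma det_omega:
  assumes "\<And>k. s k \<in> ball 0 \<rho>" "inj (\<lambda>k. (s k)\<^sup>2)"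
  shows "det (\<chi> i k. omega g (s k) $ i :: complex ^ 3 ^ 3) \<noteq> 0"
proof -
  have "det (\<chi> i k. omega g (s k) $ i :: complex ^ 3 ^ 3) =
      - (((s 1)\<^sup>2 - (s 2)\<^sup>2) * ((s 1)\<^sup>2 - (s 3)\<^sup>2) * ((s 2)\<^sup>2 - (s 3)\<^sup>2)) / (g (s 1) * g (s 2) * g (s 3))"
    using g_nz[OF assms(1)]
    by (simp add: det_3 omega_def field_simps eval_nat_numeral)
  moreover have "(s 1)\<^sup>2 \<noteq> (s 2)\<^sup>2" "(s 1)\<^sup>2 \<noteq> (s 3)\<^sup>2" "(s 2)\<^sup>2 \<noteq> (s 3)\<^sup>2"
    using assms(2) by (auto dest: injD)
  ultimately show ?thesis using g_nz[OF assms(1)] by simp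
qed

text \<open>At a triple of parameters with distinct squares the derivative of the Abel sum is
  invertible, so the image has interior points, and \<open>\<sigma>\<close> is nonzero at one of
  them.\<close>

lemma minor_relations_open:
  obtains V v0 where "open V" "v0 \<in> V" "\<sigma> v0 \<noteq> 0"
    "\<And>v. v \<in> V \<Longrightarrow> minor_relations lam \<sigma> v"
proof -
  define T where "T = {s :: complex ^ 3. (\<forall>k. s $ k \<in> ball 0 \<rho>) \<and> (\<forall>k. s $ k \<noteq> 0) \<and>
    (\<forall>k l. k \<noteq> l \<longrightarrow> (s $ k)\<^sup>2 \<noteq> (s $ l)\<^sup>2)}"
  have sq: "inj (\<lambda>k. (s $ k)\<^sup>2)" if "s \<in> T" for s
    using that unfolding T_def inj_def by blast
  have "open T"
  proof -
    have "open {s :: complex ^ 3. s $ k \<in> ball 0 \<rho>}" for k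
      using open_vimage_vec_nth[OF open_ball[of 0 \<rho>], of k] unfolding vimage_def .
    moreover have "open {s :: complex ^ 3. s $ k \<noteq> 0}" for k
      by (intro open_Collect_neq continuous_intros)
    moreover have "open {s :: complex ^ 3. (s $ k)\<^sup>2 \<noteq> (s $ l)\<^sup>2}" for k l
      by (intro open_Collect_neq continuous_intros)
    moreover have "T = (\<Inter>k. {s. s $ k \<in> ball 0 \<rho>}) \<inter> (\<Inter>k. {s. s $ k \<noteq> 0}) \<inter>
        (\<Inter>k. \<Inter>l\<in>- {k}. {s. (s $ k)\<^sup>2 \<noteq> (s $ l)\<^sup>2})"
      by (auto simp: T_def)
    ultimately show ?thesis
      by (auto intro!: open_Int open_INT)
  qed
  \<comment> \<open>A concrete triple in the disc: three different positive numbers, hence nonzero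
    with different squares.\<close>
  define s0 :: "complex ^ 3" where "s0 = vector [of_real (\<rho> / 2), of_real (\<rho> / 3), of_real (\<rho> / 4)]"
  have s0: "s0 \<in> T"
    using rho unfolding T_def s0_def
    by (simp add: forall_3 norm_divide power_divide)
  have cont: "continuous_on T (\<lambda>s. U (($) s))"
    by (intro continuous_at_imp_continuous_on ballI has_derivative_continuous[OF has_derivative_U])
       (auto simp: T_def)
  define M :: "complex ^ 3 ^ 3" where "M = (\<chi> i k. omega g (s0 $ k) $ i)"
  have "det M \<noteq> 0"
    unfolding M_def using s0 sq by (intro det_omega) (auto simp: T_def)
  then obtain M' where M': "M ** M' = mat 1"
    using invertible_det_nz[of M] by (auto simp: invertible_def)
  have "(\<lambda>s. U (($) s)) s0 \<in> interior ((\<lambda>s. U (($) s)) ` T)"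
  proof (rule sussmann_open_mapping[OF \<open>open T\<close> cont s0])
    show "((\<lambda>s. U (($) s)) has_derivative (*v) M) (at s0)"
      unfolding M_def by (rule has_derivative_U) (use s0 in \<open>simp add: T_def\<close>)
    show "bounded_linear ((*v) M')" by (rule matrix_vector_mul_bounded_linear)
    show "(*v) M \<circ> (*v) M' = id"
      by (simp add: fun_eq_iff matrix_vector_mul_assoc M')
  qed (use s0 \<open>open T\<close> in \<open>auto simp: interior_open\<close>)
  then obtain v0 where v0: "v0 \<in> interior ((\<lambda>s. U (($) s)) ` T)" "\<sigma> v0 \<noteq> 0"
    using sigma_nonzero_in_open[OF open_interior] by blast
  show thesis
  proof (rule that)
    let ?V = "interior ((\<lambda>s. U (($) s)) ` T) \<inter> {v. \<sigma> v \<noteq> 0}"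
    show "open ?V" by (intro open_Int open_interior open_nonzero[OF holo])
    show "v0 \<in> ?V" "\<sigma> v0 \<noteq> 0" using v0 by auto
    fix v assume v: "v \<in> ?V"
    then obtain s where s: "s \<in> T" "v = U (($) s)"
      using interior_subset by blast
    then have "generic (($) s)"
      using v sq[OF s(1)] by (auto simp: generic_def T_def)
    then show "minor_relations lam \<sigma> v"
      unfolding s(2) by (rule minor_relations_generic)
  qed
qed

lemma minor_relations_everywhere:
  assumes u: "\<sigma> u \<noteq> 0"
  shows "minor_relations lam \<sigma> u"
proof -
  obtain V v0 where V: "open V" "v0 \<in> V" "\<sigma> v0 \<noteq> 0" "\<And>v. v \<in> V \<Longrightarrow> minor_relations lam \<sigma> v"
    by (rule minor_relations_open) (rule that, assumption+)
  \<comment> \<open>Each conjunct of \<open>minor_relations\<close> equates two functions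
    holomorphic off the zeros of \<open>\<sigma>\<close>. Their difference vanishes on
    \<open>V\<close>, and the identity theorem carries this to \<open>u\<close>.\<close>
  have eqI: "F u = G u"
    if "holomorphic3_on F {v. \<sigma> v \<noteq> 0}" "holomorphic3_on G {v. \<sigma> v \<noteq> 0}"
      and "\<And>v. minor_relations lam \<sigma> v \<Longrightarrow> F v = G v" for F G
  proof -
    have "F u - G u = 0"
      by (rule holomorphic3_zero_on_open[OF holo holomorphic3_on_diff[OF that(1,2)] V(1,2,3) _ u])
         (simp add: that(3)[OF V(4)])
    then show ?thesis by simp
  qed
  note wp = holomorphic3_on_wp2[OF holo] holomorphic3_on_wp3[OF holo]
  have p: "holomorphic3_on (\<lambda>v. p_coeffs \<sigma> v i) {v. \<sigma> v \<noteq> 0}"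
    and q: "holomorphic3_on (\<lambda>v. q_coeffs \<sigma> v i) {v. \<sigma> v \<noteq> 0}"
    and r: "holomorphic3_on (\<lambda>v. r_coeffs lam \<sigma> v i) {v. \<sigma> v \<noteq> 0}" if "i \<in> {0, 1, 2, 3, 4}" for i
    using that unfolding p_coeffs_def q_coeffs_def r_coeffs_def Let_def
    by (elim insertE emptyE; simp; intro holomorphic3_intros wp)+
  have gram: "holomorphic3_on (\<lambda>v. gram (p_coeffs \<sigma> v) (q_coeffs \<sigma> v) (r_coeffs lam \<sigma> v) i j) {v. \<sigma> v \<noteq> 0}"
    if "i \<in> {0, 1, 2, 3, 4}" "j \<in> {0, 1, 2, 3, 4}" for i j
    unfolding gram_def divide_inverse
    by (intro holomorphic3_intros p q r that)
  have minor: "holomorphic3_on (\<lambda>v. minor (p_coeffs \<sigma> v) (q_coeffs \<sigma> v) (r_coeffs lam \<sigma> v) i j k) {v. \<sigma> v \<noteq> 0}"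
    if "i \<in> {0, 1, 2, 3, 4}" "j \<in> {0, 1, 2, 3, 4}" "k \<in> {0, 1, 2, 3, 4}" for i j k
    unfolding minor_def by (intro holomorphic3_intros p q r that)
  note hol = holomorphic3_intros wp gram minor
  show ?thesis
    unfolding minor_relations_def Let_def
    by (intro conjI; rule eqI; (intro hol)?; simp add: minor_relations_def Let_def)
qed

end

section \<open>The quadratic relations for products of 3-index functions\<close>

theorem theorem4p1:
  fixes lam :: "nat \<Rightarrow> complex" and \<sigma> :: "complex ^ 3 \<Rightarrow> complex" and u :: "complex ^ 3"
    and l0 l1 l2 l3 l4 l5 l6 :: complex
    and p11 p12 p13 p22 p23 p33 :: complex
    and p111 p112 p113 p122 p123 p133 p222 p223 p233 p333 D :: complex
  defines "l0 \<equiv> lam 0"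
    and "l1 \<equiv> lam 1"
    and "l2 \<equiv> lam 2"
    and "l3 \<equiv> lam 3"
    and "l4 \<equiv> lam 4"
    and "l5 \<equiv> lam 5"
    and "l6 \<equiv> lam 6"
    and "p11 \<equiv> wp2 \<sigma> 1 1 u"
    and "p12 \<equiv> wp2 \<sigma> 1 2 u"
    and "p13 \<equiv> wp2 \<sigma> 1 3 u"
    and "p22 \<equiv> wp2 \<sigma> 2 2 u"
    and "p23 \<equiv> wp2 \<sigma> 2 3 u"
    and "p33 \<equiv> wp2 \<sigma> 3 3 u"
    and "p111 \<equiv> wp3 \<sigma> 1 1 1 u"
    and "p112 \<equiv> wp3 \<sigma> 1 1 2 u"
    and "p113 \<equiv> wp3 \<sigma> 1 1 3 u"
    and "p122 \<equiv> wp3 \<sigma> 1 2 2 u"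
    and "p123 \<equiv> wp3 \<sigma> 1 2 3 u"
    and "p133 \<equiv> wp3 \<sigma> 1 3 3 u"
    and "p222 \<equiv> wp3 \<sigma> 2 2 2 u"
    and "p223 \<equiv> wp3 \<sigma> 2 2 3 u"
    and "p233 \<equiv> wp3 \<sigma> 2 3 3 u"
    and "p333 \<equiv> wp3 \<sigma> 3 3 3 u"
    and "D \<equiv> p11 * p33 - p12 * p23 - p13^2 + p13 * p22"
  assumes "lam 7 = 1"
    and "nonsingular_curve lam"
    and "kleinian_sigma lam \<sigma>"
    and "\<sigma> u \<noteq> 0"
  shows "
      p333^2 = 4 * p33^3 + 4 * l4 + 4 * l5 * p33 + 4 * l6 * p33^2 - 4 * p13 + 4 * p22
        + 4 * p33 * p23 \<and>
      p233 * p333 = 4 * p23 * p33^2 + 2 * l3 + 2 * l5 * p23 + 4 * l6 * p33 * p23 + 2 * p12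
        + 4 * p33 * p13 - 2 * p33 * p22 + 2 * p23^2 \<and>
      p233^2 = 8 * p23 * p13 - 4 * p23 * p22 + 4 * p11 + 4 * l2 + 4 * p23^2 * p33
        + 4 * l6 * p23^2 \<and>
      p223 * p333 = - 4 * p33 * p12 - 2 * p23 * p13 + 4 * p23 * p22 + 4 * l6 * p33 * p13
        + 2 * l5 * p33 * p23 + 4 * l4 * p23 - 2 * p11 + 2 * l5 * p13 - 2 * l3 * p33
        + 2 * p22 * p33^2 + 2 * p23^2 * p33 \<and>
      p133 * p333 = - 2 * p33 * p12 + 2 * p23 * p13 + 4 * l6 * p33 * p13 - 2 * p11
        + 2 * l5 * p13 + 4 * p13 * p33^2 \<and>
      p223 * p233 = 2 * l1 + 4 * l6 * p23 * p13 + 2 * p22 * p23 * p33 + 2 * p23^3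
        - 2 * p13 * p22 + 4 * p13^2 - 4 * p11 * p33 + 2 * l5 * p23^2 - 4 * l2 * p33
        + 2 * l3 * p23 \<and>
      p222 * p333 = - 16 * p13^2 - 4 * p22^2 + 20 * p13 * p22 - 2 * p12 * p23
        + 6 * p22 * p23 * p33 + 4 * p11 * p33 - 2 * p23^3 - 2 * l5 * l3 - 8 * l6 * p23 * p13
        - 2 * l5^2 * p23 - 2 * l5 * p12 - 4 * l4 * p22 + 16 * l4 * p13 - 4 * l3 * p33^2
        + 8 * l4 * p33 * p23 - 2 * l5 * p33 * p22 - 4 * l6 * p33 * p12 + 8 * l5 * p33 * p13
        + 8 * l6 * p23 * p22 + 8 * l6 * l4 * p23 - 4 * l6 * l3 * p33 - 4 * l5 * p23^2
        - 2 * l3 * p23 \<and>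
      p133 * p233 = 2 * l1 + 4 * l6 * p23 * p13 + 4 * p13 * p23 * p33 - 2 * p13 * p22
        - 2 * p12 * p23 + 4 * p13^2 \<and>
      p123 * p333 = 2 * p11 * p33 - 4 * p13^2 + 4 * p13 * p22 + 4 * l4 * p13
        + 2 * p12 * p33^2 + 2 * p13 * p23 * p33 + 2 * l5 * p33 * p13 \<and>
      p223^2 = 4 * p33 * D - 4 * p23 * p11 - 4 * p13 * p12 + 4 * l0 - 4 * l3 * p33 * p23
        + 4 * l6 * p13^2 + 4 * l5 * p23 * p13 + 4 * l2 * p33^2 + 4 * l4 * p23^2
        - 4 * l1 * p33 + 4 * p22 * p23^2 \<and>
      p133 * p223 = 4 * l0 - 2 * p23 * p11 - 4 * p13 * p12 + 4 * l6 * p13^2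
        + 2 * l5 * p23 * p13 - 2 * l1 * p33 + 2 * p13 * p23^2 + 2 * p13 * p33 * p22 \<and>
      p133^2 = 4 * p13^2 * p33 - 4 * p13 * p12 + 4 * l0 + 4 * l6 * p13^2 \<and>
      p222 * p233 = - 8 * p33 * D - 4 * p23 * p11 + 4 * l6 * l3 * p23 - 4 * l6 * D
        - 4 * l6 * p13^2 - 8 * l6 * l2 * p33 + 2 * l5 * p23 * p22 + 8 * p13 * p12
        - 2 * p22 * p12 - 4 * l2 * l5 + 4 * l3 * p33 * p23 + 2 * p22^2 * p33
        + 2 * p22 * p23^2 - 8 * l2 * p33^2 + 4 * l6 * p13 * p22 - 4 * l6 * p11 * p33
        - 4 * l1 * p33 - 4 * l5 * p11 + 8 * l3 * p13 - 2 * l3 * p22 - 4 * l2 * p23 \<and>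
      p123 * p233 = 2 * p13 * p12 + 2 * l5 * p23 * p13 - 2 * l1 * p33 + 2 * p13 * p23^2
        + 2 * p12 * p33 * p23 + 2 * l3 * p13 \<and>
      p122 * p333 = 4 * p33 * D - 2 * l5 * p33 * p12 - 8 * l6 * p13^2 + 8 * l6 * l4 * p13
        + 8 * l4 * p33 * p13 + 6 * p13 * p12 - 4 * l5 * p23 * p13 - 2 * l5^2 * p13
        - 4 * l4 * p12 + 2 * l5 * p11 + 2 * l3 * p13 + 8 * l6 * p13 * p22
        + 4 * l6 * p11 * p33 - 2 * p13 * p23^2 + 2 * p13 * p33 * p22 + 4 * p12 * p33 * p23
        - 4 * p22 * p12 + 4 * p23 * p11 \<and>
      p113 * p333 = - 2 * p33 * D + 2 * p23 * p11 + 2 * p13 * p12 + 2 * p13^2 * p33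
        + 2 * p11 * p33^2 + 2 * l3 * p13 \<and>
      p222 * p223 = - 4 * l6 * p23 * p11 - 4 * p23 * D + 4 * l5 * p12 * p23
        - 4 * l5 * p11 * p33 + 4 * l4 * p23 * p22 - 2 * l3 * p33 * p22 - 4 * l6 * l1 * p33
        + 2 * l5 * l3 * p23 - 4 * l2 * p33 * p23 - 4 * l2 * l5 * p33 - 8 * l4 * p11
        + 2 * l3 * p23^2 + 4 * l3 * p12 + 8 * l2 * p13 - 8 * l2 * p22 - 2 * l1 * p23
        - 8 * l0 * p33 + 4 * p22^2 * p23 + 4 * l5 * p13^2 - 6 * p22 * p11 + 2 * p12^2
        + 2 * l3^2 - 8 * l2 * l4 - 2 * l5 * l1 \<and>
      p133 * p222 = - 4 * l6 * p23 * p11 - 4 * p23 * D + 2 * l5 * p12 * p23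
        - 4 * l6 * l1 * p33 - 2 * p12 * p23^2 - 2 * l1 * p23 - 8 * l0 * p33 + 4 * l5 * p13^2
        - 8 * p13 * p11 + 2 * p22 * p11 - 2 * l5 * l1 + 4 * p13 * p23 * p22
        + 2 * p12 * p33 * p22 - 4 * l1 * p33^2 \<and>
      p123 * p223 = 2 * p23 * D + 2 * p12 * p23^2 - 4 * l0 * p33 - 2 * p13 * p11
        + 2 * l5 * p13^2 - 2 * l3 * p33 * p13 + 4 * l4 * p23 * p13 + 2 * p13 * p23 * p22
        + 2 * l1 * p33^2 \<and>
      p123 * p133 = - 4 * l0 * p33 - 2 * p13 * p11 + 2 * p13^2 * p23 + 2 * p12 * p13 * p33
        + 2 * l5 * p13^2 \<and>
      p122 * p233 = 2 * l5 * p12 * p23 - 2 * l5 * p11 * p33 - 4 * l6 * l1 * p33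
        + 2 * p12 * p23^2 - 2 * l3 * p12 + 4 * l2 * p13 - 4 * l1 * p23 - 2 * l5 * p13^2
        + 4 * p13 * p11 - 2 * p12^2 - 2 * l5 * l1 + 4 * l6 * p13 * p12 + 4 * l6 * l3 * p13
        + 4 * l3 * p33 * p13 + 2 * p12 * p33 * p22 + 2 * l5 * D - 4 * l1 * p33^2 \<and>
      p113 * p233 = - 2 * p23 * D + 4 * l2 * p13 - 2 * l1 * p23 + 4 * p13 * p11
        + 2 * p13^2 * p23 + 2 * p11 * p23 * p33 \<and>
      p112 * p333 = 4 * l6 * p23 * p11 + 2 * p23 * D - 2 * l5 * p11 * p33 - 2 * l3 * p12
        - 2 * p13^2 * p23 - 2 * l5 * p13^2 + 4 * p13 * p11 - 2 * p22 * p11 - 2 * p12^2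
        + 4 * l6 * p13 * p12 + 4 * l6 * l3 * p13 + 4 * l3 * p33 * p13 + 4 * p12 * p13 * p33
        + 2 * p11 * p23 * p33 + 2 * l5 * D \<and>
      p222^2 = - 8 * l3 * p23 * p13 + 8 * p23 * l5 * l2 - 8 * l5 * l3 * p13
        + 4 * p23 * p22 * l3 - 16 * l6 * l4 * p11 - 16 * l6 * l2 * p22 + 4 * l5 * l3 * p22
        - 16 * l2 * l4 * p33 - 8 * p33 * l1 * l5 + 8 * l3 * p12 * l6 + 16 * l0 * p33^2
        - 4 * p12^2 * p33 - 4 * p11 * p23^2 + 8 * p12 * p13 * p23 - 8 * l1 * p33 * p23
        + 16 * l6 * p13 * p11 + 16 * l6 * l2 * p13 + 4 * p11 * p22 * p33 - 4 * p13^2 * p22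
        + 16 * l1 * p13 - 16 * l1 * l4 - 16 * l6 * l4 * l2 - 16 * p22 * p11 * l6
        - 16 * p22 * l2 * p33 + 4 * l5 * p22 * p12 + 4 * l6 * l3^2 + 4 * l5^2 * l2
        + 4 * p23^2 * l2 + 4 * p22^2 * l4 + 4 * p12^2 * l6 + 4 * l5^2 * p11 + 4 * l3^2 * p33
        - 16 * l4 * D - 8 * l3 * p11 + 32 * p13 * D - 20 * p22 * D - 8 * l5 * p13 * p12
        + 4 * p22^3 - 16 * l1 * p22 + 16 * l2 * p33 * p13 - 8 * p12 * p11 + 16 * l4 * p13^2 \<and>
      p123 * p222 = - 2 * p33 * l1 * l5 + 4 * p13 * p22 * l4 + 4 * l4 * p11 * p33
        - 2 * p23 * l5 * p11 - 4 * l1 * p22 + 8 * p13 * D - 2 * p22 * D - 2 * p12 * p11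
        + 4 * p12 * p13 * p23 - 2 * l1 * p33 * p23 + 2 * p11 * p22 * p33 + 4 * l4 * p13^2
        + 8 * l0 * p33^2 - 2 * p12^2 * p33 - 2 * p11 * p23^2 - 2 * l3 * p33 * p12
        + 2 * p13 * p22^2 - 2 * l3 * p11 - 4 * l4 * D - 2 * p13^2 * p22 + 4 * l1 * p13
        - 4 * l1 * l4 + 2 * p12 * p23 * p22 \<and>
      p123^2 = 4 * p13 * D + 4 * p12 * p13 * p23 + 4 * l4 * p13^2 + 4 * l0 * p33^2 \<and>
      p122 * p223 = - 4 * l1 * l4 - 2 * p33 * l1 * l5 + 4 * l5 * p13 * p12
        + 4 * l3 * p23 * p13 + 4 * p13 * p22 * l4 - 4 * l1 * p22 - 8 * l6 * l0 * p33
        - 4 * l6 * p13 * p11 - 4 * l5 * l0 - 12 * p13 * D + 4 * p22 * D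
        - 4 * p12 * p13 * p23 + 2 * p13^2 * p22 + 6 * l1 * p13 - 8 * l0 * p23
        - 8 * l4 * p13^2 - 8 * l0 * p33^2 + 2 * p12^2 * p33 + 2 * p11 * p23^2
        - 4 * l2 * p33 * p13 - 2 * p11 * p22 * p33 - 2 * l3 * p11 + 2 * l5 * l3 * p13
        + 4 * p12 * p23 * p22 \<and>
      p122 * p133 = - 4 * p13 * D + 2 * p12 * p11 - 4 * l5 * l0 + 2 * p12^2 * p33
        + 2 * p13^2 * p22 - 8 * l6 * l0 * p33 + 2 * l5 * p13 * p12 - 4 * l6 * p13 * p11
        + 2 * l1 * p13 - 8 * l0 * p23 - 8 * l0 * p33^2 \<and>
      p113 * p223 = - 4 * p13 * D + 2 * p11 * p23^2 + 2 * l3 * p23 * p13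
        + 2 * l1 * p33 * p23 - 4 * l2 * p33 * p13 + 2 * p13^2 * p22 + 2 * l1 * p13
        - 4 * l0 * p23 \<and>
      p113 * p133 = - 2 * p13 * D + 2 * p11 * p13 * p33 + 2 * p13^3 + 2 * l1 * p13
        - 4 * l0 * p23 \<and>
      p112 * p233 = 8 * p13 * D - 2 * p22 * D - 4 * p12 * p11 + 4 * p12 * p13 * p23
        - 4 * l1 * p33 * p23 + 8 * l2 * p33 * p13 + 8 * l6 * p13 * p11 + 8 * l6 * l2 * p13
        + 2 * p11 * p22 * p33 - 4 * l6 * l1 * p23 - 4 * l2 * p12 - 2 * p13^2 * p22
        - 4 * l1 * p13 + 2 * l1 * p22 \<and>
      p111 * p333 = 2 * l5 * p13 * p12 + 2 * l3 * p23 * p13 + 6 * p11 * p13 * p33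
        - 4 * l4 * p11 * p33 + 2 * p23 * l5 * p11 - 4 * p12 * p13 * p23
        - 2 * p11 * p22 * p33 + 2 * p13^2 * p22 - 4 * l4 * p13^2 + 2 * p12^2 * p33
        + 2 * p11 * p23^2 + 2 * l5 * l3 * p13 + 4 * l4 * D - 10 * p13 * D + 4 * p22 * D
        - 2 * p13^3 + 2 * l3 * p33 * p12 \<and>
      p122 * p222 = - 8 * l6 * l4 * l1 - 4 * l2 * p33 * p12 - 6 * l1 * p33 * p22
        + 4 * l3 * p13 * p22 - 16 * l0 * p22 + 2 * l1 * p23^2 + 4 * l5 * l1 * p23
        + 8 * l6 * l1 * p13 - 8 * l5 * l0 * p33 + 4 * l4 * p22 * p12 - 8 * l1 * l4 * p33
        - 4 * l6 * p12 * p11 - 8 * l6 * l1 * p22 - 4 * l6 * l3 * p11 + 4 * p12 * p22^2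
        + 2 * l5 * p12^2 - 4 * p12 * D - 16 * l4 * l0 - 2 * l1 * p12 - 4 * l3 * D
        - 4 * l2 * p11 + 2 * l5 * l3 * p12 + 16 * l0 * p13 + 2 * l5^2 * l1
        - 2 * l5 * p22 * p11 - 2 * l3 * l1 \<and>
      p122 * p123 = 2 * p12^2 * p23 - 8 * l4 * l0 + 2 * p12 * D + 2 * p11^2
        + 2 * p12 * p22 * p13 + 4 * l4 * p13 * p12 - 2 * l5 * p13 * p11 - 2 * l1 * p33 * p13
        - 4 * l5 * l0 * p33 - 8 * l0 * p22 + 2 * l3 * p13^2 + 8 * l0 * p13 \<and>
      p113 * p222 = 2 * l3 * p11 * p33 + 8 * l0 * p33 * p23 - 2 * p12^2 * p23 - 2 * l3 * l1
        - 4 * p12 * D - 4 * p11^2 - 8 * l1 * p33 * p13 - 4 * l2 * p33 * p12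
        + 2 * l1 * p33 * p22 + 2 * l3 * p13 * p22 + 2 * l3 * p13^2 - 2 * l1 * p12
        + 4 * p12 * p22 * p13 + 2 * p11 * p22 * p23 - 2 * l3 * D - 4 * l2 * p11 \<and>
      p113 * p123 = 4 * l0 * p33 * p23 + 2 * p13^2 * p12 + 2 * p11 * p13 * p23
        - 2 * l1 * p33 * p13 + 2 * l3 * p13^2 \<and>
      p112 * p223 = - 8 * l0 * p33 * p23 + 2 * p12^2 * p23 - 2 * l3 * l1 - 4 * p11^2
        + 2 * p11 * p22 * p23 + 4 * l5 * p13 * p11 + 4 * l1 * p33 * p13 + 4 * l2 * l5 * p13
        - 8 * l6 * l0 * p23 + 4 * l2 * p23 * p13 + 2 * l3 * p13 * p22 - 4 * l2 * p11
        + 4 * l6 * l1 * p13 + 4 * l0 * p22 - 2 * l1 * p23^2 - 4 * l3 * p13^2 - 4 * l1 * p12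
        - 8 * l0 * p13 - 2 * l5 * l1 * p23 \<and>
      p112 * p133 = - 8 * l0 * p33 * p23 + 2 * p13^2 * p12 - 2 * p12 * D
        + 2 * p11 * p33 * p12 + 4 * l1 * p33 * p13 - 8 * l6 * l0 * p23 + 4 * l6 * l1 * p13
        + 4 * l0 * p22 - 2 * l1 * p12 - 8 * l0 * p13 \<and>
      p111 * p233 = - 2 * l3 * p11 * p33 - 2 * p13^2 * p12 + 2 * p12 * D
        + 4 * p11 * p13 * p23 + 2 * p11 * p33 * p12 + 4 * l2 * l5 * p13 + 4 * l2 * p23 * p13
        + 4 * l2 * p33 * p12 - 2 * l1 * p33 * p22 - 2 * l5 * l1 * p23 + 4 * l5 * p13 * p11
        + 4 * l1 * p33 * p13 - 2 * l1 * p23^2 - 2 * l3 * p13^2 + 2 * l3 * D \<and>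
      p122^2 = - 16 * l6 * l4 * l0 + 4 * p12^2 * p22 + 4 * p11 * D + 4 * l5^2 * l0
        - 8 * l3 * l0 - 4 * l5 * p12 * p11 - 4 * l1 * p11 + 4 * l2 * p13^2
        - 16 * l4 * l0 * p33 - 4 * l1 * p23 * p13 + 8 * l5 * l0 * p23 - 8 * l0 * p33 * p22
        - 8 * l0 * p12 + 4 * l3 * p13 * p12 - 4 * l1 * p33 * p12 + 4 * l6 * p11^2
        + 8 * l0 * p23^2 + 16 * l6 * l0 * p13 + 4 * l4 * p12^2 - 16 * l6 * l0 * p22 \<and>
      p113 * p122 = 2 * p13 * p12^2 - 4 * l3 * l0 + 2 * p11 * p13 * p22 - 8 * l0 * p33 * p13
        + 4 * l0 * p23^2 - 2 * l1 * p11 + 4 * l2 * p13^2 - 4 * l1 * p23 * p13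
        + 4 * l0 * p33 * p22 - 4 * l0 * p12 + 2 * l3 * p13 * p12 - 2 * l1 * p33 * p12 \<and>
      p113^2 = 4 * p11 * p13^2 + 4 * l0 * p23^2 + 4 * l2 * p13^2 - 4 * l1 * p23 * p13 \<and>
      p112 * p222 = 2 * p11 * p22^2 + 2 * p12^2 * p22 - 4 * l6 * l3 * l1 - 8 * p11 * D
        - 8 * l3 * l0 - 8 * l2 * p11 * p33 - 4 * l3 * l1 * p33 - 8 * l6 * l2 * p11
        + 2 * l3 * p22 * p12 - 2 * l5 * l1 * p22 + 8 * l5 * l1 * p13 - 8 * l0 * p23^2
        - 4 * l1 * p11 + 8 * l1 * p23 * p13 - 8 * l5 * l0 * p23 - 8 * l0 * p12
        - 4 * l1 * p33 * p12 + 4 * l2 * p12 * p23 + 4 * l5 * p12 * p11 - 2 * l1 * p23 * p22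
        - 4 * l6 * l1 * p12 - 8 * l6 * p11^2 + 4 * l2 * l5 * p12 \<and>
      p112 * p123 = 2 * p13 * p12^2 - 4 * l3 * l0 + 2 * p11 * p23 * p12 + 2 * l5 * l1 * p13
        - 4 * l0 * p23^2 - 2 * l1 * p11 + 2 * l1 * p23 * p13 - 4 * l5 * l0 * p23
        - 4 * l0 * p12 + 2 * l3 * p13 * p12 \<and>
      p111 * p223 = - 2 * p13 * p12^2 + 4 * p11 * D + 2 * p11 * p13 * p22
        + 4 * p11 * p23 * p12 - 4 * l2 * p11 * p33 - 2 * l3^2 * p13 + 2 * l3 * l1 * p33
        + 8 * l4 * p13 * p11 - 2 * l3 * p23 * p11 - 4 * l1 * l4 * p23 + 2 * l5 * l1 * p13
        + 6 * l1 * p23 * p13 - 4 * l5 * l0 * p23 - 4 * l0 * p33 * p22 - 4 * l3 * p13 * p12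
        + 4 * l1 * p33 * p12 + 8 * l2 * l4 * p13 + 8 * l2 * D - 4 * l1 * p23 * p22
        + 8 * l0 * p33 * p13 + 8 * l2 * p12 * p23 - 4 * l0 * p23^2 \<and>
      p111 * p133 = 2 * p11^2 * p33 - 2 * p11 * D + 8 * l0 * p33 * p13 + 2 * p11 * p13^2
        + 2 * l5 * l1 * p13 - 4 * l0 * p23^2 + 2 * l1 * p23 * p13 - 4 * l5 * l0 * p23
        - 4 * l0 * p33 * p22 + 2 * l1 * p33 * p12 \<and>
      p112 * p122 = 2 * p11 * p12 * p22 + 2 * l1^2 - 8 * l2 * l0 - 8 * l6 * l3 * l0
        + 2 * p12^3 - 8 * l3 * l0 * p33 + 2 * l5 * l1 * p12 + 4 * l1 * p13^2
        - 8 * l6 * l0 * p12 + 4 * l2 * p13 * p12 + 8 * l5 * l0 * p13 - 4 * l1 * p11 * p33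
        - 2 * l1 * p13 * p22 - 8 * l0 * p33 * p12 - 4 * l6 * l1 * p11 - 8 * l0 * p11
        - 4 * l5 * l0 * p22 + 2 * l3 * p12^2 \<and>
      p112 * p113 = 4 * p11 * p12 * p13 + 2 * l1^2 - 8 * l2 * l0 + 4 * l0 * p23 * p22
        + 2 * l1 * D - 8 * l0 * p23 * p13 + 6 * l1 * p13^2 + 4 * l2 * p13 * p12
        - 2 * l1 * p11 * p33 - 4 * l1 * p13 * p22 - 8 * l0 * p11 \<and>
      p111 * p222 = 18 * l1 * p13 * p22 + 8 * l3 * p13 * p11 + 2 * l1 * p11 * p33
        + 6 * p11 * p12 * p22 - 16 * l4 * l0 * p23 + 8 * l4 * p12 * p11 + 8 * l3 * l0 * p33
        - 14 * l1 * p13^2 - 4 * l3 * p12^2 + 2 * l1 * D - 4 * l5 * p11^2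
        - 16 * l0 * p23 * p22 + 16 * l0 * p23 * p13 + 16 * l1 * l4 * p13
        + 8 * l0 * p33 * p12 - 2 * l5 * l1 * p12 - 2 * l3 * l1 * p23 - 4 * l2 * l5 * p11
        - 4 * l2 * p23 * p11 + 8 * l2 * l4 * p12 - 2 * l3 * p22 * p11 - 2 * l3^2 * p12
        - 4 * l1 * l4 * p22 + 8 * l2 * p22 * p12 - 4 * l1 * p22^2 - 8 * l2 * p13 * p12
        - 2 * l5 * l3 * l1 - 2 * p12^3 \<and>
      p111 * p123 = 2 * p11^2 * p23 + 2 * p11 * p12 * p13 - 8 * l0 * p23 * p22
        + 8 * l0 * p23 * p13 + 4 * l1 * l4 * p13 + 4 * l3 * l0 * p33 - 4 * l1 * p13^2
        + 2 * l1 * p11 * p33 + 4 * l1 * p13 * p22 - 8 * l4 * l0 * p23 + 2 * l3 * p13 * p11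
        + 4 * l0 * p33 * p12 \<and>
      p112^2 = - 16 * l0 * D + 4 * l6 * l1^2 - 16 * l6 * l2 * l0 + 4 * p11 * p12^2
        + 8 * l1 * p13 * p12 - 16 * l6 * l0 * p11 - 16 * l0 * p12 * p23 - 16 * l2 * l0 * p33
        + 4 * l0 * p22^2 - 4 * l1 * p22 * p12 + 4 * l2 * p12^2 + 4 * l1^2 * p33 \<and>
      p111 * p122 = 2 * p11^2 * p22 - 4 * l5 * l3 * l0 + 2 * p11 * p12^2 - 8 * l3 * l0 * p23
        - 4 * l1 * p23 * p11 + 4 * l2 * p13 * p11 + 8 * l0 * p11 * p33 - 2 * l1 * p13 * p12
        + 4 * l1 * l4 * p12 - 2 * l5 * l1 * p11 - 4 * l5 * l0 * p12 - 8 * l4 * l0 * p22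
        - 8 * l0 * p12 * p23 + 8 * l2 * l0 * p33 - 8 * l0 * p22^2 + 4 * l1 * p22 * p12
        - 2 * l1^2 * p33 + 24 * l0 * p13 * p22 + 16 * l4 * l0 * p13 + 2 * l3 * l1 * p13
        + 2 * l3 * p12 * p11 - 16 * l0 * p13^2 \<and>
      p111 * p113 = 4 * p11^2 * p13 - 4 * l3 * l0 * p23 - 2 * l1 * p23 * p11
        + 4 * l2 * p13 * p11 + 8 * l0 * p11 * p33 + 2 * l1 * p13 * p12 + 2 * l3 * l1 * p13
        - 4 * l0 * p12 * p23 + 8 * l2 * l0 * p33 - 2 * l1^2 * p33 \<and>
      p111 * p112 = 2 * l5 * l1^2 - 8 * l2 * l5 * l0 + 4 * p11^2 * p12 - 8 * l0 * p23 * p11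
        + 2 * l3 * l1 * p12 - 4 * l0 * p22 * p12 - 8 * l2 * l0 * p23 + 8 * l0 * p13 * p12
        + 4 * l1 * p13 * p11 - 4 * l3 * l0 * p22 + 4 * l2 * p12 * p11 - 2 * l1 * p22 * p11
        + 8 * l3 * l0 * p13 - 8 * l5 * l0 * p11 + 2 * l1 * p12^2 + 2 * l1^2 * p23 \<and>
      p111^2 = 4 * p11^3 + 4 * l1^2 * l4 + 4 * l3^2 * l0 - 16 * l2 * l4 * l0
        + 8 * l3 * l0 * p12 + 4 * l0 * p12^2 + 4 * l2 * p11^2 - 16 * l2 * l0 * p22
        + 16 * l0 * p13 * p11 - 16 * l0 * p22 * p11 + 4 * l1 * p12 * p11
        + 16 * l2 * l0 * p13 + 4 * l3 * l1 * p11 - 16 * l4 * l0 * p11 - 4 * l1^2 * p13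
        + 4 * l1^2 * p22"
proof -
  obtain \<rho> g A where chart: "\<rho> > 0" "g holomorphic_on ball 0 \<rho>" "\<And>s. g (- s) = g s"
    "\<And>s. s \<in> ball 0 \<rho> \<Longrightarrow> g s \<noteq> 0"
    "\<And>s. s \<noteq> 0 \<Longrightarrow> (g s / s ^ 7)\<^sup>2 = curve_poly lam (1 / s\<^sup>2)"
    "\<And>s. A (- s) = - A s"
    "\<And>s. s \<in> ball 0 \<rho> \<Longrightarrow> (A has_derivative (\<lambda>h. h *s omega g s)) (at s)"
    by (rule exists_infinity_chart[of lam, OF \<open>lam 7 = 1\<close>]) (rule that, assumption+)
  interpret kleinian_chart lam \<sigma> \<rho> g A
    by unfold_locales (fact chart \<open>lam 7 = 1\<close> \<open>kleinian_sigma lam \<sigma>\<close>)+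
  define p where "p = p_coeffs \<sigma> u"
  define q where "q = q_coeffs \<sigma> u"
  define r where "r = r_coeffs lam \<sigma> u"
  note rel = minor_relations_everywhere[OF \<open>\<sigma> u \<noteq> 0\<close>, unfolded minor_relations_def Let_def,
      folded p_def q_def r_def
        l0_def l1_def l2_def l3_def l4_def l5_def l6_def p11_def p12_def p13_def p22_def p23_def p33_def
        p111_def p112_def p113_def p122_def p123_def p133_def p222_def p223_def p233_def p333_def]
  have p: "p 0 = - p13" "p (Suc 0) = - p23" "p 2 = - p33" "p 3 = 1" "p 4 = 0"
    and q: "q 0 = p133" "q (Suc 0) = p233" "q 2 = p333" "q 3 = 0" "q 4 = 0"
    and r: "r 0 = - p12 + p13 * (l6 + p33)" "r (Suc 0) = 2 * p13 - p22 + p23 * (l6 + p33)"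
      "r 2 = l5 + p23 + p33 * (l6 + p33)" "r 3 = l6 + p33" "r 4 = 1"
    by (simp_all add: p_def q_def r_def p_coeffs_def q_coeffs_def r_coeffs_def Let_def
        p12_def p13_def p22_def p23_def p33_def p133_def p233_def p333_def l5_def l6_def)
  have sym: "gram p q r i j = gram p q r j i" for i j
    by (simp add: gram_def)
  have G: "gram p q r 0 0 = 2 * l0" "gram p q r 0 1 = l1" "gram p q r 0 2 = - p11"
    "gram p q r 1 1 = 2 * l2 + 2 * p11" "gram p q r 1 2 = l3 + p12"
    "gram p q r 2 2 = 2 * l4 - 2 * p13 + 2 * p22"
    using rel by simp_all
  have H:
    "gram p q r 0 0 = 2 * l0" "gram p q r 0 1 = l1" "gram p q r 0 2 = - p11"
    "gram p q r 1 0 = l1" "gram p q r 1 1 = 2 * l2 + 2 * p11" "gram p q r 1 2 = l3 + p12"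
    "gram p q r 2 0 = - p11" "gram p q r 2 1 = l3 + p12"
    "gram p q r 2 2 = 2 * l4 - 2 * p13 + 2 * p22"
    using G sym[of 1 0] sym[of 2 0] sym[of 2 1] by simp_all
  \<comment> \<open>Entries with an index 3 or 4 follow from the choice of the coefficients alone.
    Together with \<open>H\<close> this covers all 25 entries, each affine in the 2-index
    functions.\<close>
  have H':
    "gram p q r 0 3 = - p12" "gram p q r 0 4 = - p13" "gram p q r 1 3 = 2 * p13 - p22"
    "gram p q r 1 4 = - p23" "gram p q r 2 3 = l5 + p23" "gram p q r 2 4 = - p33"
    "gram p q r 3 0 = - p12" "gram p q r 3 1 = 2 * p13 - p22" "gram p q r 3 2 = l5 + p23"
    "gram p q r 3 3 = 2 * l6 + 2 * p33" "gram p q r 3 4 = 1" "gram p q r 4 0 = - p13"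
    "gram p q r 4 1 = - p23" "gram p q r 4 2 = - p33" "gram p q r 4 3 = 1" "gram p q r 4 4 = 0"
    by (simp_all add: gram_def p q r algebra_simps)
  \<comment> \<open>All ten 3-index functions as combinations of minors. For the last three,
    \<open>p\<close> has the entries 1, 0 and \<open>q\<close> the entries 0, 0 in columns 3 and 4,
    and \<open>r 4 = 1\<close>, so the minor of columns \<open>i\<close>, 3, 4 is
    \<open>- q i\<close>.\<close>
  have T:
    "p111 = - minor p q r 0 1 2" "p112 = - minor p q r 0 1 3"
    "p122 = - minor p q r 0 2 3 - minor p q r 0 1 4"
    "p222 = - minor p q r 1 2 3 - 2 * minor p q r 0 2 4" "p113 = - minor p q r 0 1 4"
    "p123 = - minor p q r 0 2 4" "p223 = - minor p q r 1 2 4 - minor p q r 0 3 4"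
    "p133 = - minor p q r 0 3 4" "p233 = - minor p q r 1 3 4" "p333 = - minor p q r 2 3 4"
    using rel by (simp_all add: minor_def p q r)
  show ?thesis
    \<comment> \<open>Every product expands into products of two minors, hence into 3 x 3 minors of
      the \<open>gram\<close> matrix, whose degree in the 2-index functions is at most three; the
      square of the minor of columns 2, 3, 4 gives the relation for \<open>p333^2\<close>.
      \<open>One_nat_def\<close> adapts the index 1 to the normal form \<open>Suc 0\<close>.\<close>
    by (intro conjI)
       (simp_all add: T D_def minor_times_minor minor_times_minor_left H[unfolded One_nat_def] H'[unfolded One_nat_def]
         algebra_simps power2_eq_square power3_eq_cube)
qed

end
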